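(* Let $A_1, A_2 \in \mathcal M_2(\mathbb C)$, $B \in \mathcal M_{2,1}(\mathbb C)$ with $B \neq 0$, $T \in (0,+\infty)$, and $(\Lambda_1,\Lambda_2) \in (0,+\infty)^2$ with $\Lambda_1 > \Lambda_2$. Consider the system $$x(t) = A_1 x(t-\Lambda_1) + A_2 x(t-\Lambda_2) + B u(t), \qquad x(t)\in\mathbb C^2,\ u(t)\in\mathbb C. \quad (\Sigma)$$ (a) If $\operatorname{Ran} A_1 \subset \operatorname{Ran} B$, or if both pairs $(A_1,B)$ and $(A_2,B)$ are not controllable, then $(\Sigma)$ is neither approximately nor exactly controllable in time $T$. (b) If $\operatorname{Ran} A_1 \not\subset \operatorname{Ran} B$ and exactly one of the pairs $(A_1,B)$, $(A_2,B)$ is controllable, then the following are equivalent: (i) $(\Sigma)$ is approximately controllable in time $T$; (ii) $(\Sigma)$ is exactly controllable in time $T$; (iii) $T \geq 2\Lambda_1$. (c) If $(A_1,B)$ and $(A_2,B)$ are both controllable, let $B^\perp\in\mathbb C^2$ be the unique vector such that $\det\begin{pmatrix} B & B^\perp\end{pmatrix} = 1$ and $B^* B^\perp = 0$ (where $B^*$ is the conjugate transpose of $B$), and set $$\beta = \frac{\det \mathcal C(A_1,B)}{\det\mathcal C(A_2,B)}, \qquad \alpha = \det\begin{pmatrix} B & (A_1-\beta A_2)B^\perp\end{pmatrix}.$$ Let $\mathcal S\subset\mathbb C$ be the set of all possible complex values of the expression $\beta + \alpha^{1-\Lambda_2/\Lambda_1}$. Then: (i) $(\Sigma)$ is approximately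 controllable in time $T$ if and only if $T\geq 2\Lambda_1$ and $0\notin\mathcal S$; (ii) $(\Sigma)$ is exactly controllable in time $T$ if and only if $T\geq 2\Lambda_1$ and $0\notin\overline{\mathcal S}$.
   Context: $\operatorname{Ran}$ denotes the range of a matrix. For $A\in\mathcal M_2(\mathbb C)$ and $B\in\mathcal M_{2,1}(\mathbb C)$, $\mathcal C(A,B) = \begin{pmatrix} B & AB\end{pmatrix}\in\mathcal M_2(\mathbb C)$, and $(A,B)$ is controllable if $\mathcal C(A,B)$ has rank $2$. Explicitly, writing $\alpha=|\alpha|e^{i\theta}$ with $\theta\in(-\pi,\pi]$, $$\mathcal S = \left\{\beta + |\alpha|^{1-\Lambda_2/\Lambda_1} e^{i(\theta+2k\pi)(1-\Lambda_2/\Lambda_1)} : k\in\mathbb Z\right\}$$ (so $\mathcal S=\{\beta\}$ if $\alpha=0$), and $\overline{\mathcal S}$ is its closure in $\mathbb C$. Solutions and controllability. Let $\mathsf X = L^2((-\Lambda_1,0),\mathbb C^2)$ and $\mathsf Y_T = L^2((0,T),\mathbb C)$. For $x_0\in\mathsf X$ and $u\in\mathsf Y_T$, the solution of $(\Sigma)$ with initial condition $x_0$ and control $u$ is the unique (up to a.e. equality) function $x:(-\Lambda_1,T)\to\mathbb C^2$ equal to $x_0$ on $(-\Lambda_1,0)$ and satisfying the equation for (almost) every $t\in(0,T)$. For $t \in [0,T]$, $x_t\in\mathsf X$ is $x_t(s)=x(t+s)$, $s\in(-\Lambda_1,0)$. System $(\Sigma)$ is approximately controllable in time $T$ if for every $x_0,y\in\mathsf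 X$ and $\varepsilon>0$ there is $u\in\mathsf Y_T$ such that the solution satisfies $\|x_T-y\|_{\mathsf X}<\varepsilon$; it is exactly controllable in time $T$ if for every $x_0,y\in\mathsf X$ there is $u\in\mathsf Y_T$ such that the solution satisfies $x_T=y$. *)

theory Defs
  imports "HOL-Analysis.Analysis"
begin

definition Ran :: "complex^'n^'m \<Rightarrow> (complex^'m) set" where
  "Ran M = range (\<lambda>v. M *v v)"

definition two_columns :: "complex^2 \<Rightarrow> complex^2 \<Rightarrow> complex^2^2" where
  "two_columns p q = (\<chi> i j. if j = 1 then p $ i else q $ i)"

definition conj_transpose :: "complex^'n^'m \<Rightarrow> complex^'m^'n" where
  "conj_transpose M = map_matrix cnj (transpose M)"

definition ctrb :: "complex^2^2 \<Rightarrow> complex^1^2 \<Rightarrow> complex^2^2" where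
  "ctrb A B = two_columns (column 1 B) (column 1 (A ** B))"

definition controllable :: "complex^2^2 \<Rightarrow> complex^1^2 \<Rightarrow> bool" where
  "controllable A B \<longleftrightarrow> rank (ctrb A B) = 2"

definition perp :: "complex^1^2 \<Rightarrow> complex^2" where
  "perp B = (THE p. det (two_columns (column 1 B) p) = 1 \<and> conj_transpose B *v p = 0)"

lemma perp_unique_existence:
  fixes B :: "complex^1^2"
  assumes "B \<noteq> 0"
  shows "\<exists>!p. det (two_columns (column 1 B) p) = 1 \<and> conj_transpose B *v p = 0"
proof -
  define a b where "a = B $ 1 $ 1" and "b = B $ 2 $ 1"
  define n where "n = a * cnj a + b * cnj b"
  have ab: "a \<noteq> 0 \<or> b \<noteq> 0"
    using assms by (auto simp: a_def b_def vec_eq_iff forall_2)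
  have n_eq: "n = of_real ((cmod a)\<^sup>2 + (cmod b)\<^sup>2)"
    by (simp only: n_def complex_norm_square of_real_add)
  have "(cmod a)\<^sup>2 + (cmod b)\<^sup>2 \<noteq> 0"
    using ab by (simp add: sum_power2_eq_zero_iff)
  then have n: "n \<noteq> 0"
    unfolding n_eq by (simp only: of_real_eq_0_iff not_False_eq_True)
  have char: "det (two_columns (column 1 B) p) = 1 \<and> conj_transpose B *v p = 0 \<longleftrightarrow>
      a * p $ 2 - p $ 1 * b = 1 \<and> cnj a * p $ 1 + cnj b * p $ 2 = 0" for p
    by (simp add: det_2 two_columns_def column_def conj_transpose_def map_matrix_def transpose_def
        matrix_vector_mult_def vec_eq_iff sum_2 a_def b_def)
  define q :: "complex^2" where "q = vector [- cnj b / n, cnj a / n]"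
  have q: "n * q $ 1 = - cnj b" "n * q $ 2 = cnj a"
    using n by (simp_all add: q_def vector_2)
  show ?thesis
    unfolding char
  proof (rule ex1I[of _ q])
    have "n * (a * q $ 2 - q $ 1 * b) = a * (n * q $ 2) - b * (n * q $ 1)"
      by (simp add: algebra_simps)
    also have "\<dots> = n * 1" unfolding q by (simp add: n_def)
    finally have 1: "a * q $ 2 - q $ 1 * b = 1" using n mult_left_cancel by blast
    have "n * (cnj a * q $ 1 + cnj b * q $ 2) = cnj a * (n * q $ 1) + cnj b * (n * q $ 2)"
      by (simp add: algebra_simps)
    also have "\<dots> = 0" unfolding q by simp
    finally show "a * q $ 2 - q $ 1 * b = 1 \<and> cnj a * q $ 1 + cnj b * q $ 2 = 0"
      using n 1 by simp
  next
    fix p :: "complex^2"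
    assume p: "a * p $ 2 - p $ 1 * b = 1 \<and> cnj a * p $ 1 + cnj b * p $ 2 = 0"
    have "n * p $ 1 = a * (cnj a * p $ 1 + cnj b * p $ 2) - cnj b * (a * p $ 2 - p $ 1 * b)"
      by (simp add: n_def algebra_simps)
    then have 1: "n * p $ 1 = - cnj b" using p by simp
    have "n * p $ 2 = b * (cnj a * p $ 1 + cnj b * p $ 2) + cnj a * (a * p $ 2 - p $ 1 * b)"
      by (simp add: n_def algebra_simps)
    then have 2: "n * p $ 2 = cnj a" using p by simp
    have "n * p $ 1 = n * q $ 1" "n * p $ 2 = n * q $ 2"
      using 1 2 q by simp_all
    then show "p = q"
      using n by (simp add: vec_eq_iff forall_2)
  qed
qed

text \<open>Representatives are used instead of classes modulo almost everywhere equality;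
  values outside \<open>S\<close> are irrelevant.\<close>

definition L2 :: "real set \<Rightarrow> (real \<Rightarrow> 'b::euclidean_space) set" where
  "L2 S = {f. f \<in> borel_measurable (lebesgue_on S) \<and>
              integrable (lebesgue_on S) (\<lambda>t. (norm (f t))\<^sup>2)}"

definition L2_norm :: "real set \<Rightarrow> (real \<Rightarrow> 'b::euclidean_space) \<Rightarrow> real" where
  "L2_norm S f = sqrt (integral\<^sup>L (lebesgue_on S) (\<lambda>t. (norm (f t))\<^sup>2))"

text \<open>For square-integrable \<open>x0\<close> and \<open>u\<close>, the two equations below determine \<open>x\<close> almost everywhere
  on \<open>(-\<Lambda>1, T)\<close> and make it square-integrable there. That membership is nevertheless spelled out,
  so that every \<open>L2_norm\<close> of a state difference below is visibly the norm of an element of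
  \<open>L2\<close>, not the default value of a non-convergent integral. As solutions exist and are unique almost
  everywhere, ``the solution satisfies'' is written as an existential over \<open>x\<close>.\<close>

definition solution ::
  "complex^2^2 \<Rightarrow> complex^2^2 \<Rightarrow> complex^1^2 \<Rightarrow> real \<Rightarrow> real \<Rightarrow> real \<Rightarrow>
   (real \<Rightarrow> complex^2) \<Rightarrow> (real \<Rightarrow> complex) \<Rightarrow> (real \<Rightarrow> complex^2) \<Rightarrow> bool" where
  "solution A1 A2 B \<Lambda>1 \<Lambda>2 T x0 u x \<longleftrightarrow>
     x \<in> L2 {-\<Lambda>1<..<T} \<and>
     (AE t in lebesgue_on {-\<Lambda>1<..<0}. x t = x0 t) \<and>
     (AE t in lebesgue_on {0<..<T}.
        x t = A1 *v x (t - \<Lambda>1) + A2 *v x (t - \<Lambda>2) + B *v vec (u t))"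

definition state :: "(real \<Rightarrow> complex^2) \<Rightarrow> real \<Rightarrow> real \<Rightarrow> complex^2" where
  "state x t = (\<lambda>s. x (t + s))"

definition approximately_controllable ::
  "complex^2^2 \<Rightarrow> complex^2^2 \<Rightarrow> complex^1^2 \<Rightarrow> real \<Rightarrow> real \<Rightarrow> real \<Rightarrow> bool" where
  "approximately_controllable A1 A2 B \<Lambda>1 \<Lambda>2 T \<longleftrightarrow>
     (\<forall>x0 \<in> L2 {-\<Lambda>1<..<0}. \<forall>y \<in> L2 {-\<Lambda>1<..<0}. \<forall>\<epsilon>>0.
        \<exists>u \<in> L2 {0<..<T}. \<exists>x. solution A1 A2 B \<Lambda>1 \<Lambda>2 T x0 u x \<and>
          L2_norm {-\<Lambda>1<..<0} (\<lambda>s. state x T s - y s) < \<epsilon>)"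

definition exactly_controllable ::
  "complex^2^2 \<Rightarrow> complex^2^2 \<Rightarrow> complex^1^2 \<Rightarrow> real \<Rightarrow> real \<Rightarrow> real \<Rightarrow> bool" where
  "exactly_controllable A1 A2 B \<Lambda>1 \<Lambda>2 T \<longleftrightarrow>
     (\<forall>x0 \<in> L2 {-\<Lambda>1<..<0}. \<forall>y \<in> L2 {-\<Lambda>1<..<0}.
        \<exists>u \<in> L2 {0<..<T}. \<exists>x. solution A1 A2 B \<Lambda>1 \<Lambda>2 T x0 u x \<and>
          (AE s in lebesgue_on {-\<Lambda>1<..<0}. state x T s = y s))"

text \<open>\<open>Arg\<close> takes values in \<open>(-\<pi>, \<pi>]\<close>. For \<open>\<alpha> = 0\<close> the only value is \<open>0\<close>, since
  \<open>0 powr r = 0\<close>.\<close>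

definition power_values :: "complex \<Rightarrow> real \<Rightarrow> complex set" where
  "power_values \<alpha> r =
     {complex_of_real (cmod \<alpha> powr r) * exp (\<i> * complex_of_real ((Arg \<alpha> + 2 * of_int k * pi) * r))
      | k :: int. True}"

end

theory Submission
  imports Defs
begin

text \<open>
  In the basis \<open>B\<close>, \<open>B\<^sup>\<bottom>\<close> write \<open>x = w B + z B\<^sup>\<bottom>\<close>. The control prescribes \<open>w\<close> freely, and what is left is the
  scalar equation \<open>z t = p1 w(t - \<Lambda>1) + q1 z(t - \<Lambda>1) + p2 w(t - \<Lambda>2) + q2 z(t - \<Lambda>2)\<close> with
  \<open>p\<^sub>j = det C(A\<^sub>j, B)\<close> and \<open>q\<^sub>j = det (B, A\<^sub>j B\<^sup>\<bottom>)\<close>, so that \<open>\<beta> = p1 / p2\<close> and \<open>\<alpha> = q1 - \<beta> q2\<close>.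

  Obstructions come from square-integrable \<open>\<phi>\<close> that annihilate every response from rest. For \<open>T < 2 \<Lambda>1\<close> such
  a \<open>\<phi>\<close> is built along an orbit of a rotation; if \<open>0\<close> is one of the values \<open>\<beta> + \<alpha>^(1 - \<Lambda>2 / \<Lambda>1)\<close>, then \<open>\<phi>\<close> is an
  exponential; if \<open>0\<close> is only a limit of such values, a lacunary sum of exponentials is a target that cannot be
  reached exactly.

  Conversely, for \<open>T \<ge> 2 \<Lambda>1\<close> and \<open>p2 \<noteq> 0\<close>, steering amounts to solving \<open>\<beta> m + U m = h\<close> on \<open>(0, \<Lambda>1)\<close>, where \<open>U\<close>
  is the translation by \<open>\<Lambda>1 - \<Lambda>2\<close> of functions extended by \<open>m (c + \<Lambda>1) = \<alpha> m c\<close>. For \<open>\<alpha> = 0\<close> the operator \<open>U\<close> is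
  nilpotent. Otherwise it is diagonal in the basis \<open>exp (s t + 2 \<pi> i k t / \<Lambda>1)\<close>, \<open>exp (s \<Lambda>1) = \<alpha>\<close>, and the eigenvalues of
  \<open>\<beta> + U\<close> are the values \<open>\<beta> + \<alpha>^(1 - \<Lambda>2 / \<Lambda>1)\<close>: the range is dense iff none of them is \<open>0\<close>, and everything iff they stay
  away from \<open>0\<close>.
\<close>

section \<open>Square-integrable functions on the line\<close>

text \<open>Where 2 \<Lambda>1 comes from: on the last window of length \<Lambda>1 the control sets
  w directly, whereas z is driven by delayed values alone. So z has to be prepared one window
  earlier, and the unknown there is m = p2 w + q2 z, the combination that the shorter delay
  transports. Inserting it into the equation on the last window produces \<beta> m + U m.

  The exponential eigenbasis is in general not orthogonal. Multiplication by exp (- s t), bounded on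
  (0, \<Lambda>1) together with its inverse, turns it into the Fourier modes, so that Parseval
  bounds the inverse at the price of a fixed constant. Exact inversion sums corrections to residuals
  that decay like 8^(- n). For the converse, the lacunary target has coefficients 2^(- i) at
  frequencies whose eigenvalues are at most 4^(- i), and one exponential at a time is tested against
  it.

  Scalar functions live on the whole line, so that translations stay within one class; an interval
  enters through a cut-off in a function or in an integrand.\<close>

definition in_L2 :: "(real \<Rightarrow> complex) \<Rightarrow> bool" where
  "in_L2 f \<longleftrightarrow> f \<in> borel_measurable lebesgue \<and> integrable lebesgue (\<lambda>t. (cmod (f t))\<^sup>2)"

lemma in_L2_measurable: "in_L2 f \<Longrightarrow> f \<in> borel_measurable lebesgue"
  by (simp add: in_L2_def)

lemma in_L2_integrable: "in_L2 f \<Longrightarrow> integrable lebesgue (\<lambda>t. (cmod (f t))\<^sup>2)"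
  by (simp add: in_L2_def)

lemma in_L2_bound:
  assumes "f \<in> borel_measurable lebesgue" "integrable lebesgue g"
    and "AE t in lebesgue. (cmod (f t))\<^sup>2 \<le> g t"
  shows "in_L2 f"
  unfolding in_L2_def
proof
  have [measurable]: "f \<in> borel_measurable lebesgue" by fact
  show "integrable lebesgue (\<lambda>t. (cmod (f t))\<^sup>2)"
    by (rule Bochner_Integration.integrable_bound[OF assms(2)]) (use assms(3) in \<open>measurable, auto elim!: eventually_mono\<close>)
qed fact

lemma in_L2_zero [simp]: "in_L2 (\<lambda>_. 0)"
  by (simp add: in_L2_def)

lemma cmod_add_square_le: "(cmod (a + b))\<^sup>2 \<le> 2 * (cmod a)\<^sup>2 + 2 * (cmod b)\<^sup>2"
proof -
  have "(cmod (a + b))\<^sup>2 \<le> (cmod a + cmod b)\<^sup>2"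
    by (intro power_mono norm_triangle_ineq) auto
  also have "\<dots> \<le> 2 * (cmod a)\<^sup>2 + 2 * (cmod b)\<^sup>2"
    using sum_squares_ge_zero[of "cmod a - cmod b" 0] by (simp add: power2_eq_square algebra_simps)
  finally show ?thesis .
qed

lemma in_L2_add:
  assumes "in_L2 f" "in_L2 g"
  shows "in_L2 (\<lambda>t. f t + g t)"
proof (rule in_L2_bound)
  show "(\<lambda>t. f t + g t) \<in> borel_measurable lebesgue"
    using assms by (auto simp: in_L2_def)
  show "integrable lebesgue (\<lambda>t. 2 * (cmod (f t))\<^sup>2 + 2 * (cmod (g t))\<^sup>2)"
    using assms by (auto simp: in_L2_def)
qed (simp add: cmod_add_square_le)

lemma in_L2_mult_bounded:
  assumes "in_L2 f" "g \<in> borel_measurable lebesgue" "\<And>t. f t \<noteq> 0 \<Longrightarrow> cmod (g t) \<le> C"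
  shows "in_L2 (\<lambda>t. g t * f t)"
proof (rule in_L2_bound)
  show "(\<lambda>t. g t * f t) \<in> borel_measurable lebesgue"
    using assms by (auto simp: in_L2_def)
  show "integrable lebesgue (\<lambda>t. C\<^sup>2 * (cmod (f t))\<^sup>2)"
    using assms by (auto simp: in_L2_def)
  show "AE t in lebesgue. (cmod (g t * f t))\<^sup>2 \<le> C\<^sup>2 * (cmod (f t))\<^sup>2"
  proof (rule AE_I2)
    show "(cmod (g t * f t))\<^sup>2 \<le> C\<^sup>2 * (cmod (f t))\<^sup>2" for t
      using power_mono[OF assms(3)[of t], of 2]
      by (cases "f t = 0") (auto simp: norm_mult power_mult_distrib intro!: mult_right_mono)
  qed
qed

lemma in_L2_cmult:
  "in_L2 f \<Longrightarrow> in_L2 (\<lambda>t. c * f t)"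
  by (rule in_L2_mult_bounded[where C = "cmod c"]) auto

lemma in_L2_divide:
  "in_L2 f \<Longrightarrow> in_L2 (\<lambda>t. f t / c)"
  using in_L2_cmult[of f "1 / c"] by simp

lemma in_L2_diff:
  assumes "in_L2 f" "in_L2 g"
  shows "in_L2 (\<lambda>t. f t - g t)"
  using in_L2_add[OF assms(1) in_L2_cmult[OF assms(2), of "-1"]] by simp

lemma in_L2_uminus:
  "in_L2 f \<Longrightarrow> in_L2 (\<lambda>t. - f t)"
  using in_L2_cmult[of f "-1"] by simp

lemma in_L2_sum:
  "(\<And>i. i \<in> I \<Longrightarrow> in_L2 (f i)) \<Longrightarrow> in_L2 (\<lambda>t. \<Sum>i\<in>I. f i t)"
  by (induction I rule: infinite_finite_induct) (auto intro: in_L2_add)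

lemma borel_measurable_cnj:
  "f \<in> borel_measurable M \<Longrightarrow> (\<lambda>t. cnj (f t)) \<in> borel_measurable M"
  using measurable_compose[OF _ borel_measurable_continuous_onI[OF continuous_on_cnj[OF continuous_on_id]]]
  by blast

lemma in_L2_cnj:
  "in_L2 f \<Longrightarrow> in_L2 (\<lambda>t. cnj (f t))"
  by (auto simp: in_L2_def intro: borel_measurable_cnj)

lemma in_L2_If:
  assumes "in_L2 f" "in_L2 g" "{t. P t} \<in> sets lebesgue"
  shows "in_L2 (\<lambda>t. if P t then f t else g t)"
proof (rule in_L2_bound)
  have [measurable]: "Measurable.pred lebesgue P" using assms(3) by (simp add: pred_def)
  have [measurable]: "f \<in> borel_measurable lebesgue" "g \<in> borel_measurable lebesgue"
    using assms by (auto simp: in_L2_def)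
  show "(\<lambda>t. if P t then f t else g t) \<in> borel_measurable lebesgue" by measurable
  show "integrable lebesgue (\<lambda>t. (cmod (f t))\<^sup>2 + (cmod (g t))\<^sup>2)"
    using assms by (auto simp: in_L2_def)
qed auto

lemma sets_lebesgue_borel: "A \<in> sets borel \<Longrightarrow> A \<in> sets lebesgue"
  by simp

lemma measurable_lebesgue_affine:
  fixes a c :: real assumes "c \<noteq> 0" shows "(\<lambda>t. a + c * t) \<in> lebesgue \<rightarrow>\<^sub>M lebesgue"
  using lebesgue_affine_measurable[where c = "\<lambda>x::real. c" and t = a] assms by simp

lemma in_L2_affine:
  assumes "in_L2 f" "c \<noteq> 0"
  shows "in_L2 (\<lambda>t. f (a + c * t))"
proof -
  have "f \<in> borel_measurable lebesgue" and i: "integrable lebesgue (\<lambda>t. (cmod (f t))\<^sup>2)"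
    using assms by (auto simp: in_L2_def)
  then have "(\<lambda>t. f (a + c * t)) \<in> borel_measurable lebesgue"
    using measurable_compose[OF measurable_lebesgue_affine[OF assms(2)]] by blast
  moreover have "integrable lebesgue (\<lambda>t. (cmod (f (a + c * t)))\<^sup>2)"
    using has_bochner_integral_lebesgue_real_affine_iff[OF assms(2), of "\<lambda>t. (cmod (f t))\<^sup>2" _ a, THEN iffD1,
        OF has_bochner_integral_integrable[OF i]]
    by (rule integrable.intros)
  ultimately show ?thesis by (simp add: in_L2_def)
qed

lemma in_L2_shift:
  "in_L2 f \<Longrightarrow> in_L2 (\<lambda>t. f (t + d))"
  using in_L2_affine[of f 1 d] by (simp add: add.commute)

lemma in_L2_shift':
  "in_L2 f \<Longrightarrow> in_L2 (\<lambda>t. f (t - d))"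
  using in_L2_shift[of f "- d"] by simp

lemma lebesgue_integral_shift:
  fixes f :: "real \<Rightarrow> 'a :: euclidean_space"
  shows "(\<integral>t. f (t + d) \<partial>lebesgue) = (\<integral>t. f t \<partial>lebesgue)"
  using lebesgue_integral_real_affine[of 1 f d] by (simp add: add.commute)

lemma AE_lebesgue_shift:
  assumes "AE t in lebesgue. P t"
  shows "AE t in lebesgue. P (t + d :: real)"
proof -
  obtain N where N: "N \<in> null_sets lebesgue" "{t. \<not> P t} \<subseteq> N"
    using assms by (auto simp: eventually_ae_filter)
  have "{t. \<not> P (t + d)} \<subseteq> (\<lambda>t. - d + t) ` N"
    using N(2) by (auto simp: image_iff intro!: bexI[of _ "_ + d"])
  moreover have "(\<lambda>t. - d + t) ` N \<in> null_sets lebesgue"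
    using N(1) negligible_translation[of N "-d"] by (simp add: negligible_iff_null_sets image_image)
  ultimately show ?thesis
    unfolding eventually_ae_filter by auto
qed

lemma in_L2_product:
  assumes "in_L2 f" "in_L2 g"
  shows "integrable lebesgue (\<lambda>t. f t * g t)"
proof -
  have [measurable]: "f \<in> borel_measurable lebesgue" "g \<in> borel_measurable lebesgue"
    using assms by (auto simp: in_L2_def)
  have "integrable lebesgue (\<lambda>t. (cmod (f t))\<^sup>2 + (cmod (g t))\<^sup>2)"
    using assms by (auto simp: in_L2_def)
  then show ?thesis
  proof (rule Bochner_Integration.integrable_bound)
    show "AE t in lebesgue. norm (f t * g t) \<le> norm ((cmod (f t))\<^sup>2 + (cmod (g t))\<^sup>2)"
    proof (rule AE_I2)
      fix t
      have "2 * (cmod (f t) * cmod (g t)) \<le> (cmod (f t))\<^sup>2 + (cmod (g t))\<^sup>2"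
        using sum_squares_bound[of "cmod (f t)" "cmod (g t)"] by (simp add: mult.assoc)
      moreover have "0 \<le> cmod (f t) * cmod (g t)" by simp
      ultimately have "cmod (f t) * cmod (g t) \<le> (cmod (f t))\<^sup>2 + (cmod (g t))\<^sup>2"
        by linarith
      then show "norm (f t * g t) \<le> norm ((cmod (f t))\<^sup>2 + (cmod (g t))\<^sup>2)"
        by (simp add: norm_mult)
    qed
  qed measurable
qed

lemma in_L2_indicator:
  "in_L2 (\<lambda>t. if a < t \<and> t < b then c else 0)"
proof -
  have "integrable lebesgue (\<lambda>t. (cmod c)\<^sup>2 * indicat_real {a<..<b} t)"
    by (intro integrable_mult_right integrable_real_indicator)
       (cases "a \<le> b"; simp)+
  moreover have "(\<lambda>t. if a < t \<and> t < b then c else 0) \<in> borel_measurable borel"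
    by measurable
  then have "(\<lambda>t. if a < t \<and> t < b then c else 0) \<in> borel_measurable lebesgue"
    by (intro measurable_completion) simp
  ultimately show ?thesis
    by (intro in_L2_bound[where g = "\<lambda>t. (cmod c)\<^sup>2 * indicat_real {a<..<b} t"])
      (auto simp: indicator_def)
qed

lemma in_L2_bounded_on_interval:
  assumes "f \<in> borel_measurable lebesgue" "\<And>t. a < t \<Longrightarrow> t < b \<Longrightarrow> cmod (f t) \<le> C"
  shows "in_L2 (\<lambda>t. if a < t \<and> t < b then f t else 0)"
proof -
  have "in_L2 (\<lambda>t. f t * (if a < t \<and> t < b then 1 else 0))"
    by (rule in_L2_mult_bounded[OF in_L2_indicator assms(1)])
       (use assms(2) in \<open>auto split: if_splits\<close>)
  then show ?thesis by (rule back_subst[where P = in_L2]) auto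
qed

lemma in_L2_continuous_on_interval:
  assumes "continuous_on UNIV f"
  shows "in_L2 (\<lambda>t. if a < t \<and> t < b then f t else 0)"
proof -
  have "compact (f ` {a..b})"
    using assms by (intro compact_continuous_image) (auto intro: continuous_on_subset)
  then obtain C where "\<And>t. t \<in> {a..b} \<Longrightarrow> cmod (f t) \<le> C"
    using compact_imp_bounded bounded_iff by (metis imageI)
  moreover have "f \<in> borel_measurable lebesgue"
    using assms by (simp add: borel_measurable_continuous_onI measurable_completion)
  ultimately show ?thesis
    by (intro in_L2_bounded_on_interval[where C = C]) auto
qed

lemma in_L2_restrict:
  assumes "in_L2 f" "{t. P t} \<in> sets lebesgue"
  shows "in_L2 (\<lambda>t. if P t then f t else 0)"
  using in_L2_If[OF assms(1) in_L2_zero assms(2)] .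

lemmas in_L2_intros =
  in_L2_zero in_L2_add in_L2_diff in_L2_cmult
  in_L2_uminus in_L2_divide
  in_L2_cnj in_L2_If in_L2_indicator

lemma interval_sets_lebesgue [simp, intro]:
  fixes a b :: real
  shows "{t. a < t \<and> t < b} \<in> sets lebesgue" "{t. a \<le> t \<and> t < b} \<in> sets lebesgue"
    "{t. a < t \<and> t \<le> b} \<in> sets lebesgue" "{t. t \<le> a} \<in> sets lebesgue" "{t. t < a} \<in> sets lebesgue"
    "{t. a < t} \<in> sets lebesgue" "{t. a \<le> t} \<in> sets lebesgue"
  by (auto intro!: sets_lebesgue_borel)

section \<open>Coordinates adapted to the control direction\<close>

text \<open>With \<open>across\<close>, these are the coordinates given by Cramer's rule in the
  basis B, \<open>perp B\<close>, whose determinant is 1.\<close>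

definition along :: "complex^1^2 \<Rightarrow> complex^2 \<Rightarrow> complex" where
  "along B x = det (two_columns x (perp B))"

definition across :: "complex^1^2 \<Rightarrow> complex^2 \<Rightarrow> complex" where
  "across B x = det (two_columns (column 1 B) x)"

lemma across_eq: "across B x = B$1$1 * x$2 - x$1 * B$2$1"
  by (simp add: across_def det_2 two_columns_def column_def)

lemma along_eq: "along B x = x$1 * perp B $ 2 - perp B $ 1 * x$2"
  by (simp add: along_def det_2 two_columns_def column_def)

lemma across_perp: "B \<noteq> 0 \<Longrightarrow> across B (perp B) = 1"
  using theI'[OF perp_unique_existence, of B] by (simp add: across_def perp_def)

lemma along_column: "B \<noteq> 0 \<Longrightarrow> along B (column 1 B) = 1"
  using across_perp by (simp add: across_eq along_eq column_def)

lemma along_perp: "along B (perp B) = 0"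
  by (simp add: along_eq)

lemma across_column: "across B (column 1 B) = 0"
  by (simp add: across_eq column_def)

lemma along_add: "along B (x + y) = along B x + along B y"
  and along_mult: "along B (c *s x) = c * along B x"
  and across_add: "across B (x + y) = across B x + across B y"
  and across_diff: "across B (x - y) = across B x - across B y"
  and across_mult: "across B (c *s x) = c * across B x"
  by (simp_all add: along_eq across_eq algebra_simps)

lemma along_across_decomposition:
  assumes "B \<noteq> 0"
  shows "x = along B x *s column 1 B + across B x *s perp B"
proof -
  have one: "B$1$1 * perp B$2 - perp B$1 * B$2$1 = 1"
    using across_perp[OF assms] by (simp add: across_eq)
  have "x$1 = along B x * B$1$1 + across B x * perp B$1"
    unfolding along_eq across_eq using one by algebra
  moreover have "x$2 = along B x * B$2$1 + across B x * perp B$2"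
    unfolding along_eq across_eq using one by algebra
  ultimately show ?thesis
    by (simp add: vec_eq_iff forall_2 column_def)
qed

lemma bounded_linear_along: "bounded_linear (along B)"
  unfolding linear_conv_bounded_linear[symmetric]
  by (rule linearI) (simp_all add: along_eq algebra_simps)

lemma bounded_linear_across: "bounded_linear (across B)"
  unfolding linear_conv_bounded_linear[symmetric]
  by (rule linearI) (simp_all add: across_eq algebra_simps)

section \<open>From vector functions on a set to scalar functions on the line\<close>

lemma L2_iff_zero_extension:
  assumes "S \<in> sets lebesgue"
  shows "f \<in> L2 S \<longleftrightarrow> (\<lambda>t. if t \<in> S then f t else 0) \<in> borel_measurable lebesgue \<and>
    integrable lebesgue (\<lambda>t. if t \<in> S then (norm (f t))\<^sup>2 else 0)"
  unfolding L2_def mem_Collect_eq borel_measurable_if[OF assms]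
    Lebesgue_Measure.integrable_restrict_UNIV[OF assms] ..

lemma L2_norm_eq:
  assumes "S \<in> sets lebesgue"
  shows "L2_norm S f = sqrt (\<integral>t. (if t \<in> S then (norm (f t))\<^sup>2 else 0) \<partial>lebesgue)"
  unfolding L2_norm_def Lebesgue_Measure.integral_restrict_UNIV[OF assms] ..

lemma AE_lebesgue_on:
  assumes "S \<in> sets lebesgue"
  shows "(AE t in lebesgue_on S. P t) \<longleftrightarrow> (AE t in lebesgue. t \<in> S \<longrightarrow> P t)"
  using assms by (intro AE_restrict_space_iff) auto

lemma in_L2_bounded_linear:
  fixes f :: "real \<Rightarrow> 'b::euclidean_space"
  assumes f: "f \<in> L2 S" and S: "S \<in> sets lebesgue" and g: "bounded_linear g"
  shows "in_L2 (\<lambda>t. if t \<in> S then g (f t) else 0)"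
proof -
  let ?f = "\<lambda>t. if t \<in> S then f t else 0"
  obtain K where K: "\<And>x. norm (g x) \<le> norm x * K" "K > 0"
    using bounded_linear.pos_bounded[OF g] by blast
  have f': "?f \<in> borel_measurable lebesgue" "integrable lebesgue (\<lambda>t. if t \<in> S then (norm (f t))\<^sup>2 else 0)"
    using f L2_iff_zero_extension[OF S] by auto
  have eq: "(\<lambda>t. if t \<in> S then g (f t) else 0) = (\<lambda>t. g (?f t))"
    using linear_0[OF bounded_linear.linear[OF g]] by auto
  show ?thesis
  proof (rule in_L2_bound)
    show "(\<lambda>t. if t \<in> S then g (f t) else 0) \<in> borel_measurable lebesgue"
      unfolding eq
      by (rule measurable_compose[OF f'(1) borel_measurable_continuous_onI])
         (rule linear_continuous_on[OF g])
    show "integrable lebesgue (\<lambda>t. K\<^sup>2 * (if t \<in> S then (norm (f t))\<^sup>2 else 0))"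
      using f'(2) by (rule integrable_mult_right)
    show "AE t in lebesgue. (cmod (if t \<in> S then g (f t) else 0))\<^sup>2 \<le> K\<^sup>2 * (if t \<in> S then (norm (f t))\<^sup>2 else 0)"
      using power_mono[OF K(1) norm_ge_zero, of _ 2] by (intro AE_I2) (auto simp: power_mult_distrib mult.commute)
  qed
qed

definition recombine :: "complex^1^2 \<Rightarrow> (real \<Rightarrow> complex) \<Rightarrow> (real \<Rightarrow> complex) \<Rightarrow> real \<Rightarrow> complex^2" where
  "recombine B w z t = w t *s column 1 B + z t *s perp B"

lemma along_recombine: "B \<noteq> 0 \<Longrightarrow> along B (recombine B w z t) = w t"
  and across_recombine: "B \<noteq> 0 \<Longrightarrow> across B (recombine B w z t) = z t"
  by (simp_all add: recombine_def along_add along_mult across_add across_mult along_column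
      along_perp across_column across_perp)

lemma norm_vector_smult: "norm (c *s (v :: complex^2)) = cmod c * norm v"
  by (simp add: norm_vec_def L2_set_def sum_2 norm_mult power_mult_distrib flip: distrib_left)
     (simp add: real_sqrt_mult)

lemma recombine_bound:
  "(norm (recombine B w z t))\<^sup>2 \<le> 2 * (norm (column 1 B))\<^sup>2 * (cmod (w t))\<^sup>2 + 2 * (norm (perp B))\<^sup>2 * (cmod (z t))\<^sup>2"
proof -
  let ?a = "cmod (w t) * norm (column 1 B)" and ?b = "cmod (z t) * norm (perp B)"
  have "norm (recombine B w z t) \<le> ?a + ?b"
    unfolding recombine_def by (rule order_trans[OF norm_triangle_ineq]) (simp add: norm_vector_smult)
  then have "(norm (recombine B w z t))\<^sup>2 \<le> (?a + ?b)\<^sup>2"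
    by (intro power_mono) auto
  also have "\<dots> \<le> 2 * ?a\<^sup>2 + 2 * ?b\<^sup>2"
    using sum_squares_ge_zero[of "?a - ?b" 0] by (simp add: power2_eq_square algebra_simps)
  finally show ?thesis by (simp add: power_mult_distrib mult_ac)
qed

lemma recombine_measurable:
  assumes "w \<in> borel_measurable lebesgue" "z \<in> borel_measurable lebesgue"
  shows "recombine B w z \<in> borel_measurable lebesgue"
proof -
  have "recombine B w z = (\<lambda>t. (\<lambda>p. fst p *s column 1 B + snd p *s perp B) (w t, z t))"
    by (auto simp: recombine_def)
  moreover have "continuous_on UNIV (\<lambda>p. fst p *s column 1 B + snd p *s perp B)"
    unfolding vector_scalar_mult_def by (intro continuous_intros)
  ultimately show ?thesis
    using measurable_compose[OF borel_measurable_Pair[OF assms] borel_measurable_continuous_onI,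
        of "\<lambda>p. fst p *s column 1 B + snd p *s perp B"] by simp
qed

lemma recombine_norm_integrable:
  assumes "in_L2 w" "in_L2 z"
  shows "integrable lebesgue (\<lambda>t. (norm (recombine B w z t))\<^sup>2)"
proof (rule Bochner_Integration.integrable_bound)
  show "integrable lebesgue (\<lambda>t. 2 * (norm (column 1 B))\<^sup>2 * (cmod (w t))\<^sup>2 + 2 * (norm (perp B))\<^sup>2 * (cmod (z t))\<^sup>2)"
    using assms by (auto simp: in_L2_def)
  have [measurable]: "recombine B w z \<in> borel_measurable lebesgue"
    using assms by (auto simp: in_L2_def intro!: recombine_measurable)
  show "(\<lambda>t. (norm (recombine B w z t))\<^sup>2) \<in> borel_measurable lebesgue" by measurable
  show "AE t in lebesgue. norm ((norm (recombine B w z t))\<^sup>2)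
      \<le> norm (2 * (norm (column 1 B))\<^sup>2 * (cmod (w t))\<^sup>2 + 2 * (norm (perp B))\<^sup>2 * (cmod (z t))\<^sup>2)"
    using recombine_bound by (intro AE_I2) auto
qed

lemma recombine_in_L2:
  assumes "in_L2 w" "in_L2 z" "S \<in> sets lebesgue"
  shows "recombine B w z \<in> L2 S"
proof -
  have "recombine B w z \<in> borel_measurable lebesgue"
    using assms by (auto simp: in_L2_def intro!: recombine_measurable)
  then show ?thesis
    unfolding L2_def mem_Collect_eq
    using assms(3) integrable_mult_indicator[OF assms(3) recombine_norm_integrable[OF assms(1,2)]]
    by (subst integrable_restrict_space) (auto intro: measurable_restrict_space1)
qed

lemma in_L2_imp_L2:
  assumes "in_L2 u" "S \<in> sets lebesgue"
  shows "u \<in> L2 S"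
  using assms integrable_mult_indicator[OF assms(2) in_L2_integrable[OF assms(1)]]
  unfolding L2_def mem_Collect_eq
  by (subst integrable_restrict_space) (auto intro: measurable_restrict_space1 simp: in_L2_def)

section \<open>Controllability and range inclusion in adapted coordinates\<close>

definition p_coeff :: "complex^2^2 \<Rightarrow> complex^1^2 \<Rightarrow> complex" where
  "p_coeff A B = across B (A *v column 1 B)"

definition q_coeff :: "complex^2^2 \<Rightarrow> complex^1^2 \<Rightarrow> complex" where
  "q_coeff A B = across B (A *v perp B)"

lemma across_matrix:
  assumes "B \<noteq> 0"
  shows "across B (A *v x) = p_coeff A B * along B x + q_coeff A B * across B x"
proof -
  have "A *v x = along B x *s (A *v column 1 B) + across B x *s (A *v perp B)"
    by (subst along_across_decomposition[OF assms, of x])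
       (simp add: matrix_vector_right_distrib vector_scalar_commute)
  then show ?thesis
    by (simp add: across_add across_mult p_coeff_def q_coeff_def mult.commute)
qed

lemma det_ctrb: "det (ctrb A B) = p_coeff A B"
proof -
  have "column 1 (A ** B) = A *v column 1 B"
    by (simp add: vec_eq_iff column_def matrix_matrix_mult_def matrix_vector_mult_def)
  then show ?thesis by (simp add: ctrb_def p_coeff_def across_def)
qed

lemma controllable_iff: "controllable A B \<longleftrightarrow> p_coeff A B \<noteq> 0"
proof -
  have "rank M = 2 \<longleftrightarrow> vec.span (rows M) = UNIV" for M :: "complex^2^2"
    using vec.dim_eq_full[of "rows M"]
    by (simp add: row_rank_def_gen vec.dimension_def card_cart_basis)
  then have "rank M = 2 \<longleftrightarrow> det M \<noteq> 0" for M :: "complex^2^2"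
    by (simp add: invertible_left_inverse matrix_left_invertible_span_rows_gen flip: invertible_det_nz)
  then show ?thesis by (simp add: controllable_def det_ctrb)
qed

text \<open>\<open>Ran B\<close> is the kernel of \<open>across B\<close>, so the inclusion says
  that \<open>across B\<close> annihilates the images under A of both basis vectors.\<close>

lemma Ran_subset_iff:
  assumes "B \<noteq> 0"
  shows "Ran A \<subseteq> Ran B \<longleftrightarrow> p_coeff A B = 0 \<and> q_coeff A B = 0"
proof -
  have B: "B *v v = v$1 *s column 1 B" for v
    by (simp add: vec_eq_iff matrix_vector_mult_def column_def mult.commute)
  have mem: "x \<in> Ran B \<longleftrightarrow> across B x = 0" for x
  proof
    assume "x \<in> Ran B" then show "across B x = 0"
      by (auto simp: Ran_def B across_mult across_column)
  next
    assume "across B x = 0"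
    then have "x = B *v vec (along B x)"
      using along_across_decomposition[OF assms, of x] by (simp add: B)
    then show "x \<in> Ran B" unfolding Ran_def by blast
  qed
  have "Ran A \<subseteq> Ran B \<longleftrightarrow> (\<forall>v. across B (A *v v) = 0)"
    using mem by (auto simp: Ran_def)
  also have "\<dots> \<longleftrightarrow> p_coeff A B = 0 \<and> q_coeff A B = 0"
    unfolding across_matrix[OF assms]
    using along_column[OF assms] across_column along_perp across_perp[OF assms]
    by (metis add.right_neutral add_0 mult.right_neutral mult_zero_left mult_zero_right)
  finally show ?thesis .
qed

lemma alpha_eq:
  "det (two_columns (column 1 B) ((A1 - map_matrix ((*) \<beta>) A2) *v perp B)) = q_coeff A1 B - \<beta> * q_coeff A2 B"
proof -
  have "map_matrix ((*) \<beta>) A2 *v v = \<beta> *s (A2 *v v)" for v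
    by (simp add: vec_eq_iff matrix_vector_mult_def map_matrix_def sum_distrib_left mult.assoc)
  then show ?thesis
    by (simp add: matrix_vector_mult_diff_rdistrib q_coeff_def across_diff across_mult flip: across_def)
qed

section \<open>Reduction to a scalar delay equation\<close>

lemma AE_lebesgue_neq: "AE t in lebesgue. t \<noteq> (c :: real)"
  using AE_lborel_singleton[of c] by (rule AE_completion)

lemma integrable_restrict_interval:
  fixes f :: "real \<Rightarrow> 'a :: euclidean_space"
  assumes "integrable lebesgue f"
  shows "integrable lebesgue (\<lambda>t. if a < t \<and> t < b then f t else 0)"
  using Lebesgue_Measure.integrable_restrict_UNIV[of "{a<..<b}" f]
    integrable_mult_indicator[OF _ assms, of "{a<..<b}"]
  by (simp add: integrable_restrict_space)

locale delay_system =
  fixes p1 q1 p2 q2 :: complex and \<Lambda>1 \<Lambda>2 T :: real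
  assumes \<Lambda>2_pos: "0 < \<Lambda>2" and \<Lambda>2_less: "\<Lambda>2 < \<Lambda>1" and T_pos: "0 < T"
begin

abbreviation delayed :: "(real \<Rightarrow> complex) \<Rightarrow> (real \<Rightarrow> complex) \<Rightarrow> real \<Rightarrow> complex" where
  "delayed w z t \<equiv> p1 * w (t - \<Lambda>1) + q1 * z (t - \<Lambda>1) + p2 * w (t - \<Lambda>2) + q2 * z (t - \<Lambda>2)"

definition dynamics :: "(real \<Rightarrow> complex) \<Rightarrow> (real \<Rightarrow> complex) \<Rightarrow> bool" where
  "dynamics w z \<longleftrightarrow> in_L2 w \<and> in_L2 z \<and>
     (AE t in lebesgue. 0 < t \<and> t < T \<longrightarrow>
        z t = delayed w z t)"

text \<open>Responses from rest are extended by zero beyond T as well, so that they can be paired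
  with test functions over the whole line.\<close>

definition zero_response :: "(real \<Rightarrow> complex) \<Rightarrow> (real \<Rightarrow> complex) \<Rightarrow> bool" where
  "zero_response w z \<longleftrightarrow> dynamics w z \<and> (\<forall>t. t \<le> 0 \<or> T \<le> t \<longrightarrow> w t = 0 \<and> z t = 0)"

abbreviation window_energy :: "(real \<Rightarrow> 'a :: real_normed_vector) \<Rightarrow> real" where
  "window_energy f \<equiv> \<integral>t. (if T - \<Lambda>1 < t \<and> t < T then (norm (f t))\<^sup>2 else 0) \<partial>lebesgue"

text \<open>The obstructions refute this consequence of approximate controllability: density of the
  final states reached from rest, measured separately in the two coordinates.\<close>

definition approximable :: bool where
  "approximable \<longleftrightarrow> (\<forall>wy zy \<epsilon>. in_L2 wy \<longrightarrow> in_L2 zy \<longrightarrow> 0 < \<epsilon> \<longrightarrow>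
    (\<exists>w z. zero_response w z \<and>
      window_energy (\<lambda>t. w t - wy t) < \<epsilon> \<and>
      window_energy (\<lambda>t. z t - zy t) < \<epsilon>))"

definition response :: "(real \<Rightarrow> complex) \<Rightarrow> (real \<Rightarrow> complex) \<Rightarrow> (real \<Rightarrow> complex) \<Rightarrow> (real \<Rightarrow> complex) \<Rightarrow> bool" where
  "response w0 z0 w z \<longleftrightarrow> dynamics w z \<and> (\<forall>t. - \<Lambda>1 < t \<and> t < 0 \<longrightarrow> w t = w0 t \<and> z t = z0 t)"

end

section \<open>Passage between the planar system and the scalar equation\<close>

locale planar_system = delay_system "p_coeff A1 B" "q_coeff A1 B" "p_coeff A2 B" "q_coeff A2 B" \<Lambda>1 \<Lambda>2 T
  for A1 A2 :: "complex^2^2" and B :: "complex^1^2" and \<Lambda>1 \<Lambda>2 T :: real +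
  assumes B_nonzero: "B \<noteq> 0"
begin

abbreviation approx_ctrl :: bool where
  "approx_ctrl \<equiv> approximately_controllable A1 A2 B \<Lambda>1 \<Lambda>2 T"

abbreviation exact_ctrl :: bool where
  "exact_ctrl \<equiv> exactly_controllable A1 A2 B \<Lambda>1 \<Lambda>2 T"

lemma column_control: "B *v vec c = c *s column 1 B"
  by (simp add: vec_eq_iff matrix_vector_mult_def column_def mult.commute)

lemma solution_zero_response:
  assumes "solution A1 A2 B \<Lambda>1 \<Lambda>2 T (\<lambda>_. 0) u x"
  obtains w z where "zero_response w z" "AE t in lebesgue. - \<Lambda>1 < t \<and> t < T \<longrightarrow> x t = recombine B w z t"
proof -
  define w where "w t = (if t \<in> {0<..<T} then along B (x t) else 0)" for t
  define z where "z t = (if t \<in> {0<..<T} then across B (x t) else 0)" for t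
  have x: "x \<in> L2 {-\<Lambda>1<..<T}" and x0: "AE t in lebesgue. t \<in> {-\<Lambda>1<..<0} \<longrightarrow> x t = 0"
    and eq: "AE t in lebesgue. t \<in> {0<..<T} \<longrightarrow> x t = A1 *v x (t - \<Lambda>1) + A2 *v x (t - \<Lambda>2) + B *v vec (u t)"
    using assms by (simp_all add: solution_def AE_lebesgue_on)
  have \<Lambda>1: "0 < \<Lambda>1" using \<Lambda>2_pos \<Lambda>2_less by simp
  have sq: "in_L2 (\<lambda>t. if 0 < t \<and> t < T then (if t \<in> {-\<Lambda>1<..<T} then f (x t) else 0) else 0)"
    if "bounded_linear f" for f
    using in_L2_bounded_linear[OF x _ that] by (rule in_L2_restrict) auto
  have w: "in_L2 w"
    by (rule back_subst[where P = in_L2, OF sq[OF bounded_linear_along[of B]]])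
       (use \<Lambda>1 in \<open>auto simp: w_def fun_eq_iff\<close>)
  have z: "in_L2 z"
    by (rule back_subst[where P = in_L2, OF sq[OF bounded_linear_across[of B]]])
       (use \<Lambda>1 in \<open>auto simp: z_def fun_eq_iff\<close>)
  \<comment> \<open>Cutting the coordinates off at 0 changes x on a null set only, because the
    initial state is zero.\<close>
  have rec: "AE t in lebesgue. - \<Lambda>1 < t \<and> t < T \<longrightarrow> x t = recombine B w z t"
    using x0 AE_lebesgue_neq[of 0]
  proof eventually_elim
    case (elim t)
    show ?case
    proof (cases "0 < t")
      case True
      then show ?thesis
        using along_across_decomposition[OF B_nonzero, of "x t"] by (simp add: recombine_def w_def z_def)
    next
      case False
      then show ?thesis using elim by (auto simp: recombine_def w_def z_def)
    qed
  qed
  have "AE t in lebesgue. 0 < t \<and> t < T \<longrightarrow>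
        z t = delayed w z t"
    using eq AE_lebesgue_shift[OF rec, of "- \<Lambda>1"] AE_lebesgue_shift[OF rec, of "- \<Lambda>2"]
  proof eventually_elim
    case (elim t)
    show ?case
    proof
      assume t: "0 < t \<and> t < T"
      then have "x (t - \<Lambda>1) = recombine B w z (t - \<Lambda>1)" "x (t - \<Lambda>2) = recombine B w z (t - \<Lambda>2)"
        using elim \<Lambda>2_pos \<Lambda>2_less by auto
      then have "across B (x t) = across B (A1 *v recombine B w z (t - \<Lambda>1) + A2 *v recombine B w z (t - \<Lambda>2)
           + B *v vec (u t))" using elim t by simp
      then show "z t = delayed w z t"
        using t by (simp add: z_def[of t] column_control across_add across_mult across_column
            across_matrix[OF B_nonzero] along_recombine[OF B_nonzero] across_recombine[OF B_nonzero])
    qed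
  qed
  then have "zero_response w z"
    using w z by (auto simp: zero_response_def dynamics_def w_def z_def)
  then show thesis using that rec by blast
qed

lemma state_distance:
  assumes "in_L2 w" "in_L2 z"
    and x: "AE t in lebesgue. T - \<Lambda>1 < t \<and> t < T \<longrightarrow> x t - y (t - T) = recombine B w z t"
  shows "L2_norm {-\<Lambda>1<..<0} (\<lambda>s. state x T s - y s) =
    sqrt (window_energy (\<lambda>t. recombine B w z t))"
proof -
  note m = borel_measurable_integrable[OF integrable_restrict_interval[OF recombine_norm_integrable[OF assms(1,2)]],
      of "T - \<Lambda>1" T B]
  let ?f = "\<lambda>t. if T - \<Lambda>1 < t \<and> t < T then (norm (x t - y (t - T)))\<^sup>2 else 0"
  have ae: "AE t in lebesgue. (if T - \<Lambda>1 < t \<and> t < T then (norm (recombine B w z t))\<^sup>2 else 0) = ?f t"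
    using x by eventually_elim auto
  have "(\<integral>s. (if s \<in> {-\<Lambda>1<..<0} then (norm (state x T s - y s))\<^sup>2 else 0) \<partial>lebesgue) = (\<integral>t. ?f (t + T) \<partial>lebesgue)"
    by (rule Bochner_Integration.integral_cong) (auto simp: state_def add.commute)
  also have "\<dots> = (\<integral>t. ?f t \<partial>lebesgue)"
    by (rule lebesgue_integral_shift)
  \<comment> \<open>Neither x nor y is assumed measurable: by completeness of Lebesgue measure,
    measurability passes from \<open>recombine\<close> through the almost everywhere
    equality.\<close>
  also have "\<dots> = window_energy (\<lambda>t. recombine B w z t)"
    by (rule integral_cong_AE) (use ae m borel_measurable_AE[OF m ae] in \<open>auto elim: eventually_mono\<close>)
  finally show ?thesis by (simp add: L2_norm_eq)
qed

lemma approximately_controllable_scalar: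
  assumes approx_ctrl
  shows approximable
  unfolding approximable_def
proof (intro allI impI)
  fix wy zy :: "real \<Rightarrow> complex" and \<epsilon> :: real
  assume wy: "in_L2 wy" and zy: "in_L2 zy" and \<epsilon>: "\<epsilon> > 0"
  obtain K1 where K1: "\<And>v. cmod (across B v) \<le> norm v * K1" "K1 > 0"
    using bounded_linear.pos_bounded[OF bounded_linear_across] by blast
  obtain K2 where K2: "\<And>v. cmod (along B v) \<le> norm v * K2" "K2 > 0"
    using bounded_linear.pos_bounded[OF bounded_linear_along] by blast
  define K where "K = max K1 K2"
  have K: "cmod (across B v) \<le> norm v * K" "cmod (along B v) \<le> norm v * K" for v
    using K1(1)[of v] K2(1)[of v] mult_left_mono[of K1 K "norm v"] mult_left_mono[of K2 K "norm v"]
    by (auto simp: K_def)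
  have K0: "K > 0" using K1(2) by (simp add: K_def)
  \<comment> \<open>K bounds both coordinate functionals, so a state error below \<delta> leaves
    both coordinate energies below \<epsilon>.\<close>
  define \<delta> where "\<delta> = sqrt (\<epsilon> / K\<^sup>2)"
  have \<delta>: "\<delta> > 0" using \<epsilon> K0 by (simp add: \<delta>_def)
  define y where "y s = recombine B wy zy (s + T)" for s
  have "y = recombine B (\<lambda>s. wy (s + T)) (\<lambda>s. zy (s + T))"
    by (simp add: y_def recombine_def fun_eq_iff)
  then have "y \<in> L2 {-\<Lambda>1<..<0}"
    using in_L2_shift[OF wy] in_L2_shift[OF zy] by (auto intro: recombine_in_L2)
  moreover have "(\<lambda>_. 0) \<in> L2 {-\<Lambda>1<..<0}" by (simp add: L2_def)
  ultimately obtain u x where s: "solution A1 A2 B \<Lambda>1 \<Lambda>2 T (\<lambda>_. 0) u x"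
    and d: "L2_norm {-\<Lambda>1<..<0} (\<lambda>s. state x T s - y s) < \<delta>"
    using assms(1) \<delta> unfolding approximately_controllable_def by blast
  obtain w z where wz: "zero_response w z" and x: "AE t in lebesgue. - \<Lambda>1 < t \<and> t < T \<longrightarrow> x t = recombine B w z t"
    using solution_zero_response[OF s] .
  let ?w = "\<lambda>t. w t - wy t" and ?z = "\<lambda>t. z t - zy t"
  let ?r = "\<lambda>t. if T - \<Lambda>1 < t \<and> t < T then (norm (recombine B ?w ?z t))\<^sup>2 else 0"
  have sq: "in_L2 ?w" "in_L2 ?z"
    using wz wy zy by (auto simp: zero_response_def dynamics_def intro: in_L2_diff)
  have "AE t in lebesgue. T - \<Lambda>1 < t \<and> t < T \<longrightarrow> x t - y (t - T) = recombine B ?w ?z t"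
    using x by eventually_elim
      (use T_pos in \<open>auto simp: y_def recombine_def vec_eq_iff vector_scalar_mult_def algebra_simps\<close>)
  note dist = state_distance[OF sq this]
  let ?I = "window_energy (\<lambda>t. recombine B ?w ?z t)"
  have "sqrt ?I < \<delta>" using d dist by simp
  then have "?I < \<epsilon> / K\<^sup>2"
    unfolding \<delta>_def by simp
  then have I: "K\<^sup>2 * ?I < \<epsilon>" using K0 by (simp add: field_simps)
  have i1: "integrable lebesgue (\<lambda>t. if T - \<Lambda>1 < t \<and> t < T then (norm (recombine B ?w ?z t))\<^sup>2 else 0)"
    by (rule integrable_restrict_interval[OF recombine_norm_integrable[OF sq]])
  have bound: "window_energy (\<lambda>t. v t) < \<epsilon>"
    if "in_L2 v" and v: "\<And>t. cmod (v t) \<le> norm (recombine B ?w ?z t) * K" for v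
  proof -
    have "window_energy (\<lambda>t. v t)
       \<le> (\<integral>t. K\<^sup>2 * ?r t \<partial>lebesgue)"
    proof (rule integral_mono[OF integrable_restrict_interval[OF in_L2_integrable[OF that(1)]] integrable_mult_right[OF i1]])
      fix t
      from power_mono[OF v[of t] norm_ge_zero, of 2]
      show "(if T - \<Lambda>1 < t \<and> t < T then (cmod (v t))\<^sup>2 else 0)
        \<le> K\<^sup>2 * ?r t"
        by (simp add: power_mult_distrib mult.commute)
    qed
    also have "\<dots> < \<epsilon>" using I by simp
    finally show ?thesis .
  qed
  show "\<exists>w z. zero_response w z \<and>
      window_energy (\<lambda>t. w t - wy t) < \<epsilon> \<and>
      window_energy (\<lambda>t. z t - zy t) < \<epsilon>"
    using wz bound[OF sq(1)] bound[OF sq(2)] K(1)[of "recombine B ?w ?z _"] K(2)[of "recombine B ?w ?z _"]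
    by (auto simp: across_recombine[OF B_nonzero] along_recombine[OF B_nonzero])
qed

lemma exactly_controllable_scalar:
  assumes exact_ctrl "in_L2 wy" "in_L2 zy"
  shows "\<exists>w z. zero_response w z \<and> (AE t in lebesgue. T - \<Lambda>1 < t \<and> t < T \<longrightarrow> w t = wy t \<and> z t = zy t)"
proof -
  define y where "y s = recombine B wy zy (s + T)" for s
  have "y = recombine B (\<lambda>s. wy (s + T)) (\<lambda>s. zy (s + T))"
    by (simp add: y_def recombine_def fun_eq_iff)
  then have "y \<in> L2 {-\<Lambda>1<..<0}"
    using in_L2_shift[OF assms(2)] in_L2_shift[OF assms(3)]
    by (auto intro: recombine_in_L2)
  moreover have "(\<lambda>_. 0) \<in> L2 {-\<Lambda>1<..<0}" by (simp add: L2_def)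
  ultimately obtain u x where s: "solution A1 A2 B \<Lambda>1 \<Lambda>2 T (\<lambda>_. 0) u x"
    and d: "AE s in lebesgue_on {-\<Lambda>1<..<0}. state x T s = y s"
    using assms(1) unfolding exactly_controllable_def by blast
  obtain w z where wz: "zero_response w z" and x: "AE t in lebesgue. - \<Lambda>1 < t \<and> t < T \<longrightarrow> x t = recombine B w z t"
    using solution_zero_response[OF s] .
  have "AE s in lebesgue. s \<in> {-\<Lambda>1<..<0} \<longrightarrow> x (T + s) = recombine B wy zy (s + T)"
    using d by (simp add: AE_lebesgue_on state_def y_def)
  from AE_lebesgue_shift[OF this, of "- T"] x
  have "AE t in lebesgue. T - \<Lambda>1 < t \<and> t < T \<longrightarrow> w t = wy t \<and> z t = zy t"
  proof eventually_elim
    case (elim t)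
    show ?case
    proof
      assume "T - \<Lambda>1 < t \<and> t < T"
      then have "recombine B w z t = recombine B wy zy t" using elim T_pos by auto
      then show "w t = wy t \<and> z t = zy t"
        using along_recombine[OF B_nonzero] across_recombine[OF B_nonzero] by metis
    qed
  qed
  then show ?thesis using wz by blast
qed

lemma response_solution:
  assumes r: "response w0 z0 w z"
    and x0: "AE t in lebesgue. - \<Lambda>1 < t \<and> t < 0 \<longrightarrow> x0 t = recombine B w0 z0 t"
  obtains u where "u \<in> L2 {0<..<T}" "solution A1 A2 B \<Lambda>1 \<Lambda>2 T x0 u (recombine B w z)"
proof -
  let ?x = "recombine B w z"
  \<comment> \<open>The B-coordinate of the system, solved for the control. It can be met for every
    w, which is why w is free and the equation for z alone remains.\<close>
  define u where "u t = w t - along B (A1 *v ?x (t - \<Lambda>1)) - along B (A2 *v ?x (t - \<Lambda>2))" for t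
  have sq: "in_L2 w" "in_L2 z"
    and eq: "AE t in lebesgue. 0 < t \<and> t < T \<longrightarrow>
        z t = delayed w z t"
    and init: "\<And>t. - \<Lambda>1 < t \<Longrightarrow> t < 0 \<Longrightarrow> w t = w0 t \<and> z t = z0 t"
    using r by (auto simp: response_def dynamics_def)
  have along: "along B (A *v ?x t) = along B (A *v column 1 B) * w t + along B (A *v perp B) * z t" for A t
    by (simp add: recombine_def matrix_vector_right_distrib vector_scalar_commute along_add along_mult mult.commute)
  have "in_L2 u"
    unfolding u_def along
    by (intro in_L2_intros sq sq[THEN in_L2_shift'])
  then have "u \<in> L2 {0<..<T}" by (intro in_L2_imp_L2) auto
  moreover have "solution A1 A2 B \<Lambda>1 \<Lambda>2 T x0 u ?x"
    unfolding solution_def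
  proof (intro conjI)
    show "?x \<in> L2 {-\<Lambda>1<..<T}" using sq by (intro recombine_in_L2) auto
    have "AE t in lebesgue. t \<in> {-\<Lambda>1<..<0} \<longrightarrow> ?x t = x0 t"
      using x0 by eventually_elim (use init in \<open>auto simp: recombine_def\<close>)
    then show "AE t in lebesgue_on {-\<Lambda>1<..<0}. ?x t = x0 t" by (simp add: AE_lebesgue_on)
    have "AE t in lebesgue. t \<in> {0<..<T} \<longrightarrow> ?x t = A1 *v ?x (t - \<Lambda>1) + A2 *v ?x (t - \<Lambda>2) + B *v vec (u t)"
      using eq
    proof eventually_elim
      case (elim t)
      let ?r = "A1 *v ?x (t - \<Lambda>1) + A2 *v ?x (t - \<Lambda>2)"
      show ?case
      proof
        assume t: "t \<in> {0<..<T}"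
        have "across B ?r = z t"
          using elim t by (simp add: across_add across_matrix[OF B_nonzero] along_recombine[OF B_nonzero] across_recombine[OF B_nonzero])
        moreover have "along B ?r + u t = w t" by (simp add: u_def along_add)
        ultimately have "?x t = (along B ?r + u t) *s column 1 B + across B ?r *s perp B"
          by (simp add: recombine_def)
        also have "\<dots> = (along B ?r *s column 1 B + across B ?r *s perp B) + u t *s column 1 B"
          by (simp only: vector_sadd_rdistrib add_ac)
        also have "\<dots> = ?r + B *v vec (u t)"
          by (simp only: along_across_decomposition[OF B_nonzero, symmetric] column_control)
        finally show "?x t = ?r + B *v vec (u t)" .
      qed
    qed
    then show "AE t in lebesgue_on {0<..<T}. ?x t = A1 *v ?x (t - \<Lambda>1) + A2 *v ?x (t - \<Lambda>2) + B *v vec (u t)"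
      by (simp add: AE_lebesgue_on)
  qed
  ultimately show thesis using that by blast
qed

lemma L2_recombine:
  assumes "x \<in> L2 {-\<Lambda>1<..<0}"
  obtains w z where "in_L2 w" "in_L2 z" "\<And>t. - \<Lambda>1 < t \<Longrightarrow> t < 0 \<Longrightarrow> x t = recombine B w z t"
proof
  show "in_L2 (\<lambda>t. if t \<in> {-\<Lambda>1<..<0} then along B (x t) else 0)"
    by (rule in_L2_bounded_linear[OF assms _ bounded_linear_along]) auto
  show "in_L2 (\<lambda>t. if t \<in> {-\<Lambda>1<..<0} then across B (x t) else 0)"
    by (rule in_L2_bounded_linear[OF assms _ bounded_linear_across]) auto
  show "x t = recombine B (\<lambda>t. if t \<in> {-\<Lambda>1<..<0} then along B (x t) else 0) (\<lambda>t. if t \<in> {-\<Lambda>1<..<0} then across B (x t) else 0) t"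
    if "- \<Lambda>1 < t" "t < 0" for t
    using that along_across_decomposition[OF B_nonzero, of "x t"] by (simp add: recombine_def)
qed

lemma exactly_controllableI:
  assumes "\<And>w0 z0 wy zy. in_L2 w0 \<Longrightarrow> in_L2 z0 \<Longrightarrow> in_L2 wy \<Longrightarrow> in_L2 zy \<Longrightarrow>
    \<exists>w z. response w0 z0 w z \<and> (AE t in lebesgue. T - \<Lambda>1 < t \<and> t < T \<longrightarrow> w t = wy t \<and> z t = zy t)"
  shows exact_ctrl
  unfolding exactly_controllable_def
proof (intro ballI)
  fix x0 y :: "real \<Rightarrow> complex^2" assume x0: "x0 \<in> L2 {-\<Lambda>1<..<0}" and y: "y \<in> L2 {-\<Lambda>1<..<0}"
  obtain w0 z0 where 0: "in_L2 w0" "in_L2 z0" "\<And>t. - \<Lambda>1 < t \<Longrightarrow> t < 0 \<Longrightarrow> x0 t = recombine B w0 z0 t"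
    using L2_recombine[OF x0] by blast
  obtain wy zy where y: "in_L2 wy" "in_L2 zy" "\<And>t. - \<Lambda>1 < t \<Longrightarrow> t < 0 \<Longrightarrow> y t = recombine B wy zy t"
    using L2_recombine[OF y] by blast
  obtain w z where r: "response w0 z0 w z" and
    wz: "AE t in lebesgue. T - \<Lambda>1 < t \<and> t < T \<longrightarrow> w t = wy (t - T) \<and> z t = zy (t - T)"
    using assms[OF 0(1,2) in_L2_shift'[OF y(1), of T] in_L2_shift'[OF y(2), of T]] by blast
  obtain u where "u \<in> L2 {0<..<T}" "solution A1 A2 B \<Lambda>1 \<Lambda>2 T x0 u (recombine B w z)"
    using response_solution[OF r, of x0] 0(3) by auto
  moreover have "AE s in lebesgue_on {-\<Lambda>1<..<0}. state (recombine B w z) T s = y s"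
  proof -
    have "AE s in lebesgue. s \<in> {-\<Lambda>1<..<0} \<longrightarrow> state (recombine B w z) T s = y s"
      using AE_lebesgue_shift[OF wz, of T]
      by eventually_elim (use y(3) in \<open>auto simp: state_def recombine_def add.commute\<close>)
    then show ?thesis by (simp add: AE_lebesgue_on)
  qed
  ultimately show "\<exists>u\<in>L2 {0<..<T}. \<exists>x. solution A1 A2 B \<Lambda>1 \<Lambda>2 T x0 u x \<and>
       (AE s in lebesgue_on {-\<Lambda>1<..<0}. state x T s = y s)" by blast
qed

lemma approximately_controllableI:
  assumes "\<And>w0 z0 wy zy \<epsilon>. in_L2 w0 \<Longrightarrow> in_L2 z0 \<Longrightarrow> in_L2 wy \<Longrightarrow> in_L2 zy \<Longrightarrow> 0 < \<epsilon> \<Longrightarrow>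
    \<exists>w z. response w0 z0 w z \<and>
      window_energy (\<lambda>t. w t - wy t) < \<epsilon> \<and>
      window_energy (\<lambda>t. z t - zy t) < \<epsilon>"
  shows approx_ctrl
  unfolding approximately_controllable_def
proof (intro ballI allI impI)
  fix x0 y :: "real \<Rightarrow> complex^2" and \<epsilon> :: real
  assume x0: "x0 \<in> L2 {-\<Lambda>1<..<0}" and y: "y \<in> L2 {-\<Lambda>1<..<0}" and \<epsilon>: "0 < \<epsilon>"
  obtain w0 z0 where 0: "in_L2 w0" "in_L2 z0" "\<And>t. - \<Lambda>1 < t \<Longrightarrow> t < 0 \<Longrightarrow> x0 t = recombine B w0 z0 t"
    using L2_recombine[OF x0] by blast
  obtain wy zy where y: "in_L2 wy" "in_L2 zy" "\<And>t. - \<Lambda>1 < t \<Longrightarrow> t < 0 \<Longrightarrow> y t = recombine B wy zy t"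
    using L2_recombine[OF y] by blast
  \<comment> \<open>The summand 1 keeps C positive and makes the final comparison of C - 1 with C
    strict.\<close>
  define C where "C = 2 * (norm (column 1 B))\<^sup>2 + 2 * (norm (perp B))\<^sup>2 + 1"
  have C: "C > 0" by (simp add: C_def add_nonneg_pos)
  have "\<epsilon>\<^sup>2 / C > 0" using \<epsilon> C by simp
  from assms[OF 0(1,2) in_L2_shift'[OF y(1), of T] in_L2_shift'[OF y(2), of T] this]
  obtain w z where r: "response w0 z0 w z" and
    dw: "window_energy (\<lambda>t. w t - wy (t - T)) < \<epsilon>\<^sup>2 / C" (is "?W < _") and
    dz: "window_energy (\<lambda>t. z t - zy (t - T)) < \<epsilon>\<^sup>2 / C" (is "?Z < _")
    by blast
  obtain u where u: "u \<in> L2 {0<..<T}" "solution A1 A2 B \<Lambda>1 \<Lambda>2 T x0 u (recombine B w z)"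
    using response_solution[OF r, of x0] 0(3) by auto
  let ?w = "\<lambda>t. w t - wy (t - T)" and ?z = "\<lambda>t. z t - zy (t - T)"
  have sq: "in_L2 ?w" "in_L2 ?z"
    using r y by (auto simp: response_def dynamics_def intro!: in_L2_diff in_L2_shift'[of wy] in_L2_shift'[of zy])
  have iw: "integrable lebesgue (\<lambda>t. if T - \<Lambda>1 < t \<and> t < T then (cmod (v t))\<^sup>2 else 0)" if "in_L2 v" for v
    by (rule integrable_restrict_interval[OF in_L2_integrable[OF that]])
  have "L2_norm {-\<Lambda>1<..<0} (\<lambda>s. state (recombine B w z) T s - y s) =
    sqrt (window_energy (\<lambda>t. recombine B ?w ?z t))"
    by (rule state_distance[OF sq], rule AE_I2)
       (auto simp: y(3) recombine_def vec_eq_iff vector_scalar_mult_def algebra_simps)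
  also have "\<dots> < \<epsilon>"
  proof (rule real_less_lsqrt)
    have "window_energy (\<lambda>t. recombine B ?w ?z t)
      \<le> (\<integral>t. 2 * (norm (column 1 B))\<^sup>2 * (if T - \<Lambda>1 < t \<and> t < T then (cmod (?w t))\<^sup>2 else 0)
          + 2 * (norm (perp B))\<^sup>2 * (if T - \<Lambda>1 < t \<and> t < T then (cmod (?z t))\<^sup>2 else 0) \<partial>lebesgue)"
    proof (rule integral_mono_AE')
      show "integrable lebesgue (\<lambda>t. 2 * (norm (column 1 B))\<^sup>2 * (if T - \<Lambda>1 < t \<and> t < T then (cmod (?w t))\<^sup>2 else 0)
          + 2 * (norm (perp B))\<^sup>2 * (if T - \<Lambda>1 < t \<and> t < T then (cmod (?z t))\<^sup>2 else 0))"
        by (intro Bochner_Integration.integrable_add integrable_mult_right iw sq)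
    qed (use recombine_bound[of B ?w ?z] in \<open>auto intro!: AE_I2\<close>)
    also have "\<dots> = 2 * (norm (column 1 B))\<^sup>2 * ?W + 2 * (norm (perp B))\<^sup>2 * ?Z"
      by (subst Bochner_Integration.integral_add) (auto intro!: integrable_mult_right iw sq)
    also have "\<dots> \<le> 2 * (norm (column 1 B))\<^sup>2 * (\<epsilon>\<^sup>2 / C) + 2 * (norm (perp B))\<^sup>2 * (\<epsilon>\<^sup>2 / C)"
      using dw dz by (intro add_mono mult_left_mono) auto
    also have "\<dots> = (C - 1) * (\<epsilon>\<^sup>2 / C)" unfolding C_def by algebra
    also have "\<dots> < C * (\<epsilon>\<^sup>2 / C)" using C \<epsilon> by (intro mult_strict_right_mono) auto
    also have "\<dots> = \<epsilon>\<^sup>2" using C by simp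
    finally show "window_energy (\<lambda>t. recombine B ?w ?z t) < \<epsilon>\<^sup>2" .
  qed (use \<epsilon> in \<open>auto intro!: integral_nonneg\<close>)
  finally show "\<exists>u\<in>L2 {0<..<T}. \<exists>x. solution A1 A2 B \<Lambda>1 \<Lambda>2 T x0 u x \<and>
       L2_norm {-\<Lambda>1<..<0} (\<lambda>s. state x T s - y s) < \<epsilon>" using u by blast
qed

lemma exactly_imp_approximately_controllable:
  assumes exact_ctrl
  shows approx_ctrl
  unfolding approximately_controllable_def
proof (intro ballI allI impI)
  fix x0 y :: "real \<Rightarrow> complex^2" and \<epsilon> :: real
  assume x0: "x0 \<in> L2 {-\<Lambda>1<..<0}" and y: "y \<in> L2 {-\<Lambda>1<..<0}" and \<epsilon>: "0 < \<epsilon>"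
  then obtain u x where u: "u\<in>L2 {0<..<T}" "solution A1 A2 B \<Lambda>1 \<Lambda>2 T x0 u x"
    and e: "AE s in lebesgue_on {-\<Lambda>1<..<0}. state x T s = y s"
    using assms unfolding exactly_controllable_def by blast
  have "(\<integral>s. (norm (state x T s - y s))\<^sup>2 \<partial>lebesgue_on {-\<Lambda>1<..<0}) = 0"
    by (rule integral_eq_zero_AE) (use e in \<open>eventually_elim, simp\<close>)
  then have "L2_norm {-\<Lambda>1<..<0} (\<lambda>s. state x T s - y s) < \<epsilon>"
    using \<epsilon> by (simp add: L2_norm_def)
  then show "\<exists>u\<in>L2 {0<..<T}. \<exists>x. solution A1 A2 B \<Lambda>1 \<Lambda>2 T x0 u x \<and>
       L2_norm {-\<Lambda>1<..<0} (\<lambda>s. state x T s - y s) < \<epsilon>" using u by blast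
qed

end

section \<open>Duality obstructions\<close>

lemma AE_interval_witness:
  fixes a b :: real
  assumes "AE t in lebesgue. P t" "a < b"
  obtains t where "a < t" "t < b" "P t"
proof (rule ccontr)
  assume "\<not> thesis"
  then have "{a<..<b} \<subseteq> {t. \<not> P t}" using that by auto
  moreover obtain N where "N \<in> null_sets lebesgue" "{t. \<not> P t} \<subseteq> N"
    using assms(1) by (auto simp: eventually_ae_filter)
  ultimately have "negligible {a<..<b}"
    by (meson negligible_iff_null_sets negligible_subset order_trans)
  then show False
    using assms(2) negligible_interval(2)[of a b] by (simp add: box_real)
qed

text \<open>Method of steps: the right-hand side at t uses z only at times up to t - min d1 d2, so
  each substitution of the previous approximation extends the solution by that length.\<close>

lemma delay_equation_solvable:
  fixes d1 d2 :: real
  assumes d: "0 < d1" "0 < d2" and F: "in_L2 F" and z0: "in_L2 z0"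
  obtains z where "in_L2 z" "\<And>t. t \<le> 0 \<Longrightarrow> z t = z0 t"
    "\<And>t. 0 < t \<Longrightarrow> t < T \<Longrightarrow> z t = F t + c1 * z (t - d1) + c2 * z (t - d2)"
proof -
  define d where "d = min d1 d2"
  have "\<exists>z. in_L2 z \<and> (\<forall>t\<le>0. z t = z0 t) \<and>
      (\<forall>t. 0 < t \<and> t < T \<and> t < real n * d \<longrightarrow> z t = F t + c1 * z (t - d1) + c2 * z (t - d2))" for n
  proof (induction n)
    case 0
    then show ?case using z0 by (intro exI[of _ z0]) auto
  next
    case (Suc n)
    then obtain z where z: "in_L2 z" "\<And>t. t \<le> 0 \<Longrightarrow> z t = z0 t"
      "\<And>t. 0 < t \<Longrightarrow> t < T \<Longrightarrow> t < real n * d \<Longrightarrow> z t = F t + c1 * z (t - d1) + c2 * z (t - d2)"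
      by blast
    define v where "v t = (if t \<le> 0 then z0 t else F t + c1 * z (t - d1) + c2 * z (t - d2))" for t
    have "in_L2 v"
      unfolding v_def by (intro in_L2_intros z0 F in_L2_shift'[OF z(1)]) auto
    moreover have "v t = F t + c1 * v (t - d1) + c2 * v (t - d2)" if t: "0 < t" "t < T" "t < real (Suc n) * d" for t
    proof -
      have "v (t - e) = z (t - e)" if "d \<le> e" "0 < e" for e
        using z(2,3)[of "t - e"] t that by (auto simp: v_def algebra_simps)
      then show ?thesis using t d by (simp add: v_def[of t] d_def)
    qed
    moreover have "v t = z0 t" if "t \<le> 0" for t using that by (simp add: v_def)
    ultimately show ?case by blast
  qed
  moreover obtain n where "T / d \<le> real n" using real_arch_simple by blast
  moreover have "d > 0" using d by (simp add: d_def)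
  ultimately obtain z where "in_L2 z" "\<forall>t\<le>0. z t = z0 t"
      "\<forall>t. 0 < t \<and> t < T \<and> t < real n * d \<longrightarrow> z t = F t + c1 * z (t - d1) + c2 * z (t - d2)" "T \<le> real n * d"
    by (metis pos_divide_le_eq)
  then show thesis by (intro that[of z]) auto
qed

section \<open>Annihilators of the responses from rest\<close>

context delay_system
begin

lemma \<Lambda>1_pos: "0 < \<Lambda>1"
  using \<Lambda>2_pos \<Lambda>2_less by simp

text \<open>The equation for z is multiplied by \<phi> and the delays are moved onto \<phi> by
  translation. The factors of z and w are the components of the adjoint operator applied to
  \<phi>.\<close>

lemma dual_identity:
  assumes r: "zero_response w z" and \<phi>: "in_L2 \<phi>" and supp: "\<And>t. t \<le> 0 \<or> T \<le> t \<Longrightarrow> \<phi> t = 0"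
  shows "(\<integral>t. z t * (\<phi> t - q1 * \<phi> (t + \<Lambda>1) - q2 * \<phi> (t + \<Lambda>2)) \<partial>lebesgue)
       = (\<integral>t. w t * (p1 * \<phi> (t + \<Lambda>1) + p2 * \<phi> (t + \<Lambda>2)) \<partial>lebesgue)"
proof -
  have w: "in_L2 w" and z: "in_L2 z"
    and eq: "AE t in lebesgue. 0 < t \<and> t < T \<longrightarrow>
        z t = delayed w z t"
    using r by (auto simp: zero_response_def dynamics_def)
  have i: "integrable lebesgue (\<lambda>t. \<phi> (t + d) * v t)" "integrable lebesgue (\<lambda>t. \<phi> t * v (t - d))"
    "integrable lebesgue (\<lambda>t. \<phi> t * v t)"
    if "in_L2 v" for v d
    using that \<phi> by (auto intro!: in_L2_product in_L2_shift in_L2_shift')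
  have shift: "(\<integral>t. \<phi> (t + d) * v t \<partial>lebesgue) = (\<integral>t. \<phi> t * v (t - d) \<partial>lebesgue)" for v d
    using lebesgue_integral_shift[of "\<lambda>t. \<phi> t * v (t - d)" d] by simp
  have "(\<integral>t. z t * (\<phi> t - q1 * \<phi> (t + \<Lambda>1) - q2 * \<phi> (t + \<Lambda>2)) \<partial>lebesgue)
      - (\<integral>t. w t * (p1 * \<phi> (t + \<Lambda>1) + p2 * \<phi> (t + \<Lambda>2)) \<partial>lebesgue)
    = (\<integral>t. \<phi> t * z t - q1 * (\<phi> (t + \<Lambda>1) * z t) - q2 * (\<phi> (t + \<Lambda>2) * z t) \<partial>lebesgue)
      - (\<integral>t. p1 * (\<phi> (t + \<Lambda>1) * w t) + p2 * (\<phi> (t + \<Lambda>2) * w t) \<partial>lebesgue)"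
    by (simp add: algebra_simps)
  also have "\<dots> = (\<integral>t. \<phi> t * z t \<partial>lebesgue) - q1 * (\<integral>t. \<phi> (t + \<Lambda>1) * z t \<partial>lebesgue) - q2 * (\<integral>t. \<phi> (t + \<Lambda>2) * z t \<partial>lebesgue)
      - p1 * (\<integral>t. \<phi> (t + \<Lambda>1) * w t \<partial>lebesgue) - p2 * (\<integral>t. \<phi> (t + \<Lambda>2) * w t \<partial>lebesgue)"
    using i[OF w] i[OF z] by simp
  also have "\<dots> = (\<integral>t. \<phi> t * z t \<partial>lebesgue) - q1 * (\<integral>t. \<phi> t * z (t - \<Lambda>1) \<partial>lebesgue) - q2 * (\<integral>t. \<phi> t * z (t - \<Lambda>2) \<partial>lebesgue)
      - p1 * (\<integral>t. \<phi> t * w (t - \<Lambda>1) \<partial>lebesgue) - p2 * (\<integral>t. \<phi> t * w (t - \<Lambda>2) \<partial>lebesgue)"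
    by (simp only: shift)
  also have "\<dots> = (\<integral>t. \<phi> t * z t - q1 * (\<phi> t * z (t - \<Lambda>1)) - q2 * (\<phi> t * z (t - \<Lambda>2))
      - p1 * (\<phi> t * w (t - \<Lambda>1)) - p2 * (\<phi> t * w (t - \<Lambda>2)) \<partial>lebesgue)"
    using i[OF w] i[OF z] by simp
  also have "\<dots> = 0"
  proof (rule integral_eq_zero_AE)
    show "AE t in lebesgue. \<phi> t * z t - q1 * (\<phi> t * z (t - \<Lambda>1)) - q2 * (\<phi> t * z (t - \<Lambda>2))
      - p1 * (\<phi> t * w (t - \<Lambda>1)) - p2 * (\<phi> t * w (t - \<Lambda>2)) = 0"
      using eq
    proof eventually_elim
      case (elim t)
      then show ?case using supp[of t] by (cases "0 < t \<and> t < T") (auto simp: algebra_simps)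
    qed
  qed
  finally show ?thesis by simp
qed

text \<open>The hypotheses make the adjoint components a and b vanish before the last window, so by
  duality every reachable final state is annihilated by their restrictions to it. Density forces
  these to vanish. On the last window \<phi> (t + \<Lambda>1) = 0, and what remains of a = 0 is
  \<phi> t = q2 \<phi> (t + \<Lambda>2), which carries the zero backwards from T.\<close>

lemma approximable_annihilator:
  assumes ap: approximable and \<phi>: "in_L2 \<phi>" and supp: "\<And>t. t \<le> 0 \<or> T \<le> t \<Longrightarrow> \<phi> t = 0"
    and a0: "\<And>t. 0 < t \<Longrightarrow> t < T - \<Lambda>1 \<Longrightarrow> \<phi> t = q1 * \<phi> (t + \<Lambda>1) + q2 * \<phi> (t + \<Lambda>2)"
    and b0: "\<And>t. 0 < t \<Longrightarrow> t < T - \<Lambda>1 \<Longrightarrow> p1 * \<phi> (t + \<Lambda>1) + p2 * \<phi> (t + \<Lambda>2) = 0"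
  shows "AE t in lebesgue. T - \<Lambda>1 < t \<longrightarrow> \<phi> t = 0"
proof -
  define a where "a t = \<phi> t - q1 * \<phi> (t + \<Lambda>1) - q2 * \<phi> (t + \<Lambda>2)" for t
  define b where "b t = p1 * \<phi> (t + \<Lambda>1) + p2 * \<phi> (t + \<Lambda>2)" for t
  \<comment> \<open>The maximum with 0 accounts for windows that begin before 0, where the responses
    vanish.\<close>
  define a' where "a' t = (if max (T - \<Lambda>1) 0 < t \<and> t < T then a t else 0)" for t
  define b' where "b' t = (if max (T - \<Lambda>1) 0 < t \<and> t < T then b t else 0)" for t
  have trunc: "v t * a t = v t * a' t" "v t * b t = v t * b' t"
    if "t \<noteq> T - \<Lambda>1" "\<And>t. t \<le> 0 \<or> T \<le> t \<Longrightarrow> v t = 0" for v t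
  proof -
    have "0 < t \<Longrightarrow> t < T - \<Lambda>1 \<Longrightarrow> a t = 0 \<and> b t = 0"
      using a0[of t] b0[of t] by (simp add: a_def b_def)
    then have "v t * a t = v t * a' t \<and> v t * b t = v t * b' t"
      using that by (cases "t \<le> 0 \<or> T \<le> t") (auto simp: a'_def b'_def)
    then show "v t * a t = v t * a' t" "v t * b t = v t * b' t" by auto
  qed
  have a': "in_L2 a'"
    unfolding a'_def a_def by (intro in_L2_intros \<phi> in_L2_shift[OF \<phi>]) auto
  have b': "in_L2 b'"
    unfolding b'_def b_def by (intro in_L2_intros \<phi> in_L2_shift[OF \<phi>]) auto
  let ?A = "\<integral>t. (cmod (a' t))\<^sup>2 \<partial>lebesgue" and ?B = "\<integral>t. (cmod (b' t))\<^sup>2 \<partial>lebesgue"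
  have ia: "integrable lebesgue (\<lambda>t. (cmod (a' t))\<^sup>2)" and ib: "integrable lebesgue (\<lambda>t. (cmod (b' t))\<^sup>2)"
    using a' b' by (auto simp: in_L2_def)
  have est: "?A + ?B \<le> 4 * \<epsilon>" if \<epsilon>: "\<epsilon> > 0" for \<epsilon>
  proof -
    \<comment> \<open>Conjugates of a' and - b' as target: on an exact hit the pairing would equal
      \<open>?A + ?B\<close>, while duality makes it zero.\<close>
    define zy where "zy t = cnj (a' t)" for t
    define wy where "wy t = - cnj (b' t)" for t
    have "in_L2 wy" "in_L2 zy"
      unfolding wy_def zy_def using a' b' by (auto intro!: in_L2_intros)
    with ap \<epsilon> obtain w z where r: "zero_response w z" and
      ew: "window_energy (\<lambda>t. w t - wy t) < \<epsilon>" and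
      ez: "window_energy (\<lambda>t. z t - zy t) < \<epsilon>"
      unfolding approximable_def by blast
    have w: "in_L2 w" and z: "in_L2 z"
      and out: "\<And>t. t \<le> 0 \<or> T \<le> t \<Longrightarrow> w t = 0 \<and> z t = 0"
      using r by (auto simp: zero_response_def dynamics_def)
  \<comment> \<open>The majorant of |f| from x y \<le> x^2 + y^2 / 4. It contains only a quarter of
    the integrand of \<open>?A + ?B\<close>, which is absorbed on the left in the end.\<close>
  let ?R = "\<lambda>t. (if T - \<Lambda>1 < t \<and> t < T then (cmod (z t - zy t))\<^sup>2 else 0)
         + (if T - \<Lambda>1 < t \<and> t < T then (cmod (w t - wy t))\<^sup>2 else 0) + ((cmod (a' t))\<^sup>2 + (cmod (b' t))\<^sup>2) / 4"
    have za: "(\<integral>t. z t * a t \<partial>lebesgue) = (\<integral>t. z t * a' t \<partial>lebesgue)"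
    proof (rule integral_cong_AE)
      show "AE t in lebesgue. z t * a t = z t * a' t"
        using AE_lebesgue_neq[of "T - \<Lambda>1"]
        by eventually_elim (use trunc(1) out in blast)
      show "(\<lambda>t. z t * a t) \<in> borel_measurable lebesgue"
        unfolding a_def by (intro borel_measurable_integrable in_L2_product in_L2_intros \<phi> in_L2_shift[OF \<phi>] z)
      show "(\<lambda>t. z t * a' t) \<in> borel_measurable lebesgue"
        by (intro borel_measurable_integrable in_L2_product a' z)
    qed
    have wb: "(\<integral>t. w t * b t \<partial>lebesgue) = (\<integral>t. w t * b' t \<partial>lebesgue)"
    proof (rule integral_cong_AE)
      show "AE t in lebesgue. w t * b t = w t * b' t"
        using AE_lebesgue_neq[of "T - \<Lambda>1"]
        by eventually_elim (use trunc(2) out in blast)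
      show "(\<lambda>t. w t * b t) \<in> borel_measurable lebesgue"
        unfolding b_def by (intro borel_measurable_integrable in_L2_product in_L2_intros \<phi> in_L2_shift[OF \<phi>] w)
      show "(\<lambda>t. w t * b' t) \<in> borel_measurable lebesgue"
        by (intro borel_measurable_integrable in_L2_product b' w)
    qed
    have zero: "(\<integral>t. z t * a' t \<partial>lebesgue) = (\<integral>t. w t * b' t \<partial>lebesgue)"
      using dual_identity[OF r \<phi> supp] za wb by (simp add: a_def b_def)
    define f where "f t = (zy t - z t) * a' t - (wy t - w t) * b' t" for t
    have zy: "in_L2 zy" and wy: "in_L2 wy"
      unfolding wy_def zy_def using a' b' by (auto intro!: in_L2_intros)
    have i_f: "integrable lebesgue f"
      unfolding f_def by (intro Bochner_Integration.integrable_diff in_L2_product in_L2_diff zy wy z w a' b')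
    have "complex_of_real (?A + ?B) = (\<integral>t. complex_of_real ((cmod (a' t))\<^sup>2 + (cmod (b' t))\<^sup>2) \<partial>lebesgue)"
      by (simp only: integral_complex_of_real Bochner_Integration.integral_add[OF ia ib])
    also have "\<dots> = (\<integral>t. f t + z t * a' t - w t * b' t \<partial>lebesgue)"
      unfolding f_def zy_def wy_def by (simp only: of_real_add complex_norm_square) (simp add: algebra_simps)
    also have "\<dots> = (\<integral>t. f t \<partial>lebesgue)"
      using zero in_L2_product[OF z a'] in_L2_product[OF w b'] i_f by simp
    finally have "?A + ?B \<le> cmod (\<integral>t. f t \<partial>lebesgue)"
      by (metis complex_Re_le_cmod Re_complex_of_real)
    also have "\<dots> \<le> (\<integral>t. cmod (f t) \<partial>lebesgue)" by (rule integral_norm_bound)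
    also have "\<dots> \<le> (\<integral>t. ?R t \<partial>lebesgue)"
    proof (rule integral_mono)
      show "integrable lebesgue (\<lambda>t. cmod (f t))" using i_f by simp
      show "integrable lebesgue (\<lambda>t. ?R t)"
        using ia ib by (intro Bochner_Integration.integrable_add integrable_restrict_interval
          in_L2_integrable in_L2_diff zy wy z w) auto
      fix t
      have prod: "cmod (u * v) \<le> (cmod u)\<^sup>2 + (cmod v)\<^sup>2 / 4" for u v
        using sum_squares_ge_zero[of "cmod u - cmod v / 2" 0]
        by (simp add: norm_mult power2_eq_square algebra_simps)
      have "cmod (f t) \<le> cmod ((zy t - z t) * a' t) + cmod ((wy t - w t) * b' t)"
        unfolding f_def by (rule norm_triangle_ineq4)
      also have "\<dots> \<le> ?R t"
        using prod[of "zy t - z t" "a' t"] prod[of "wy t - w t" "b' t"]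
        by (auto simp: a'_def b'_def norm_minus_commute add_divide_distrib)
      finally show "cmod (f t) \<le> ?R t" .
    qed
    also have "\<dots> = window_energy (\<lambda>t. z t - zy t)
        + window_energy (\<lambda>t. w t - wy t) + (?A + ?B) / 4"
      using ia ib integrable_restrict_interval[OF in_L2_integrable[OF in_L2_diff[OF z zy]], of "T - \<Lambda>1" T]
       integrable_restrict_interval[OF in_L2_integrable[OF in_L2_diff[OF w wy]], of "T - \<Lambda>1" T] by simp
    finally have "?A + ?B \<le> \<dots>" .
    moreover have "X \<le> 4 * \<epsilon>" if "X \<le> x + y + X / 4" "x < \<epsilon>" "y < \<epsilon>" for X x y :: real
      using that \<epsilon> by linarith
    ultimately show ?thesis using ez ew by blast
  qed
  have A0: "0 \<le> ?A" and B0: "0 \<le> ?B" by simp_all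
  have "?A + ?B \<le> 0"
  proof (rule ccontr)
    assume "\<not> ?thesis"
    then show False using est[of "(?A + ?B) / 8"] by simp
  qed
  then have "?A = 0" using A0 B0 by linarith
  then have "AE t in lebesgue. a' t = 0"
    using integral_nonneg_eq_0_iff_AE[OF ia] by simp
  then have rec: "AE t in lebesgue. T - \<Lambda>1 < t \<and> 0 < t \<longrightarrow> \<phi> t = q2 * \<phi> (t + \<Lambda>2)"
  proof eventually_elim
    case (elim t)
    then show ?case using supp[of "t + \<Lambda>1"] supp[of t] supp[of "t + \<Lambda>2"] \<Lambda>2_pos
      by (cases "t < T") (auto simp: a'_def a_def)
  qed
  have steps: "AE t in lebesgue. T - \<Lambda>1 < t \<and> T - real k * \<Lambda>2 \<le> t \<longrightarrow> \<phi> t = 0" for k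
  proof (induction k)
    case 0
    then show ?case using supp by (intro AE_I2) auto
  next
    case (Suc k)
    show ?case
      using AE_lebesgue_shift[OF Suc, of \<Lambda>2] rec
    proof eventually_elim
      case (elim t)
      show ?case
        using elim supp[of t] \<Lambda>2_pos by (cases "0 < t") (auto simp: algebra_simps)
    qed
  qed
  obtain k where "\<Lambda>1 / \<Lambda>2 \<le> real k" using real_arch_simple by blast
  then have "\<Lambda>1 \<le> real k * \<Lambda>2" using \<Lambda>2_pos by (simp add: field_simps)
  with steps[of k] show ?thesis by (auto elim!: eventually_mono)
qed

text \<open>With p1 = q1 = 0 the two conditions involve \<phi> only at t and t + \<Lambda>2 with t <
  T - \<Lambda>1, and the interval (l, T) avoids both points.\<close>

lemma not_approximable_no_first_delay:
  assumes "p1 = 0" "q1 = 0"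
  shows "\<not> approximable"
proof
  assume ap: approximable
  define l where "l = max 0 (max (T - \<Lambda>2) (T - (\<Lambda>1 - \<Lambda>2)))"
  define \<phi> where "\<phi> t = (if l < t \<and> t < T then 1 else 0 :: complex)" for t
  have "l < T" using T_pos \<Lambda>2_pos \<Lambda>2_less by (simp add: l_def)
  have "AE t in lebesgue. T - \<Lambda>1 < t \<longrightarrow> \<phi> t = 0"
  proof (rule approximable_annihilator[OF ap])
    show "in_L2 \<phi>" unfolding \<phi>_def by (rule in_L2_indicator)
  qed (use assms \<Lambda>2_pos \<Lambda>2_less in \<open>auto simp: \<phi>_def l_def\<close>)
  then obtain t where "l < t" "t < T" "T - \<Lambda>1 < t \<longrightarrow> \<phi> t = 0"
    using AE_interval_witness[OF _ \<open>l < T\<close>] by blast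
  then show False using \<Lambda>2_less by (auto simp: \<phi>_def l_def)
qed

text \<open>With p1 = p2 = 0 the control never reaches z. The condition on p1 and p2 holds
  trivially, and the other one is a delay equation run backwards from T. A source on the last
  stretch of length \<Lambda>2, outside the range of the condition, makes its solution
  nonzero.\<close>

lemma not_approximable_uncontrolled:
  assumes "p1 = 0" "p2 = 0"
  shows "\<not> approximable"
proof
  assume ap: approximable
  obtain \<zeta> where \<zeta>: "in_L2 \<zeta>" "\<And>t. t \<le> 0 \<Longrightarrow> \<zeta> t = 0"
    "\<And>t. 0 < t \<Longrightarrow> t < T \<Longrightarrow> \<zeta> t = (if 0 < t \<and> t < \<Lambda>2 then 1 else 0) + q1 * \<zeta> (t - \<Lambda>1) + q2 * \<zeta> (t - \<Lambda>2)"
    using delay_equation_solvable[OF \<Lambda>1_pos \<Lambda>2_pos in_L2_indicator[of 0 \<Lambda>2 1] in_L2_zero, of T q1 q2]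
    by metis
  define \<phi> where "\<phi> t = (if 0 < t \<and> t < T then \<zeta> (T - t) else 0)" for t
  have "in_L2 (\<lambda>t. \<zeta> (T - t))"
    using in_L2_affine[OF \<zeta>(1), of "-1" T] by simp
  then have sq: "in_L2 \<phi>"
    unfolding \<phi>_def by (intro in_L2_restrict) auto
  define l where "l = max 0 (T - \<Lambda>2)"
  have "l < T" using T_pos \<Lambda>2_pos by (simp add: l_def)
  have "AE t in lebesgue. T - \<Lambda>1 < t \<longrightarrow> \<phi> t = 0"
  proof (rule approximable_annihilator[OF ap sq])
    fix t assume t: "0 < t" "t < T - \<Lambda>1"
    have "\<phi> (t + e) = \<zeta> (T - t - e)" if "0 < e" for e
      using t that \<zeta>(2)[of "T - t - e"] by (auto simp: \<phi>_def algebra_simps)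
    then show "\<phi> t = q1 * \<phi> (t + \<Lambda>1) + q2 * \<phi> (t + \<Lambda>2)"
      using \<zeta>(3)[of "T - t"] t \<Lambda>1_pos \<Lambda>2_pos \<Lambda>2_less by (simp add: \<phi>_def[of t])
  qed (use assms in \<open>auto simp: \<phi>_def\<close>)
  then obtain t where t: "l < t" "t < T" "T - \<Lambda>1 < t \<longrightarrow> \<phi> t = 0"
    using AE_interval_witness[OF _ \<open>l < T\<close>] by blast
  then have "\<zeta> (T - t) = 1"
    using \<zeta>(3)[of "T - t"] \<zeta>(2)[of "T - t - \<Lambda>1"] \<zeta>(2)[of "T - t - \<Lambda>2"] \<Lambda>2_less by (auto simp: l_def)
  then show False using t \<Lambda>2_less by (auto simp: \<phi>_def l_def)
qed

text \<open>If T \<le> \<Lambda>1, no t satisfies 0 < t < T - \<Lambda>1 and every \<phi> on (0, T)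
  is an annihilator.\<close>

lemma approximable_time_ge_delay:
  assumes ap: approximable
  shows "\<Lambda>1 < T"
proof (rule ccontr)
  assume T: "\<not> ?thesis"
  define \<phi> where "\<phi> t = (if 0 < t \<and> t < T then 1 else 0 :: complex)" for t
  have "AE t in lebesgue. T - \<Lambda>1 < t \<longrightarrow> \<phi> t = 0"
    by (rule approximable_annihilator[OF ap])
       (use T in \<open>auto simp: \<phi>_def intro: in_L2_indicator\<close>)
  then obtain t where "0 < t" "t < T" "T - \<Lambda>1 < t \<longrightarrow> \<phi> t = 0"
    using AE_interval_witness[OF _ T_pos] by blast
  then show False using T by (auto simp: \<phi>_def)
qed

text \<open>With p1 = 0 it is enough that \<phi> vanishes on (\<Lambda>2, T - \<Lambda>1 +
  \<Lambda>2) and that \<phi> t = q1 \<phi> (t + \<Lambda>1) for 0 < t < T - \<Lambda>1. For T < 2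
  \<Lambda>1 there is room for (l, r) to the right of that interval such that its translate by -
  \<Lambda>1 ends at \<Lambda>2 at the latest, hence to the left of it.\<close>

lemma approximable_time_bound_p1_zero:
  assumes ap: approximable and "p1 = 0"
  shows "2 * \<Lambda>1 \<le> T"
proof (rule ccontr)
  assume T: "\<not> ?thesis"
  have T1: "\<Lambda>1 < T" using approximable_time_ge_delay[OF ap] .
  define l where "l = T - (\<Lambda>1 - \<Lambda>2)"
  define r where "r = min T (\<Lambda>1 + \<Lambda>2)"
  have "l < r" using T \<Lambda>2_less by (simp add: l_def r_def)
  define \<phi> where "\<phi> t = (if l < t \<and> t < r then 1 else 0) +
      (if max 0 (l - \<Lambda>1) < t \<and> t < r - \<Lambda>1 then q1 else 0)" for t
  have "AE t in lebesgue. T - \<Lambda>1 < t \<longrightarrow> \<phi> t = 0"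
  proof (rule approximable_annihilator[OF ap])
    show "in_L2 \<phi>" unfolding \<phi>_def by (intro in_L2_intros)
    show "\<phi> t = 0" if "t \<le> 0 \<or> T \<le> t" for t
      using that T T1 \<Lambda>2_pos \<Lambda>2_less by (auto simp: \<phi>_def l_def r_def)
    show "\<phi> t = q1 * \<phi> (t + \<Lambda>1) + q2 * \<phi> (t + \<Lambda>2)" "p1 * \<phi> (t + \<Lambda>1) + p2 * \<phi> (t + \<Lambda>2) = 0"
      if "0 < t" "t < T - \<Lambda>1" for t
      using that assms T \<Lambda>2_pos \<Lambda>2_less by (auto simp: \<phi>_def l_def r_def)
  qed
  then obtain t where "l < t" "t < r" "T - \<Lambda>1 < t \<longrightarrow> \<phi> t = 0"
    using AE_interval_witness[OF _ \<open>l < r\<close>] by blast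
  then show False using T1 \<Lambda>2_pos by (auto simp: \<phi>_def l_def r_def split: if_splits)
qed

text \<open>The two annihilator conditions tie \<open>\<phi>\<close> at \<open>t\<close> and at \<open>t + \<Lambda>1\<close> to its value at \<open>t + \<Lambda>2\<close>: modulo
  \<open>\<Lambda>1\<close> this is a rotation, and it is left unconstrained on the gap \<open>(T - \<Lambda>1, \<Lambda>1)\<close>. A point of the gap
  which returns to the gap, say after \<open>N\<close> steps, carries a chain of \<open>N\<close> points on which a nonzero
  \<open>\<phi>\<close> can be prescribed.\<close>

lemma approximable_time_bound_p1_nonzero:
  assumes ap: approximable and "p1 \<noteq> 0"
  shows "2 * \<Lambda>1 \<le> T"
proof (rule ccontr)
  assume T: "\<not> ?thesis"
  have T1: "\<Lambda>1 < T" using approximable_time_ge_delay[OF ap] .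
  define \<delta> where "\<delta> = 2 * \<Lambda>1 - T"
  have \<delta>: "\<delta> > 0" using T by (simp add: \<delta>_def)
  \<comment> \<open>Dirichlet's theorem with this K gives a number N of rotation steps whose net
    displacement d modulo \<Lambda>1 is smaller than the length \<delta> of the gap, whether or not
    the delays are commensurable.\<close>
  obtain K :: nat where K: "\<Lambda>1 / \<delta> < real K" using reals_Archimedean2 by blast
  have "0 < \<Lambda>1 / \<delta>" using \<Lambda>1_pos \<delta> by simp
  then have "0 < real K" using K by linarith
  then have "K > 0" by simp
  then obtain M k where k: "0 < k" "\<bar>of_int k * (\<Lambda>2 / \<Lambda>1) - of_int M\<bar> < 1 / real K"
    using Dirichlet_approx[of K "\<Lambda>2 / \<Lambda>1"] by metis
  define N where "N = nat k"
  define d where "d = real N * \<Lambda>2 - of_int M * \<Lambda>1"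
  have "d = \<Lambda>1 * (of_int k * (\<Lambda>2 / \<Lambda>1) - of_int M)"
    using k(1) \<Lambda>1_pos by (simp add: d_def N_def algebra_simps)
  then have "\<bar>d\<bar> = \<Lambda>1 * \<bar>of_int k * (\<Lambda>2 / \<Lambda>1) - of_int M\<bar>"
    using \<Lambda>1_pos by (simp only: abs_mult abs_of_pos)
  also have "\<dots> < \<Lambda>1 * (1 / real K)"
    using k(2) \<Lambda>1_pos by (intro mult_strict_left_mono)
  also have "\<dots> < \<delta>" using K \<open>0 < real K\<close> \<delta> by (simp add: field_simps)
  finally have d: "\<bar>d\<bar> < \<delta>" .
  \<comment> \<open>(l, r) is the intersection of the gap with the gap shifted by d, so N steps lead
    from it back into the gap.\<close>
  define l where "l = max (T - \<Lambda>1) (T - \<Lambda>1 + d)"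
  define r where "r = min \<Lambda>1 (\<Lambda>1 + d)"
  have lr: "l < r" using d \<delta> by (auto simp: l_def r_def \<delta>_def)
  \<comment> \<open>The annihilator conditions solved for the two unknowns: \<phi> (t + \<Lambda>1)
    = - \<gamma> \<phi> (t + \<Lambda>2) and \<phi> t = \<kappa> \<phi> (t + \<Lambda>2).\<close>
  define \<gamma> where "\<gamma> = p2 / p1"
  define \<kappa> where "\<kappa> = q2 - \<gamma> * q1"
  \<comment> \<open>\<open>\<psi> n\<close> is the initial bump carried through n steps of this
    recursion; the value 0 on the gap ends each chain there.\<close>
  define \<psi> where "\<psi> = rec_nat (\<lambda>t. if l < t \<and> t < r then 1 else 0)
    (\<lambda>n f t. if 0 < t \<and> t < T - \<Lambda>1 then \<kappa> * f (t + \<Lambda>2) else if \<Lambda>1 < t \<and> t < T then - \<gamma> * f (t - (\<Lambda>1 - \<Lambda>2)) else 0)"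
  have \<psi>0: "\<psi> 0 t = (if l < t \<and> t < r then 1 else 0)" and
    \<psi>Suc: "\<psi> (Suc n) t = (if 0 < t \<and> t < T - \<Lambda>1 then \<kappa> * \<psi> n (t + \<Lambda>2) else if \<Lambda>1 < t \<and> t < T then - \<gamma> * \<psi> n (t - (\<Lambda>1 - \<Lambda>2)) else 0)"
    for n t by (simp_all add: \<psi>_def)
  have sq: "in_L2 (\<psi> n)" for n
  proof (induction n)
    case 0
    show ?case unfolding \<psi>0[abs_def] by (rule in_L2_indicator)
  next
    case (Suc n)
    show ?case unfolding \<psi>Suc[abs_def] by (intro in_L2_intros in_L2_shift[OF Suc] in_L2_shift'[OF Suc]) auto
  qed
  have supp: "0 < t \<and> t < T" if "\<psi> n t \<noteq> 0" for n t
    using that T T1 by (cases n) (auto simp: \<psi>0 \<psi>Suc l_def r_def split: if_splits)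
  have hit: "\<exists>m::int. l < t + real n * \<Lambda>2 - of_int m * \<Lambda>1 \<and> t + real n * \<Lambda>2 - of_int m * \<Lambda>1 < r" if "\<psi> n t \<noteq> 0" for n t
    using that
  proof (induction n arbitrary: t)
    case 0
    then show ?case by (intro exI[of _ 0]) (auto simp: \<psi>0 split: if_splits)
  next
    case (Suc n)
    consider "\<psi> n (t + \<Lambda>2) \<noteq> 0" | "\<psi> n (t - (\<Lambda>1 - \<Lambda>2)) \<noteq> 0"
      using Suc.prems by (auto simp: \<psi>Suc split: if_splits)
    then show ?case
    proof cases
      case 1
      from Suc.IH[OF this] obtain m :: int where "l < t + \<Lambda>2 + real n * \<Lambda>2 - of_int m * \<Lambda>1 \<and> t + \<Lambda>2 + real n * \<Lambda>2 - of_int m * \<Lambda>1 < r" by blast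
      then show ?thesis by (intro exI[of _ m]) (simp add: algebra_simps)
    next
      case 2
      from Suc.IH[OF this] obtain m :: int where "l < t - (\<Lambda>1 - \<Lambda>2) + real n * \<Lambda>2 - of_int m * \<Lambda>1 \<and> t - (\<Lambda>1 - \<Lambda>2) + real n * \<Lambda>2 - of_int m * \<Lambda>1 < r" by blast
      then show ?thesis by (intro exI[of _ "m + 1"]) (simp add: algebra_simps)
    qed
  qed
  \<comment> \<open>The choice of N pays off: the support of \<open>\<psi> N\<close> would have to
    lie in the gap, where every later \<open>\<psi>\<close> is zero. Hence the sum over n < N
    satisfies the recursion without a remainder.\<close>
  have N: "\<psi> N t = 0" for t
  proof (rule ccontr)
    assume nz: "\<psi> N t \<noteq> 0"
    obtain m :: int where m: "l < t + real N * \<Lambda>2 - of_int m * \<Lambda>1" "t + real N * \<Lambda>2 - of_int m * \<Lambda>1 < r"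
      using hit[OF nz] by blast
    define k' where "k' = M - m"
    have "t + real N * \<Lambda>2 - of_int m * \<Lambda>1 = t + d + of_int k' * \<Lambda>1"
      by (simp add: d_def k'_def algebra_simps)
    then have t: "T - \<Lambda>1 < t + of_int k' * \<Lambda>1" "t + of_int k' * \<Lambda>1 < \<Lambda>1"
      using m by (auto simp: l_def r_def)
    have "k' < 1"
    proof (rule ccontr)
      assume "\<not> k' < 1"
      then have "1 * \<Lambda>1 \<le> of_int k' * \<Lambda>1" using \<Lambda>1_pos by (intro mult_right_mono) auto
      then show False using t supp[OF nz] by linarith
    qed
    moreover have "- 1 < k'"
    proof (rule ccontr)
      assume "\<not> - 1 < k'"
      then have "of_int k' * \<Lambda>1 \<le> (- 1) * \<Lambda>1" using \<Lambda>1_pos by (intro mult_right_mono) auto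
      then show False using t supp[OF nz] by linarith
    qed
    ultimately have "k' = 0" by simp
    moreover obtain n where "N = Suc n" using k(1) by (cases N) (auto simp: N_def)
    ultimately show False using t nz by (auto simp: \<psi>Suc split: if_splits)
  qed
  define \<phi> where "\<phi> t = (\<Sum>n<N. \<psi> n t)" for t
  have shifted: "\<phi> t = (\<Sum>n<N. \<psi> (Suc n) t)" if "\<psi> 0 t = 0" for t
    using that N[of t] sum.lessThan_Suc_shift[of "\<lambda>n. \<psi> n t" N] by (simp add: \<phi>_def)
  have up: "\<phi> (t + \<Lambda>1) = - \<gamma> * \<phi> (t + \<Lambda>2)" and low: "\<phi> t = \<kappa> * \<phi> (t + \<Lambda>2)" if t: "0 < t" "t < T - \<Lambda>1" for t
  proof -
    have "\<phi> (t + \<Lambda>1) = (\<Sum>n<N. \<psi> (Suc n) (t + \<Lambda>1))"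
      using t by (intro shifted) (auto simp: \<psi>0 r_def)
    also have "\<dots> = (\<Sum>n<N. - \<gamma> * \<psi> n (t + \<Lambda>2))"
      using t T by (intro sum.cong) (auto simp: \<psi>Suc algebra_simps)
    finally show "\<phi> (t + \<Lambda>1) = - \<gamma> * \<phi> (t + \<Lambda>2)" by (simp only: \<phi>_def sum_distrib_left)
    have "\<phi> t = (\<Sum>n<N. \<psi> (Suc n) t)"
      using t by (intro shifted) (auto simp: \<psi>0 l_def)
    also have "\<dots> = (\<Sum>n<N. \<kappa> * \<psi> n (t + \<Lambda>2))"
      using t by (intro sum.cong) (auto simp: \<psi>Suc)
    finally show "\<phi> t = \<kappa> * \<phi> (t + \<Lambda>2)" by (simp only: \<phi>_def sum_distrib_left)
  qed
  have "AE t in lebesgue. T - \<Lambda>1 < t \<longrightarrow> \<phi> t = 0"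
  proof (rule approximable_annihilator[OF ap])
    show "in_L2 \<phi>" unfolding \<phi>_def by (intro in_L2_sum sq)
    show "\<phi> t = 0" if "t \<le> 0 \<or> T \<le> t" for t
      unfolding \<phi>_def using supp[of _ t] that by (intro sum.neutral) force
    show "\<phi> t = q1 * \<phi> (t + \<Lambda>1) + q2 * \<phi> (t + \<Lambda>2)" if "0 < t" "t < T - \<Lambda>1" for t
      using up[OF that] low[OF that] by (simp add: \<kappa>_def algebra_simps)
    show "p1 * \<phi> (t + \<Lambda>1) + p2 * \<phi> (t + \<Lambda>2) = 0" if "0 < t" "t < T - \<Lambda>1" for t
      using up[OF that] assms(2) by (simp add: \<gamma>_def)
  qed
  then obtain t where t: "l < t" "t < r" "T - \<Lambda>1 < t \<longrightarrow> \<phi> t = 0"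
    using AE_interval_witness[OF _ lr] by blast
  have gap: "T - \<Lambda>1 < t" "t < \<Lambda>1" using t by (auto simp: l_def r_def)
  obtain n where n: "N = Suc n" using k(1) by (cases N) (auto simp: N_def)
  have "\<phi> t = \<psi> 0 t + (\<Sum>i<n. \<psi> (Suc i) t)"
    unfolding \<phi>_def n by (rule sum.lessThan_Suc_shift)
  also have "\<dots> = 1" using t gap by (simp add: \<psi>0 \<psi>Suc)
  finally show False using t gap by simp
qed

lemma approximable_time_bound: "approximable \<Longrightarrow> 2 * \<Lambda>1 \<le> T"
  using approximable_time_bound_p1_zero approximable_time_bound_p1_nonzero by blast

text \<open>The exponential \<open>exp (- s t)\<close> solves the adjoint equation when \<open>s\<close> violates the Hautus test.\<close>

lemma approximable_no_eigenvalue: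
  assumes ap: approximable and "p2 \<noteq> 0"
    and \<alpha>: "exp (s * of_real \<Lambda>1) = q1 - p1 / p2 * q2" and \<beta>: "exp (s * of_real (\<Lambda>1 - \<Lambda>2)) = - (p1 / p2)"
  shows False
proof -
  define \<phi> where "\<phi> t = (if 0 < t \<and> t < T then exp (- s * of_real t) else 0)" for t
  have T1: "\<Lambda>1 < T" using approximable_time_ge_delay[OF ap] .
  have 1: "exp (- s * of_real (t + \<Lambda>2)) = - (p1 / p2) * exp (- s * of_real (t + \<Lambda>1))" for t
    unfolding \<beta>[symmetric] by (simp add: algebra_simps flip: exp_add)
  have 2: "exp (- s * of_real t) = (q1 - p1 / p2 * q2) * exp (- s * of_real (t + \<Lambda>1))" for t
    unfolding \<alpha>[symmetric] by (simp add: algebra_simps flip: exp_add)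
  have "AE t in lebesgue. T - \<Lambda>1 < t \<longrightarrow> \<phi> t = 0"
  proof (rule approximable_annihilator[OF ap])
    show "in_L2 \<phi>"
      unfolding \<phi>_def by (rule in_L2_continuous_on_interval) (intro continuous_intros)
    fix t assume t: "0 < t" "t < T - \<Lambda>1"
    then have ev: "\<phi> t = exp (- s * of_real t)" "\<phi> (t + \<Lambda>1) = exp (- s * of_real (t + \<Lambda>1))" "\<phi> (t + \<Lambda>2) = exp (- s * of_real (t + \<Lambda>2))"
      using \<Lambda>1_pos \<Lambda>2_pos \<Lambda>2_less by (auto simp: \<phi>_def)
    show "\<phi> t = q1 * \<phi> (t + \<Lambda>1) + q2 * \<phi> (t + \<Lambda>2)"
      unfolding ev 1[of t] 2[of t] by (simp add: algebra_simps)
    show "p1 * \<phi> (t + \<Lambda>1) + p2 * \<phi> (t + \<Lambda>2) = 0"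
      unfolding ev 1[of t] using \<open>p2 \<noteq> 0\<close> by simp
  qed (auto simp: \<phi>_def)
  then obtain t where "T - \<Lambda>1 < t" "t < T" "T - \<Lambda>1 < t \<longrightarrow> \<phi> t = 0"
    using AE_interval_witness[of "\<lambda>t. T - \<Lambda>1 < t \<longrightarrow> \<phi> t = 0" "T - \<Lambda>1" T] \<Lambda>1_pos by auto
  then show False using T1 by (auto simp: \<phi>_def)
qed

end

section \<open>Steering in time at least \<open>2 \<Lambda>1\<close>\<close>

text \<open>On \<open>(0, \<Lambda>1)\<close> this is the translation by \<open>\<Lambda>1 - \<Lambda>2\<close> of the extension of \<open>m\<close> with
  \<open>m (c + \<Lambda>1) = \<alpha> * m c\<close>.\<close>

definition quasi_shift :: "complex \<Rightarrow> real \<Rightarrow> real \<Rightarrow> (real \<Rightarrow> complex) \<Rightarrow> real \<Rightarrow> complex" where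
  "quasi_shift \<alpha> \<Lambda>1 \<Lambda>2 m c = (if c < \<Lambda>2 then m (c + (\<Lambda>1 - \<Lambda>2)) else \<alpha> * m (c - \<Lambda>2))"

lemma in_L2_quasi_shift:
  assumes "in_L2 m"
  shows "in_L2 (quasi_shift \<alpha> \<Lambda>1 \<Lambda>2 m)"
  unfolding quasi_shift_def[abs_def]
  by (intro in_L2_intros in_L2_shift[OF assms] in_L2_shift'[OF assms]) auto

context delay_system
begin

abbreviation transfer :: "(real \<Rightarrow> complex) \<Rightarrow> real \<Rightarrow> complex" where
  "transfer m c \<equiv> p1 / p2 * m c + quasi_shift (q1 - p1 / p2 * q2) \<Lambda>1 \<Lambda>2 m c"

text \<open>The errors of w and z are tied so that p2 w + q2 z is exactly on target in the last
  window. The error of z then does not re-enter through the delay \<Lambda>2 and equals the defect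
  of the equation \<open>transfer m = h\<close>.\<close>

definition steered where
  "steered w0 z0 wy zy m h w z \<longleftrightarrow> response w0 z0 w z \<and> (\<forall>t. T - \<Lambda>1 < t \<longrightarrow>
     z t - zy t = transfer m (t - (T - \<Lambda>1)) - h (t - (T - \<Lambda>1)) \<and>
     w t - wy t = - (q2 / p2) * (z t - zy t))"

text \<open>Three stages: w is zero on (0, T - 2 \<Lambda>1), m = p2 w + q2 z is prescribed on the
  next window, and the target is aimed at on the last. Since p1 w + q1 z = \<beta> m + \<alpha> z,
  the error of z at the end is affine in m with linear part \<open>transfer\<close>; h collects what
  depends on the data alone.\<close>

lemma steering_equation:
  assumes T: "2 * \<Lambda>1 \<le> T" and p2: "p2 \<noteq> 0"
    and w0: "in_L2 w0" and z0: "in_L2 z0"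
    and wy: "in_L2 wy" and zy: "in_L2 zy"
  obtains h where "in_L2 h"
    "\<And>m. in_L2 m \<Longrightarrow> \<exists>w z. steered w0 z0 wy zy m h w z"
proof -
  define \<tau> where "\<tau> = T - 2 * \<Lambda>1"
  have \<tau>: "0 \<le> \<tau>" "T = \<tau> + 2 * \<Lambda>1" using T by (simp_all add: \<tau>_def)
  define \<alpha> where "\<alpha> = q1 - p1 / p2 * q2"
  define w1 where "w1 t = (if t \<le> 0 then w0 t else 0)" for t
  have w1: "in_L2 w1"
    unfolding w1_def by (intro in_L2_intros w0) auto
  have "in_L2 (\<lambda>t. p1 * w1 (t - \<Lambda>1) + p2 * w1 (t - \<Lambda>2))"
    by (intro in_L2_intros in_L2_shift'[OF w1])
  then obtain z1 where z1: "in_L2 z1" "\<And>t. t \<le> 0 \<Longrightarrow> z1 t = z0 t"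
    "\<And>t. 0 < t \<Longrightarrow> t < \<tau> \<Longrightarrow> z1 t = (p1 * w1 (t - \<Lambda>1) + p2 * w1 (t - \<Lambda>2)) + q1 * z1 (t - \<Lambda>1) + q2 * z1 (t - \<Lambda>2)"
    by (rule delay_equation_solvable[OF \<Lambda>1_pos \<Lambda>2_pos _ z0, of _ \<tau> q1 q2]) blast
  \<comment> \<open>The part of z on the middle window that is fixed by the values before \<tau>; m
    contributes to z only after a delay of \<Lambda>2.\<close>
  define k where "k c = p1 * w1 (c + (\<tau> - \<Lambda>1)) + q1 * z1 (c + (\<tau> - \<Lambda>1)) +
     (if c < \<Lambda>2 then p2 * w1 (c + (\<tau> - \<Lambda>2)) + q2 * z1 (c + (\<tau> - \<Lambda>2)) else 0)" for c
  have k: "in_L2 k"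
    unfolding k_def
    by (intro in_L2_intros in_L2_shift[OF w1] in_L2_shift[OF z1(1)]) auto
  define h where "h c = zy (c + (\<tau> + \<Lambda>1)) - \<alpha> * k c
     - (if c < \<Lambda>2 then 0 else p2 * wy (c + (\<tau> + \<Lambda>1 - \<Lambda>2)) + q2 * zy (c + (\<tau> + \<Lambda>1 - \<Lambda>2)))" for c
  have h: "in_L2 h"
    unfolding h_def
    by (intro in_L2_intros in_L2_shift[OF wy] in_L2_shift[OF zy] k) auto
  show thesis
  proof (rule that[OF h])
    fix m assume m: "in_L2 m"
    define zm where "zm c = k c + (if c < \<Lambda>2 then 0 else m (c - \<Lambda>2))" for c
    define wm where "wm c = (m c - q2 * zm c) / p2" for c
    define e where "e c = p1 / p2 * m c + quasi_shift \<alpha> \<Lambda>1 \<Lambda>2 m c - h c" for c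
    have zm: "in_L2 zm"
      unfolding zm_def by (intro in_L2_intros k in_L2_shift'[OF m]) auto
    have wm: "in_L2 wm"
      unfolding wm_def by (intro in_L2_intros m zm)
    have e: "in_L2 e"
      unfolding e_def by (intro in_L2_intros m h in_L2_quasi_shift)
    have m_eq: "p2 * wm c + q2 * zm c = m c" for c using p2 by (simp add: wm_def)
    define z where "z t = (if t \<le> \<tau> then z1 t else if t \<le> \<tau> + \<Lambda>1 then zm (t - \<tau>) else zy t + e (t - (\<tau> + \<Lambda>1)))" for t
    define w where "w t = (if t \<le> \<tau> then w1 t else if t \<le> \<tau> + \<Lambda>1 then wm (t - \<tau>) else wy t - q2 / p2 * e (t - (\<tau> + \<Lambda>1)))" for t
    have sq: "in_L2 w" "in_L2 z"
      unfolding w_def z_def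
      by (intro in_L2_intros w1 z1(1) wy zy in_L2_shift'[OF e]
          in_L2_shift'[OF zm] in_L2_shift'[OF wm]; auto)+
    have "AE t in lebesgue. 0 < t \<and> t < T \<longrightarrow>
        z t = delayed w z t"
      \<comment> \<open>The junctions \<tau> and \<tau> + \<Lambda>1 of the piecewise definitions
        and their translates by \<Lambda>2 are excluded.\<close>
      using AE_lebesgue_neq[of \<tau>] AE_lebesgue_neq[of "\<tau> + \<Lambda>2"] AE_lebesgue_neq[of "\<tau> + \<Lambda>1"] AE_lebesgue_neq[of "\<tau> + \<Lambda>1 + \<Lambda>2"]
    proof eventually_elim
      case (elim t)
      show ?case
      proof
        assume t: "0 < t \<and> t < T"
        consider "t < \<tau>" | "\<tau> < t" "t < \<tau> + \<Lambda>2" | "\<tau> + \<Lambda>2 < t" "t < \<tau> + \<Lambda>1"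
          | "\<tau> + \<Lambda>1 < t" "t < \<tau> + \<Lambda>1 + \<Lambda>2" | "\<tau> + \<Lambda>1 + \<Lambda>2 < t"
          using elim by linarith
        then show "z t = delayed w z t"
        proof cases
          case 1
          then show ?thesis
            using z1(3)[of t] t \<Lambda>1_pos \<Lambda>2_pos by (simp add: z_def w_def)
        next
          case 2
          then show ?thesis
            using \<Lambda>1_pos \<Lambda>2_pos \<Lambda>2_less by (simp add: z_def w_def zm_def k_def algebra_simps)
        next
          case 3
          then have "z t = k (t - \<tau>) + m (t - \<tau> - \<Lambda>2)" "z (t - \<Lambda>2) = zm (t - \<tau> - \<Lambda>2)" "w (t - \<Lambda>2) = wm (t - \<tau> - \<Lambda>2)"
            using \<Lambda>1_pos \<Lambda>2_pos \<Lambda>2_less by (simp_all add: z_def w_def zm_def algebra_simps)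
          moreover have "k (t - \<tau>) = p1 * w (t - \<Lambda>1) + q1 * z (t - \<Lambda>1)"
            using 3 \<Lambda>2_less by (simp add: k_def w_def z_def algebra_simps)
          ultimately show ?thesis using m_eq[of "t - \<tau> - \<Lambda>2"] by (simp add: add.assoc)
        next
          case 4
          define c where "c = t - (\<tau> + \<Lambda>1)"
          have c: "0 < c" "c < \<Lambda>2" using 4 by (simp_all add: c_def)
          have v: "z t = zy t + e c" "z (t - \<Lambda>1) = zm c" "w (t - \<Lambda>1) = wm c"
            "z (t - \<Lambda>2) = zm (c + (\<Lambda>1 - \<Lambda>2))" "w (t - \<Lambda>2) = wm (c + (\<Lambda>1 - \<Lambda>2))"
            using 4 \<Lambda>1_pos \<Lambda>2_pos \<Lambda>2_less by (auto simp: z_def w_def c_def algebra_simps)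
          have zm_c: "zm c = k c" using c by (simp add: zm_def)
          have e_c: "e c = p1 / p2 * m c + m (c + (\<Lambda>1 - \<Lambda>2)) - (zy t - \<alpha> * k c)"
            using c by (simp add: e_def quasi_shift_def h_def c_def)
          have w_c: "p1 * wm c = p1 / p2 * m c - p1 / p2 * q2 * zm c"
            by (simp add: wm_def algebra_simps diff_divide_distrib)
          have "zy t + e c = p1 * wm c + q1 * zm c + m (c + (\<Lambda>1 - \<Lambda>2))"
            unfolding w_c e_c zm_c \<alpha>_def by (simp add: algebra_simps)
          then show ?thesis unfolding v m_eq[of "c + (\<Lambda>1 - \<Lambda>2)", symmetric] by (simp only: add.assoc)
        next
          case 5
          define c where "c = t - (\<tau> + \<Lambda>1)"
          have c: "\<Lambda>2 < c" "c < \<Lambda>1" using 5 t \<tau>(2) by (simp_all add: c_def)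
          have v: "z t = zy t + e c" "z (t - \<Lambda>1) = zm c" "w (t - \<Lambda>1) = wm c"
            "z (t - \<Lambda>2) = zy (t - \<Lambda>2) + e (c - \<Lambda>2)" "w (t - \<Lambda>2) = wy (t - \<Lambda>2) - q2 / p2 * e (c - \<Lambda>2)"
            using 5 t \<tau>(2) \<Lambda>1_pos \<Lambda>2_pos \<Lambda>2_less by (auto simp: z_def w_def c_def algebra_simps)
          have y: "p2 * (wy (t - \<Lambda>2) - q2 / p2 * e (c - \<Lambda>2)) + q2 * (zy (t - \<Lambda>2) + e (c - \<Lambda>2)) = p2 * wy (t - \<Lambda>2) + q2 * zy (t - \<Lambda>2)"
            using p2 by (simp add: algebra_simps)
          have zm_c: "zm c = k c + m (c - \<Lambda>2)" using c by (simp add: zm_def)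
          have e_c: "e c = p1 / p2 * m c + \<alpha> * m (c - \<Lambda>2) - (zy t - \<alpha> * k c - (p2 * wy (t - \<Lambda>2) + q2 * zy (t - \<Lambda>2)))"
            using c by (simp add: e_def quasi_shift_def h_def c_def algebra_simps)
          have w_c: "p1 * wm c = p1 / p2 * m c - p1 / p2 * q2 * zm c"
            by (simp add: wm_def algebra_simps diff_divide_distrib)
          have "zy t + e c = p1 * wm c + q1 * zm c + (p2 * wy (t - \<Lambda>2) + q2 * zy (t - \<Lambda>2))"
            unfolding w_c e_c zm_c \<alpha>_def by (simp add: algebra_simps)
          then show ?thesis unfolding v y[symmetric] by (simp only: add.assoc)
        qed
      qed
    qed
    then have "response w0 z0 w z"
      using sq \<tau>(1) z1(2) by (auto simp: response_def dynamics_def z_def w_def w1_def)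
    moreover have "z t - zy t = e (t - (T - \<Lambda>1)) \<and> w t - wy t = - (q2 / p2) * (z t - zy t)" if "T - \<Lambda>1 < t" for t
    proof -
      have "T - \<Lambda>1 = \<tau> + \<Lambda>1" using \<tau>(2) by simp
      then show ?thesis using that \<Lambda>1_pos by (simp only: z_def w_def) simp
    qed
    ultimately show "\<exists>w z. steered w0 z0 wy zy m h w z"
      unfolding e_def \<alpha>_def steered_def by blast
  qed
qed

text \<open>With p2 = 0, w acts on z only after the delay \<Lambda>1. So z up to T - \<Lambda>1 is
  settled by w up to T - 2 \<Lambda>1. The target can be imposed on z afterwards, and the equation
  on the last window is then solved for w on the window before it.\<close>

lemma exact_steering_p2_zero:
  assumes T: "2 * \<Lambda>1 \<le> T" and p: "p2 = 0" "p1 \<noteq> 0"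
    and w0: "in_L2 w0" and z0: "in_L2 z0"
    and wy: "in_L2 wy" and zy: "in_L2 zy"
  shows "\<exists>w z. response w0 z0 w z \<and> (AE t in lebesgue. T - \<Lambda>1 < t \<and> t < T \<longrightarrow> w t = wy t \<and> z t = zy t)"
proof -
  define w1 where "w1 t = (if t \<le> 0 then w0 t else 0)" for t
  have w1: "in_L2 w1"
    unfolding w1_def by (intro in_L2_intros w0) auto
  have "in_L2 (\<lambda>t. p1 * w1 (t - \<Lambda>1))"
    by (intro in_L2_intros in_L2_shift'[OF w1])
  then obtain z1 where z1: "in_L2 z1" "\<And>t. t \<le> 0 \<Longrightarrow> z1 t = z0 t"
    "\<And>t. 0 < t \<Longrightarrow> t < T - \<Lambda>1 \<Longrightarrow> z1 t = p1 * w1 (t - \<Lambda>1) + q1 * z1 (t - \<Lambda>1) + q2 * z1 (t - \<Lambda>2)"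
    by (rule delay_equation_solvable[OF \<Lambda>1_pos \<Lambda>2_pos _ z0, of _ "T - \<Lambda>1" q1 q2]) blast
  define z where "z t = (if t \<le> T - \<Lambda>1 then z1 t else zy t)" for t
  have z: "in_L2 z"
    unfolding z_def by (intro in_L2_intros z1(1) zy) auto
  define w where "w t = (if t \<le> T - 2 * \<Lambda>1 then w1 t else if t \<le> T - \<Lambda>1
    then (z (t + \<Lambda>1) - q1 * z t - q2 * z (t + (\<Lambda>1 - \<Lambda>2))) / p1 else wy t)" for t
  have w: "in_L2 w"
    unfolding w_def by (intro in_L2_intros z w1 wy in_L2_shift[OF z]) auto
  have "AE t in lebesgue. 0 < t \<and> t < T \<longrightarrow>
        z t = delayed w z t"
    using AE_lebesgue_neq[of "T - \<Lambda>1"]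
  proof eventually_elim
    case (elim t)
    then consider "t < T - \<Lambda>1" | "T - \<Lambda>1 < t" by linarith
    then show ?case
    proof cases
      case 1
      then show ?thesis using z1(3)[of t] p \<Lambda>1_pos \<Lambda>2_pos by (auto simp: z_def w_def)
    next
      case 2
      then show ?thesis using p \<Lambda>1_pos \<Lambda>2_pos by (auto simp: w_def field_simps)
    qed
  qed
  then have "response w0 z0 w z"
    using w z T z1(2) \<Lambda>1_pos by (auto simp: response_def dynamics_def z_def w_def w1_def)
  moreover have "w t = wy t \<and> z t = zy t" if "T - \<Lambda>1 < t" for t
    using that \<Lambda>1_pos by (simp add: z_def w_def)
  ultimately show ?thesis by (intro exI[of _ w] exI[of _ z]) auto
qed

section \<open>Solvability of the transfer equation\<close>

definition exactly_solvable :: bool where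
  "exactly_solvable \<longleftrightarrow> (\<forall>h. in_L2 h \<longrightarrow> (\<exists>m. in_L2 m \<and> (AE c in lebesgue. 0 < c \<and> c < \<Lambda>1 \<longrightarrow>
     transfer m c = h c)))"

definition approximately_solvable :: bool where
  "approximately_solvable \<longleftrightarrow> (\<forall>h \<epsilon>. in_L2 h \<longrightarrow> 0 < \<epsilon> \<longrightarrow> (\<exists>m. in_L2 m \<and>
    (\<integral>c. (if 0 < c \<and> c < \<Lambda>1 then (cmod (transfer m c - h c))\<^sup>2 else 0) \<partial>lebesgue) < \<epsilon>))"

lemma exact_steering:
  assumes T: "2 * \<Lambda>1 \<le> T" and p2: "p2 \<noteq> 0" and solv: exactly_solvable
    and sq: "in_L2 w0" "in_L2 z0" "in_L2 wy" "in_L2 zy"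
  shows "\<exists>w z. response w0 z0 w z \<and> (AE t in lebesgue. T - \<Lambda>1 < t \<and> t < T \<longrightarrow> w t = wy t \<and> z t = zy t)"
proof -
  obtain h where h: "in_L2 h"
    "\<And>m. in_L2 m \<Longrightarrow> \<exists>w z. steered w0 z0 wy zy m h w z"
    using steering_equation[OF T p2 sq] by blast
  obtain m where m: "in_L2 m" and
    eq: "AE c in lebesgue. 0 < c \<and> c < \<Lambda>1 \<longrightarrow> transfer m c = h c"
    using solv h(1) unfolding exactly_solvable_def by blast
  obtain w z where "steered w0 z0 wy zy m h w z"
    using h(2)[OF m] by blast
  note r = this[unfolded steered_def, THEN conjunct1] and wz = this[unfolded steered_def, THEN conjunct2, rule_format]
  have "AE t in lebesgue. T - \<Lambda>1 < t \<and> t < T \<longrightarrow> w t = wy t \<and> z t = zy t"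
    using AE_lebesgue_shift[OF eq, of "- (T - \<Lambda>1)", unfolded add_uminus_conv_diff]
  proof eventually_elim
    case (elim t)
    show ?case
    proof
      assume t: "T - \<Lambda>1 < t \<and> t < T"
      then have "z t - zy t = 0" "w t - wy t = - (q2 / p2) * (z t - zy t)"
        using wz[of t] elim by auto
      then show "w t = wy t \<and> z t = zy t" by simp
    qed
  qed
  with r show ?thesis by blast
qed

lemma approximate_steering:
  assumes T: "2 * \<Lambda>1 \<le> T" and p2: "p2 \<noteq> 0" and solv: approximately_solvable
    and sq: "in_L2 w0" "in_L2 z0" "in_L2 wy" "in_L2 zy" and \<epsilon>: "0 < \<epsilon>"
  shows "\<exists>w z. response w0 z0 w z \<and>
      window_energy (\<lambda>t. w t - wy t) < \<epsilon> \<and>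
      window_energy (\<lambda>t. z t - zy t) < \<epsilon>"
proof -
  obtain h where h: "in_L2 h"
    "\<And>m. in_L2 m \<Longrightarrow> \<exists>w z. steered w0 z0 wy zy m h w z"
    using steering_equation[OF T p2 sq] by blast
  \<comment> \<open>C dominates the factor between the energies of the two errors and is at least 1,
    so one tolerance serves both.\<close>
  define C where "C = 1 + (cmod (q2 / p2))\<^sup>2"
  have C: "C \<ge> 1" by (simp add: C_def)
  then have "\<epsilon> / C > 0" using \<epsilon> by simp
  then obtain m where m: "in_L2 m" and
    eq: "(\<integral>c. (if 0 < c \<and> c < \<Lambda>1 then (cmod (transfer m c - h c))\<^sup>2 else 0) \<partial>lebesgue) < \<epsilon> / C" (is "?I < _")
    using solv h(1) unfolding approximately_solvable_def by blast
  obtain w z where "steered w0 z0 wy zy m h w z"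
    using h(2)[OF m] by blast
  note r = this[unfolded steered_def, THEN conjunct1] and wz = this[unfolded steered_def, THEN conjunct2, rule_format]
  have "window_energy (\<lambda>t. z t - zy t)
     = (\<integral>t. (\<lambda>c. if 0 < c \<and> c < \<Lambda>1 then (cmod (transfer m c - h c))\<^sup>2 else 0) (t - (T - \<Lambda>1)) \<partial>lebesgue)"
    by (rule Bochner_Integration.integral_cong) (use wz in auto)
  also have "\<dots> = ?I"
    using lebesgue_integral_shift[of "\<lambda>c. if 0 < c \<and> c < \<Lambda>1 then (cmod (transfer m c - h c))\<^sup>2 else 0" "- (T - \<Lambda>1)",
        unfolded add_uminus_conv_diff] .
  finally have Z: "window_energy (\<lambda>t. z t - zy t) = ?I" (is "?Z = _") .
  have I0: "0 \<le> ?I" by (rule Bochner_Integration.integral_nonneg) auto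
  have "window_energy (\<lambda>t. w t - wy t)
     = (\<integral>t. (cmod (q2 / p2))\<^sup>2 * (if T - \<Lambda>1 < t \<and> t < T then (cmod (z t - zy t))\<^sup>2 else 0) \<partial>lebesgue)"
  proof (rule Bochner_Integration.integral_cong)
    have "cmod (w t - wy t) = cmod (q2 / p2) * cmod (z t - zy t)" if "T - \<Lambda>1 < t" for t
      using wz[OF that] by (metis norm_minus_cancel norm_mult mult_minus_left)
    then show "(if T - \<Lambda>1 < t \<and> t < T then (cmod (w t - wy t))\<^sup>2 else 0)
       = (cmod (q2 / p2))\<^sup>2 * (if T - \<Lambda>1 < t \<and> t < T then (cmod (z t - zy t))\<^sup>2 else 0)" for t
      by (simp add: power_mult_distrib)
  qed simp
  also have "\<dots> = (cmod (q2 / p2))\<^sup>2 * ?I" unfolding Z[symmetric] by simp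
  also have "\<dots> \<le> C * ?I" using I0 by (intro mult_right_mono) (auto simp: C_def)
  also have "\<dots> < C * (\<epsilon> / C)" using eq C by (intro mult_strict_left_mono) auto
  also have "\<dots> = \<epsilon>" using C by simp
  finally have W: "window_energy (\<lambda>t. w t - wy t) < \<epsilon>" .
  have "\<epsilon> / C \<le> \<epsilon>" using C \<epsilon> by (simp add: field_simps)
  then have "?Z < \<epsilon>" using Z eq by simp
  with W r show ?thesis by blast
qed

text \<open>Here \<beta> = 0 and \<alpha> = q1, so the operator is U itself: an exchange of two
  subintervals with the factor q1 on one of them. The witness m is its explicit inverse applied to
  h.\<close>

lemma exactly_solvable_p1_zero:
  assumes "p1 = 0" "q1 \<noteq> 0"
  shows exactly_solvable
  unfolding exactly_solvable_def
proof (intro allI impI)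
  fix h assume h: "in_L2 h"
  define m where "m c = (if c < \<Lambda>1 - \<Lambda>2 then h (c + \<Lambda>2) / q1 else h (c - (\<Lambda>1 - \<Lambda>2)))" for c
  have "in_L2 m"
    unfolding m_def
    by (intro in_L2_intros in_L2_shift[OF h] in_L2_shift'[OF h]) auto
  moreover have "transfer m c = h c" if "0 < c \<and> c < \<Lambda>1" for c
    using that assms by (simp add: quasi_shift_def m_def)
  ultimately show "\<exists>m. in_L2 m \<and> (AE c in lebesgue. 0 < c \<and> c < \<Lambda>1 \<longrightarrow>
     transfer m c = h c)" by (intro exI[of _ m]) auto
qed

text \<open>With \<alpha> = 0 the equation at c couples m c only to m (c + (\<Lambda>1 -
  \<Lambda>2)), and to nothing once c \<ge> \<Lambda>2. Reversing the interval turns it into a delay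
  equation with zero past.\<close>

lemma exactly_solvable_nilpotent:
  assumes "p1 / p2 \<noteq> 0" "q1 - p1 / p2 * q2 = 0"
  shows exactly_solvable
  unfolding exactly_solvable_def assms(2)
proof (intro allI impI)
  fix h assume h: "in_L2 h"
  define \<beta> where "\<beta> = p1 / p2"
  have F: "in_L2 (\<lambda>r. h (\<Lambda>1 - r) / \<beta>)"
    using in_L2_affine[OF h, of "- 1" \<Lambda>1] by (simp add: in_L2_divide)
  have d: "0 < \<Lambda>1 - \<Lambda>2" using \<Lambda>2_less by simp
  obtain \<zeta> where \<zeta>: "in_L2 \<zeta>" "\<And>r. r \<le> 0 \<Longrightarrow> \<zeta> r = 0"
    "\<And>r. 0 < r \<Longrightarrow> r < \<Lambda>1 \<Longrightarrow> \<zeta> r = h (\<Lambda>1 - r) / \<beta> + (- 1 / \<beta>) * \<zeta> (r - (\<Lambda>1 - \<Lambda>2)) + 0 * \<zeta> (r - (\<Lambda>1 - \<Lambda>2))"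
    by (rule delay_equation_solvable[OF d d F in_L2_zero, of \<Lambda>1 "- 1 / \<beta>" 0]) blast
  define m where "m c = \<zeta> (\<Lambda>1 - c)" for c
  have "in_L2 m"
    unfolding m_def using in_L2_affine[OF \<zeta>(1), of "- 1" \<Lambda>1] by simp
  moreover have "\<beta> * m c + quasi_shift 0 \<Lambda>1 \<Lambda>2 m c = h c" if "0 < c \<and> c < \<Lambda>1" for c
    using that \<zeta>(3)[of "\<Lambda>1 - c"] \<zeta>(2)[of "\<Lambda>2 - c"] assms(1) by (cases "c < \<Lambda>2") (simp_all add: quasi_shift_def m_def \<beta>_def field_simps)
  ultimately show "\<exists>m. in_L2 m \<and> (AE c in lebesgue. 0 < c \<and> c < \<Lambda>1 \<longrightarrow>
     p1 / p2 * m c + quasi_shift 0 \<Lambda>1 \<Lambda>2 m c = h c)" unfolding \<beta>_def by (intro exI[of _ m]) auto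
qed

end

section \<open>Completeness and trigonometric approximation\<close>

definition energy :: "real \<Rightarrow> (real \<Rightarrow> complex) \<Rightarrow> real" where
  "energy L f = (\<integral>t. (if 0 < t \<and> t < L then (cmod (f t))\<^sup>2 else 0) \<partial>lebesgue)"

text \<open>Asked on (0, L) only, so that exponentials and trigonometric polynomials
  qualify.\<close>

definition in_L2_upto :: "real \<Rightarrow> (real \<Rightarrow> complex) \<Rightarrow> bool" where
  "in_L2_upto L f \<longleftrightarrow> in_L2 (\<lambda>t. if 0 < t \<and> t < L then f t else 0)"

lemma in_L2_imp_upto: "in_L2 f \<Longrightarrow> in_L2_upto L f"
  unfolding in_L2_upto_def by (rule in_L2_restrict) auto

lemma continuous_in_L2_upto: "continuous_on UNIV f \<Longrightarrow> in_L2_upto L f"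
  unfolding in_L2_upto_def by (rule in_L2_continuous_on_interval)

lemma in_L2_upto_add:
  assumes "in_L2_upto L f" "in_L2_upto L g"
  shows "in_L2_upto L (\<lambda>t. f t + g t)"
  using in_L2_add[OF assms[unfolded in_L2_upto_def]] unfolding in_L2_upto_def
  by (rule back_subst[where P = in_L2]) auto

lemma in_L2_upto_diff:
  assumes "in_L2_upto L f" "in_L2_upto L g"
  shows "in_L2_upto L (\<lambda>t. f t - g t)"
  using in_L2_diff[OF assms[unfolded in_L2_upto_def]] unfolding in_L2_upto_def
  by (rule back_subst[where P = in_L2]) auto

lemma in_L2_upto_integrable:
  assumes "in_L2_upto L f"
  shows "integrable lebesgue (\<lambda>t. if 0 < t \<and> t < L then (cmod (f t))\<^sup>2 else 0)"
proof -
  have "integrable lebesgue (\<lambda>t. (cmod (if 0 < t \<and> t < L then f t else 0))\<^sup>2)"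
    using assms in_L2_integrable by (simp add: in_L2_upto_def)
  also have "(\<lambda>t. (cmod (if 0 < t \<and> t < L then f t else 0))\<^sup>2) = (\<lambda>t. if 0 < t \<and> t < L then (cmod (f t))\<^sup>2 else 0)"
    by auto
  finally show ?thesis .
qed

lemma energy_nonneg: "0 \<le> energy L f"
  unfolding energy_def by (rule Bochner_Integration.integral_nonneg) auto

lemma energy_bound:
  assumes g: "integrable lebesgue g" and le: "AE t in lebesgue. 0 < t \<and> t < L \<longrightarrow> (cmod (f t))\<^sup>2 \<le> g t"
    and nn: "AE t in lebesgue. 0 \<le> g t"
  shows "energy L f \<le> (\<integral>t. g t \<partial>lebesgue)"
  unfolding energy_def
  by (rule integral_mono_AE'[OF g]) (use le nn in \<open>eventually_elim, auto\<close>)+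

lemma energy_cong_AE:
  assumes g: "in_L2_upto L g" and eq: "AE t in lebesgue. 0 < t \<and> t < L \<longrightarrow> f t = g t"
  shows "energy L f = energy L g"
proof -
  have m: "(\<lambda>t. if 0 < t \<and> t < L then (cmod (g t))\<^sup>2 else 0) \<in> borel_measurable lebesgue"
    using in_L2_upto_integrable[OF g] by (rule borel_measurable_integrable)
  have ae: "AE t in lebesgue. (if 0 < t \<and> t < L then (cmod (g t))\<^sup>2 else 0) = (if 0 < t \<and> t < L then (cmod (f t))\<^sup>2 else 0)"
    using eq by eventually_elim auto
  show ?thesis
    unfolding energy_def
    by (rule integral_cong_AE) (use m borel_measurable_AE[OF m ae] ae in \<open>auto elim: eventually_mono\<close>)
qed

lemma energy_add_le:
  assumes "in_L2_upto L f" "in_L2_upto L g"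
  shows "energy L (\<lambda>t. f t + g t) \<le> 2 * energy L f + 2 * energy L g"
proof -
  let ?u = "\<lambda>t. 2 * (if 0 < t \<and> t < L then (cmod (f t))\<^sup>2 else 0) + 2 * (if 0 < t \<and> t < L then (cmod (g t))\<^sup>2 else 0)"
  have i: "integrable lebesgue (\<lambda>t. ?u t)"
    using assms[THEN in_L2_upto_integrable] by (intro Bochner_Integration.integrable_add integrable_mult_right)
  have "energy L (\<lambda>t. f t + g t) \<le> (\<integral>t. ?u t \<partial>lebesgue)"
    by (rule energy_bound[OF i]) (auto intro: cmod_add_square_le)
  also have "\<dots> = 2 * energy L f + 2 * energy L g"
    using assms[THEN in_L2_upto_integrable] by (simp add: energy_def)
  finally show ?thesis .
qed

lemma energy_mult_le:
  assumes "in_L2_upto L f" "\<And>t. 0 < t \<Longrightarrow> t < L \<Longrightarrow> cmod (u t) \<le> C"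
  shows "energy L (\<lambda>t. u t * f t) \<le> C\<^sup>2 * energy L f"
proof -
  let ?u = "\<lambda>t. C\<^sup>2 * (if 0 < t \<and> t < L then (cmod (f t))\<^sup>2 else 0)"
  have "energy L (\<lambda>t. u t * f t) \<le> (\<integral>t. ?u t \<partial>lebesgue)"
  proof (rule energy_bound)
    show "integrable lebesgue (\<lambda>t. ?u t)"
      using in_L2_upto_integrable[OF assms(1)] by (rule integrable_mult_right)
    show "AE t in lebesgue. 0 < t \<and> t < L \<longrightarrow> (cmod (u t * f t))\<^sup>2 \<le> ?u t"
      using power_mono[OF assms(2) norm_ge_zero, of _ 2]
      by (intro AE_I2) (auto simp: norm_mult power_mult_distrib intro!: mult_right_mono)
  qed auto
  also have "\<dots> = C\<^sup>2 * energy L f" by (simp add: energy_def)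
  finally show ?thesis .
qed

lemma energy_zero_AE:
  assumes "in_L2_upto L f" "energy L f \<le> 0"
  shows "AE t in lebesgue. 0 < t \<and> t < L \<longrightarrow> f t = 0"
proof -
  have "energy L f = 0" using assms(2) energy_nonneg[of L f] by simp
  then have "AE t in lebesgue. (if 0 < t \<and> t < L then (cmod (f t))\<^sup>2 else 0) = 0"
    unfolding energy_def
    using integral_nonneg_eq_0_iff_AE[OF in_L2_upto_integrable[OF assms(1)]] by simp
  then show ?thesis by eventually_elim (auto split: if_splits)
qed

lemma energy_uniform_le:
  assumes "\<And>t. 0 < t \<Longrightarrow> t < L \<Longrightarrow> cmod (f t) \<le> C" "0 \<le> L"
  shows "energy L f \<le> L * C\<^sup>2"
proof -
  have "energy L f \<le> (\<integral>t. C\<^sup>2 * indicat_real {0..L} t \<partial>lebesgue)"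
    by (rule energy_bound)
       (use power_mono[OF assms(1) norm_ge_zero, of _ 2] in
        \<open>auto intro!: AE_I2 integrable_mult_right integrable_real_indicator simp: emeasure_lborel_Icc_eq\<close>)
  also have "\<dots> = L * C\<^sup>2" using assms(2) by simp
  finally show ?thesis .
qed

text \<open>Obtained by peeling off one term at a time. Unlike the factor n of the Cauchy-Schwarz
  inequality, the weights do not depend on n, so one series bounds all partial sums.\<close>

lemma cmod_sum_square_le:
  "(cmod (\<Sum>k<n. f k))\<^sup>2 \<le> (\<Sum>k<n. 2 ^ Suc k * (cmod (f k))\<^sup>2)"
proof (induction n arbitrary: f)
  case (Suc n)
  have "(cmod (\<Sum>k<Suc n. f k))\<^sup>2 \<le> 2 * (cmod (f 0))\<^sup>2 + 2 * (cmod (\<Sum>k<n. f (Suc k)))\<^sup>2"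
    unfolding sum.lessThan_Suc_shift by (rule cmod_add_square_le)
  also have "\<dots> \<le> 2 * (cmod (f 0))\<^sup>2 + 2 * (\<Sum>k<n. 2 ^ Suc k * (cmod (f (Suc k)))\<^sup>2)"
    using Suc[of "\<lambda>k. f (Suc k)"] by simp
  also have "\<dots> = (\<Sum>k<Suc n. 2 ^ Suc k * (cmod (f k))\<^sup>2)"
    unfolding sum.lessThan_Suc_shift by (simp add: sum_distrib_left mult.assoc)
  finally show ?case .
qed simp

text \<open>Riesz-Fischer for fast series: the rate 8^(- n) beats the weights 2^(n + 1) of
  \<open>cmod_sum_square_le\<close>. Hence the weighted sum H of squares is integrable and dominates
  every partial sum, and dominated convergence applies.\<close>

lemma in_L2_series:
  fixes f :: "nat \<Rightarrow> real \<Rightarrow> complex"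
  assumes f: "\<And>n. in_L2 (f n)" and le: "\<And>n. (\<integral>t. (cmod (f n t))\<^sup>2 \<partial>lebesgue) \<le> A / 8 ^ n"
  obtains F where "in_L2 F" "(\<lambda>n. \<integral>t. (cmod (F t - (\<Sum>k<n. f k t)))\<^sup>2 \<partial>lebesgue) \<longlonglongrightarrow> 0"
proof -
  define g where "g k t = 2 ^ Suc k * (cmod (f k t))\<^sup>2" for k t
  have [measurable]: "f n \<in> borel_measurable lebesgue" for n
    using f by (simp add: in_L2_def)
  have g_int: "integrable lebesgue (g k)" for k
    unfolding g_def using f by (auto simp: in_L2_def)
  have [measurable]: "g k \<in> borel_measurable lebesgue" for k using g_int by (rule borel_measurable_integrable)
  have g_nn: "0 \<le> g k t" for k t by (simp add: g_def)
  have g_le: "(\<integral>t. g k t \<partial>lebesgue) \<le> 2 * A * (1/4) ^ k" for k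
  proof -
    have "(\<integral>t. g k t \<partial>lebesgue) = 2 ^ Suc k * (\<integral>t. (cmod (f k t))\<^sup>2 \<partial>lebesgue)" by (simp add: g_def)
    also have "\<dots> \<le> 2 ^ Suc k * (A / 8 ^ k)" by (intro mult_left_mono le) auto
    also have "\<dots> = 2 * A * (1/4) ^ k"
      by (simp add: power_divide power_mult_distrib[symmetric] field_simps flip: power_mult_distrib)
    finally show ?thesis .
  qed
  have sum_int: "summable (\<lambda>k. \<integral>t. norm (g k t) \<partial>lebesgue)"
  proof (rule summable_comparison_test'[where N = 0])
    show "summable (\<lambda>k. 2 * A * (1/4 :: real) ^ k)" by (intro summable_mult summable_geometric) auto
    show "norm (\<integral>t. norm (g k t) \<partial>lebesgue) \<le> 2 * A * (1/4) ^ k" for k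
      using g_le[of k] g_nn by (simp add: Bochner_Integration.integral_nonneg)
  qed
  have "(\<integral>\<^sup>+t. (\<Sum>k. ennreal (g k t)) \<partial>lebesgue) = (\<Sum>k. \<integral>\<^sup>+t. ennreal (g k t) \<partial>lebesgue)"
    by (rule nn_integral_suminf) measurable
  also have "\<dots> = (\<Sum>k. ennreal (\<integral>t. norm (g k t) \<partial>lebesgue))"
    using g_nn by (simp add: nn_integral_eq_integral[OF g_int])
  also have "\<dots> \<noteq> \<infinity>"
    using sum_int by (simp add: suminf_ennreal2 Bochner_Integration.integral_nonneg)
  finally have "AE t in lebesgue. (\<Sum>k. ennreal (g k t)) \<noteq> \<infinity>"
    by (intro nn_integral_noteq_infinite) measurable
  then have sm: "AE t in lebesgue. summable (\<lambda>k. g k t)"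
    by eventually_elim (rule summable_suminf_not_top, use g_nn in auto)
  define H where "H t = (\<Sum>k. g k t)" for t
  have H: "integrable lebesgue H"
    unfolding H_def using sm g_nn sum_int by (intro integrable_suminf g_int) auto
  define F where "F t = (\<Sum>k. f k t)" for t
  have F_meas[measurable]: "F \<in> borel_measurable lebesgue"
    unfolding F_def by measurable
  have part: "AE t in lebesgue. (\<lambda>n. \<Sum>k<n. f k t) \<longlonglongrightarrow> F t \<and> (\<forall>n. (cmod (\<Sum>k<n. f k t))\<^sup>2 \<le> H t)"
    using sm
  proof eventually_elim
    case (elim t)
    have "summable (\<lambda>k. f k t)"
    proof (rule summable_comparison_test'[where N = 0])
      \<comment> \<open>Expanding 2^k (x - 2^(- k))^2 \<ge> 0 turns summability of weighted squares
        into absolute convergence.\<close>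
      show "summable (\<lambda>k. (1/2) ^ k + g k t)" using elim by (intro summable_add summable_geometric) auto
      show "norm (f k t) \<le> (1/2) ^ k + g k t" for k
      proof -
        define x where "x = cmod (f k t)"
        have "0 \<le> (x - (1/2) ^ k)\<^sup>2" by simp
        then have "0 \<le> 2 ^ k * (x - (1/2) ^ k)\<^sup>2" by simp
        also have "\<dots> = 2 ^ k * x\<^sup>2 - 2 * x * (2 ^ k * (1/2) ^ k) + (1/2) ^ k * (2 ^ k * (1/2) ^ k)"
          by (simp add: power2_eq_square algebra_simps)
        also have "(2 :: real) ^ k * (1/2) ^ k = 1" by (simp add: power_divide)
        finally have "2 * x \<le> (1/2) ^ k + 2 ^ k * x\<^sup>2" by simp
        moreover have "0 \<le> x" "0 \<le> 2 ^ k * x\<^sup>2" by (simp_all add: x_def)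
        ultimately have "x \<le> (1/2) ^ k + 2 * (2 ^ k * x\<^sup>2)" by linarith
        then show ?thesis by (simp add: g_def x_def)
      qed
    qed
    then have "(\<lambda>n. \<Sum>k<n. f k t) \<longlonglongrightarrow> F t"
      unfolding F_def using summable_LIMSEQ by blast
    moreover have "(cmod (\<Sum>k<n. f k t))\<^sup>2 \<le> H t" for n
    proof -
      have "(cmod (\<Sum>k<n. f k t))\<^sup>2 \<le> (\<Sum>k<n. g k t)"
        unfolding g_def by (rule cmod_sum_square_le)
      also have "\<dots> \<le> H t" unfolding H_def by (rule sum_le_suminf[OF elim]) (auto simp: g_nn)
      finally show ?thesis .
    qed
    ultimately show ?case by blast
  qed
  have F_le: "AE t in lebesgue. (cmod (F t))\<^sup>2 \<le> H t"
    using part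
  proof eventually_elim
    case (elim t)
    then have "(\<lambda>n. (cmod (\<Sum>k<n. f k t))\<^sup>2) \<longlonglongrightarrow> (cmod (F t))\<^sup>2" by (intro tendsto_intros) auto
    then show ?case by (rule LIMSEQ_le_const2) (use elim in auto)
  qed
  have F: "in_L2 F" by (rule in_L2_bound[OF F_meas H F_le])
  have "(\<lambda>n. \<integral>t. (cmod (F t - (\<Sum>k<n. f k t)))\<^sup>2 \<partial>lebesgue) \<longlonglongrightarrow> integral\<^sup>L lebesgue (\<lambda>t::real. 0)"
  proof (rule integral_dominated_convergence[where w = "\<lambda>t. 4 * H t"])
    show "AE t in lebesgue. (\<lambda>n. (cmod (F t - (\<Sum>k<n. f k t)))\<^sup>2) \<longlonglongrightarrow> 0"
      using part
    proof eventually_elim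
      case (elim t)
      then have "(\<lambda>n. (cmod (F t - (\<Sum>k<n. f k t)))\<^sup>2) \<longlonglongrightarrow> (cmod (F t - F t))\<^sup>2" by (intro tendsto_intros) auto
      then show ?case by simp
    qed
    show "AE t in lebesgue. norm ((cmod (F t - (\<Sum>k<n. f k t)))\<^sup>2) \<le> 4 * H t" for n
      using part F_le
    proof eventually_elim
      case (elim t)
      have "(cmod (F t - (\<Sum>k<n. f k t)))\<^sup>2 \<le> 2 * (cmod (F t))\<^sup>2 + 2 * (cmod (\<Sum>k<n. f k t))\<^sup>2"
        using cmod_add_square_le[of "F t" "- (\<Sum>k<n. f k t)"] by simp
      also have "\<dots> \<le> 4 * H t" using elim by (auto dest: spec[of _ n])
      finally show ?case by simp
    qed
    show "integrable lebesgue (\<lambda>t. 4 * H t)" using H by simp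
  qed measurable
  then show thesis using that[OF F] by simp
qed

section \<open>Trigonometric polynomials and uniform approximation\<close>

definition mode :: "real \<Rightarrow> int \<Rightarrow> real \<Rightarrow> complex" where
  "mode L k t = cis (2 * pi * of_int k * t / L)"

definition trigonometric :: "real \<Rightarrow> (real \<Rightarrow> complex) \<Rightarrow> bool" where
  "trigonometric L f \<longleftrightarrow> (\<exists>K a. finite K \<and> f = (\<lambda>t. \<Sum>k\<in>K. a k * mode L k t))"

lemma mode_mult: "mode L j t * mode L k t = mode L (j + k) t"
  by (simp add: mode_def cis_mult add_divide_distrib algebra_simps)

lemma norm_mode [simp]: "cmod (mode L k t) = 1"
  by (simp add: mode_def)

lemma continuous_on_mode: "continuous_on S (mode L k)"
  unfolding mode_def[abs_def] divide_inverse by (intro continuous_intros)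

lemma trigonometric_continuous: "trigonometric L f \<Longrightarrow> continuous_on S f"
  by (auto simp: trigonometric_def intro!: continuous_intros continuous_on_mode)

lemma trigonometric_mode: "trigonometric L (\<lambda>t. c * mode L k t)"
  unfolding trigonometric_def by (intro exI[of _ "{k}"] exI[of _ "\<lambda>_. c"]) auto

lemma trigonometric_const: "trigonometric L (\<lambda>t. c)"
  using trigonometric_mode[of L c 0] by (simp add: mode_def)

lemma trigonometric_add:
  assumes "trigonometric L f" "trigonometric L g"
  shows "trigonometric L (\<lambda>t. f t + g t)"
proof -
  obtain K a where f: "finite K" "f = (\<lambda>t. \<Sum>k\<in>K. a k * mode L k t)"
    using assms by (auto simp: trigonometric_def)
  obtain J b where g: "finite J" "g = (\<lambda>t. \<Sum>k\<in>J. b k * mode L k t)"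
    using assms by (auto simp: trigonometric_def)
  have "f t = (\<Sum>k\<in>K \<union> J. (if k \<in> K then a k else 0) * mode L k t)" for t
    unfolding f(2) by (rule sum.mono_neutral_cong_left) (use f g in auto)
  moreover have "g t = (\<Sum>k\<in>K \<union> J. (if k \<in> J then b k else 0) * mode L k t)" for t
    unfolding g(2) by (rule sum.mono_neutral_cong_left) (use f g in auto)
  ultimately have "(\<lambda>t. f t + g t) = (\<lambda>t. \<Sum>k\<in>K \<union> J. ((if k \<in> K then a k else 0) + (if k \<in> J then b k else 0)) * mode L k t)"
    by (auto simp only: sum.distrib distrib_right)
  moreover have "finite (K \<union> J)" using f g by simp
  ultimately show ?thesis unfolding trigonometric_def by (intro exI conjI)
qed

lemma trigonometric_sum:
  "(\<And>i. i \<in> I \<Longrightarrow> trigonometric L (f i)) \<Longrightarrow> trigonometric L (\<lambda>t. \<Sum>i\<in>I. f i t)"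
proof (induction I rule: infinite_finite_induct)
  case (insert i I)
  have "trigonometric L (\<lambda>t. f i t + (\<Sum>i\<in>I. f i t))"
    by (rule trigonometric_add) (use insert in auto)
  then show ?case using insert.hyps by simp
qed (simp_all add: trigonometric_const)

lemma trigonometric_mult:
  assumes "trigonometric L f" "trigonometric L g"
  shows "trigonometric L (\<lambda>t. f t * g t)"
proof -
  obtain K a where f: "finite K" "f = (\<lambda>t. \<Sum>k\<in>K. a k * mode L k t)"
    using assms by (auto simp: trigonometric_def)
  obtain J b where g: "finite J" "g = (\<lambda>t. \<Sum>k\<in>J. b k * mode L k t)"
    using assms by (auto simp: trigonometric_def)
  have "(\<lambda>t. f t * g t) = (\<lambda>t. \<Sum>k\<in>K. \<Sum>j\<in>J. (a k * b j) * mode L (k + j) t)"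
    unfolding f g sum_product by (simp add: mult_ac flip: mode_mult)
  then show ?thesis by (simp only: trigonometric_sum trigonometric_mode)
qed

text \<open>On the unit circle a real linear functional is a combination of z and its conjugate,
  that is, of the modes 1 and -1; products of modes add frequencies.\<close>

lemma trigonometric_real_polynomial:
  assumes "real_polynomial_function r"
  shows "trigonometric L (\<lambda>t. of_real (r (cis (2 * pi * t / L))))"
  using assms
proof (induction rule: real_polynomial_function.induct)
  case (linear r)
  interpret r: bounded_linear r by fact
  have r_eq: "r z = Re z * r 1 + Im z * r \<i>" for z
  proof -
    have "z = Re z *\<^sub>R 1 + Im z *\<^sub>R \<i>" by (simp add: complex_eq_iff)
    then have "r z = r (Re z *\<^sub>R 1 + Im z *\<^sub>R \<i>)" by simp
    then show ?thesis by (simp add: r.add r.scaleR)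
  qed
  have "complex_of_real (r (cis (2 * pi * t / L))) =
    Complex (r 1 / 2) (- r \<i> / 2) * mode L 1 t + Complex (r 1 / 2) (r \<i> / 2) * mode L (-1) t" for t
    unfolding r_eq[of "cis (2 * pi * t / L)"] by (simp add: mode_def complex_eq_iff field_simps)
  then show ?case by (simp only:) (intro trigonometric_add trigonometric_mode)
next
  case (const c)
  show ?case by (rule trigonometric_const)
next
  case (add f g)
  show ?case unfolding of_real_add by (rule trigonometric_add[OF add.IH])
next
  case (mult f g)
  show ?case unfolding of_real_mult by (rule trigonometric_mult[OF mult.IH])
qed

lemma trigonometric_polynomial:
  fixes p :: "complex \<Rightarrow> complex"
  assumes "polynomial_function p"
  shows "trigonometric L (\<lambda>t. p (cis (2 * pi * t / L)))"
proof -
  have "real_polynomial_function (\<lambda>z. Re (p z))" "real_polynomial_function (\<lambda>z. Im (p z))"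
    using assms bounded_linear_Re bounded_linear_Im unfolding polynomial_function_def o_def by blast+
  then have "trigonometric L (\<lambda>t. of_real (Re (p (cis (2 * pi * t / L)))) + \<i> * of_real (Im (p (cis (2 * pi * t / L)))))"
    by (intro trigonometric_add trigonometric_mult[OF trigonometric_const] trigonometric_real_polynomial[of "\<lambda>z. Re (p z)"]
        trigonometric_real_polynomial[of "\<lambda>z. Im (p z)"])
  then show ?thesis by (simp add: complex_eq[symmetric])
qed

text \<open>g is transported to the unit circle, where Stone-Weierstrass applies.
  \<open>Arg2pi\<close> jumps at 1, but the margin \<delta> makes the transported function vanish
  near 1, so it is continuous.\<close>

lemma trigonometric_uniform_approximation:
  fixes g :: "real \<Rightarrow> complex"
  assumes L: "0 < L" and \<delta>: "0 < \<delta>" and g: "continuous_on UNIV g" and supp: "\<And>t. g t \<noteq> 0 \<Longrightarrow> \<delta> \<le> t \<and> t \<le> L - \<delta>" and \<epsilon>: "0 < \<epsilon>"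
  obtains P where "trigonometric L P" "\<And>t. 0 < t \<Longrightarrow> t < L \<Longrightarrow> cmod (g t - P t) < \<epsilon>"
proof -
  define f where "f z = g (L * Arg2pi z / (2 * pi))" for z
  \<comment> \<open>The margin as an angle, capped at pi because the comparison below uses that cos
    decreases on [0, pi].\<close>
  define \<eta> where "\<eta> = min (2 * pi * \<delta> / L) pi"
  have \<eta>: "0 < \<eta>" "\<eta> \<le> pi" using L \<delta> by (auto simp: \<eta>_def)
  have near1: "f z = 0" if z: "z \<in> sphere 0 1" "cos \<eta> < Re z" for z
  proof (rule ccontr)
    assume "f z \<noteq> 0"
    then have a: "\<delta> \<le> L * Arg2pi z / (2 * pi)" "L * Arg2pi z / (2 * pi) \<le> L - \<delta>"
      using supp unfolding f_def by auto
    have "2 * pi * \<delta> / L \<le> Arg2pi z" "Arg2pi z \<le> 2 * pi - 2 * pi * \<delta> / L"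
      using a L by (auto simp: field_simps)
    then have A: "\<eta> \<le> Arg2pi z" "Arg2pi z \<le> 2 * pi - \<eta>" by (auto simp: \<eta>_def)
    have "z = exp (\<i> * of_real (Arg2pi z))"
      using Arg2pi_eq[of z] z(1) by simp
    from arg_cong[OF this, of Re] have "Re z = cos (Arg2pi z)" by (simp add: Re_exp)
    moreover have "cos (Arg2pi z) \<le> cos \<eta>"
    proof (cases "Arg2pi z \<le> pi")
      case True
      then show ?thesis using A \<eta> by (intro cos_monotone_0_pi_le) auto
    next
      case False
      have "cos (Arg2pi z) = cos (2 * pi - Arg2pi z)" by simp
      also have "\<dots> \<le> cos \<eta>" using A \<eta> False by (intro cos_monotone_0_pi_le) auto
      finally show ?thesis .
    qed
    ultimately show False using z(2) by simp
  qed
  have "continuous_on (sphere 0 1) f"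
    unfolding continuous_on_eq_continuous_within
  proof
    fix z :: complex assume z: "z \<in> sphere 0 1"
    show "continuous (at z within sphere 0 1) f"
    proof (cases "z \<in> \<real>\<^sub>\<ge>\<^sub>0")
      case True
      then have "z = 1" using z by (auto simp: complex_nonneg_Reals_iff complex_eq_iff cmod_def)
      have "cos \<eta> < cos 0" using \<eta> by (intro cos_monotone_0_pi) auto
      then have "open {z. cos \<eta> < Re z}" "z \<in> {z. cos \<eta> < Re z}"
        using \<open>z = 1\<close> by (auto intro: open_halfspace_Re_gt)
      then have "\<forall>\<^sub>F x in at z within sphere 0 1. f x = 0"
        unfolding eventually_at_topological using near1 by blast
      moreover have "f z = 0" using near1[OF z] \<open>z \<in> {z. cos \<eta> < Re z}\<close> by simp
      ultimately show ?thesis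
        unfolding continuous_within by (simp add: tendsto_eventually)
    next
      case False
      then have "continuous (at z) Arg2pi" by (rule continuous_at_Arg2pi)
      then have "isCont (\<lambda>z. L * Arg2pi z / (2 * pi)) z" by (intro continuous_intros) auto
      moreover have "isCont g (L * Arg2pi z / (2 * pi))"
        using g by (simp add: continuous_on_eq_continuous_at)
      ultimately have "continuous (at z) f"
        unfolding f_def[abs_def] by (rule isCont_o2)
      then show ?thesis by (rule continuous_at_imp_continuous_within)
    qed
  qed
  from Stone_Weierstrass_polynomial_function[OF compact_sphere this \<epsilon>]
  obtain p where p: "polynomial_function p" "\<And>z. z \<in> sphere 0 1 \<Longrightarrow> cmod (f z - p z) < \<epsilon>" by blast
  show thesis
  proof (rule that[OF trigonometric_polynomial[OF p(1)]])
    fix t assume t: "0 < t" "t < L"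
    have "Arg2pi (cis (2 * pi * t / L)) = 2 * pi * t / L"
      by (rule Arg2pi_unique[of 1]) (use t L in \<open>auto simp: cis_conv_exp field_simps\<close>)
    then have "f (cis (2 * pi * t / L)) = g t" using L by (simp add: f_def)
    then show "cmod (g t - p (cis (2 * pi * t / L))) < \<epsilon>" using p(2)[of "cis (2 * pi * t / L)"] by simp
  qed
qed

section \<open>Inversion of \<open>\<beta> + U\<close>\<close>

lemma in_L2_truncation:
  assumes h: "in_L2 h" and \<epsilon>: "0 < \<epsilon>"
  obtains n :: nat where "energy L (\<lambda>t. (if cmod (h t) \<le> real n then h t else 0) - h t) < \<epsilon>"
proof -
  let ?d = "\<lambda>n t. (if cmod (h t) \<le> real n then h t else 0) - h t"
  have [measurable]: "h \<in> borel_measurable lebesgue" using h by (simp add: in_L2_def)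
  have "(\<lambda>n. energy L (\<lambda>t. ?d n t)) \<longlonglongrightarrow> integral\<^sup>L lebesgue (\<lambda>t::real. 0)"
    unfolding energy_def
  proof (rule integral_dominated_convergence[where w = "\<lambda>t. (cmod (h t))\<^sup>2"])
    show "integrable lebesgue (\<lambda>t. (cmod (h t))\<^sup>2)" using h by (rule in_L2_integrable)
    show "AE t in lebesgue. (\<lambda>n. if 0 < t \<and> t < L then (cmod (?d n t))\<^sup>2 else 0) \<longlonglongrightarrow> 0"
    proof (rule AE_I2, rule tendsto_eventually)
      fix t
      obtain N :: nat where "cmod (h t) \<le> real N" using real_arch_simple by blast
      then show "\<forall>\<^sub>F n in sequentially. (if 0 < t \<and> t < L then (cmod (?d n t))\<^sup>2 else 0) = 0"
        by (auto simp: eventually_sequentially intro!: exI[of _ N])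
    qed
    show "(\<lambda>t. if 0 < t \<and> t < L then (cmod (?d n t))\<^sup>2 else 0) \<in> borel_measurable lebesgue" for n
      by (intro measurable_If borel_measurable_power borel_measurable_norm borel_measurable_diff) (auto intro: measurable_sets)
  qed auto
  then have "\<forall>\<^sub>F n in sequentially. energy L (\<lambda>t. ?d n t) < \<epsilon>"
    using order_tendstoD(2)[OF _ \<epsilon>] by simp
  then show thesis using that by (auto simp: eventually_sequentially)
qed

text \<open>Measurability provides continuous functions \<open>f n\<close> that converge to v almost
  everywhere. The factor \<open>\<rho>\<close> switches them off near the endpoints, and C / max C
  |f n| retracts them to the disc of radius C, which leaves v unchanged. After that, a constant
  dominates.\<close>

lemma continuous_approximation:
  assumes L: "0 < L" and v: "v \<in> borel_measurable lebesgue" and le: "\<And>t. cmod (v t) \<le> C" and C: "0 < C" and \<epsilon>: "0 < \<epsilon>"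
  obtains g \<delta> where "continuous_on UNIV g" "0 < \<delta>" "\<And>t. g t \<noteq> 0 \<Longrightarrow> \<delta> \<le> t \<and> t \<le> L - \<delta>"
    "energy L (\<lambda>t. g t - v t) < \<epsilon>"
proof -
  have "v measurable_on UNIV"
    using v by (intro lebesgue_measurable_imp_measurable_on) auto
  then obtain N f where N: "negligible N" and f: "\<And>n. continuous_on UNIV (f n)"
    and lim: "\<And>t. t \<notin> N \<Longrightarrow> (\<lambda>n. f n t) \<longlonglongrightarrow> v t"
    unfolding measurable_on_def by auto
  define \<rho> where "\<rho> n t = max 0 (min 1 (real n * min t (L - t) - 1))" for n t
  define g where "g n t = of_real (\<rho> n t * (C / max C (cmod (f n t)))) * f n t" for n t
  have g_cont: "continuous_on UNIV (g n)" for n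
    unfolding g_def \<rho>_def by (intro continuous_intros f) (use C in auto)
  have g_le: "cmod (g n t) \<le> C" for n t
  proof -
    have "cmod (g n t) = \<rho> n t * (C * cmod (f n t) / max C (cmod (f n t)))"
      using C by (simp add: g_def norm_mult norm_divide \<rho>_def abs_mult)
    also have "\<dots> \<le> 1 * C"
    proof (rule mult_mono)
      show "C * cmod (f n t) / max C (cmod (f n t)) \<le> C"
        using C by (simp add: pos_divide_le_eq max.strict_coboundedI1 mult_left_mono)
    qed (use C in \<open>auto simp: \<rho>_def\<close>)
    finally show ?thesis by simp
  qed
  have g_lim: "AE t in lebesgue. 0 < t \<and> t < L \<longrightarrow> (\<lambda>n. g n t) \<longlonglongrightarrow> v t"
  proof -
    have "(\<lambda>n. g n t) \<longlonglongrightarrow> v t" if "t \<notin> N" "0 < t" "t < L" for t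
    proof -
      obtain M :: nat where M: "2 / min t (L - t) \<le> real M" using real_arch_simple by blast
      have "\<rho> n t = 1" if "M \<le> n" for n
      proof -
        have "2 / min t (L - t) \<le> real n" using M that by linarith
        then have "2 \<le> real n * min t (L - t)" using \<open>0 < t\<close> \<open>t < L\<close> by (simp add: pos_divide_le_eq)
        then show ?thesis by (simp add: \<rho>_def)
      qed
      then have "\<forall>\<^sub>F n in sequentially. 1 = \<rho> n t"
        by (auto simp: eventually_sequentially)
      then have "(\<lambda>n. \<rho> n t) \<longlonglongrightarrow> 1" by (rule tendsto_eventually[OF eventually_mono]) simp
      moreover have "(\<lambda>n. f n t) \<longlonglongrightarrow> v t" using lim that by blast
      ultimately have "(\<lambda>n. g n t) \<longlonglongrightarrow> of_real (1 * (C / max C (cmod (v t)))) * v t"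
        unfolding g_def by (intro tendsto_intros) (use C in auto)
      also have "max C (cmod (v t)) = C" using le[of t] by simp
      finally show ?thesis using C by simp
    qed
    moreover have "AE t in lebesgue. t \<notin> N"
      using N by (simp add: negligible_iff_null_sets AE_not_in)
    ultimately show ?thesis by (auto elim: eventually_mono)
  qed
  let ?d = "\<lambda>n t. if 0 < t \<and> t < L then (cmod (g n t - v t))\<^sup>2 else 0"
  have "(\<lambda>n. energy L (\<lambda>t. g n t - v t)) \<longlonglongrightarrow> integral\<^sup>L lebesgue (\<lambda>t::real. 0)"
    unfolding energy_def
  proof (rule integral_dominated_convergence[where w = "\<lambda>t. (2 * C)\<^sup>2 * indicat_real {0..L} t"])
    show "integrable lebesgue (\<lambda>t. (2 * C)\<^sup>2 * indicat_real {0..L} t)"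
      by (intro integrable_mult_right integrable_real_indicator) (auto simp: emeasure_lborel_Icc_eq)
    show "AE t in lebesgue. (\<lambda>n. ?d n t) \<longlonglongrightarrow> 0"
      using g_lim
    proof eventually_elim
      case (elim t)
      show ?case
      proof (cases "0 < t \<and> t < L")
        case True
        then have "(\<lambda>n. (cmod (g n t - v t))\<^sup>2) \<longlonglongrightarrow> (cmod (v t - v t))\<^sup>2"
          using elim by (intro tendsto_intros) auto
        then show ?thesis using True by simp
      next
        case False
        show ?thesis unfolding if_not_P[OF False] by simp
      qed
    qed
    have "(cmod (g n t - v t))\<^sup>2 \<le> (2 * C)\<^sup>2" for n t
    proof -
      have "cmod (g n t - v t) \<le> 2 * C"
        using norm_triangle_ineq4[of "g n t" "v t"] g_le[of n t] le[of t] by linarith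
      then show ?thesis by (rule power_mono) simp
    qed
    then show "AE t in lebesgue. norm (?d n t) \<le> (2 * C)\<^sup>2 * indicat_real {0..L} t" for n
      by (intro AE_I2) auto
    have [measurable]: "g n \<in> borel_measurable lebesgue" for n
      using g_cont by (simp add: borel_measurable_continuous_onI measurable_completion)
    note v[measurable]
    show "(\<lambda>t. ?d n t) \<in> borel_measurable lebesgue" for n
    proof (rule measurable_If)
      show "(\<lambda>t. (cmod (g n t - v t))\<^sup>2) \<in> borel_measurable lebesgue" by measurable
    qed auto
  qed auto
  then have "\<forall>\<^sub>F n in sequentially. energy L (\<lambda>t. g n t - v t) < \<epsilon>"
    using order_tendstoD(2)[OF _ \<epsilon>] by simp
  then obtain N0 where "\<And>n. N0 \<le> n \<Longrightarrow> energy L (\<lambda>t. g n t - v t) < \<epsilon>"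
    unfolding eventually_sequentially by blast
  \<comment> \<open>The successor makes the index positive; its reciprocal serves as the
    margin.\<close>
  then have n: "energy L (\<lambda>t. g (Suc N0) t - v t) < \<epsilon>" by simp
  show thesis
  proof (rule that[OF g_cont _ _ n])
    show "1 / real (Suc N0) \<le> t \<and> t \<le> L - 1 / real (Suc N0)" if "g (Suc N0) t \<noteq> 0" for t
    proof -
      have "\<rho> (Suc N0) t \<noteq> 0" using that by (auto simp: g_def)
      then have "1 < real (Suc N0) * min t (L - t)" by (auto simp: \<rho>_def)
      moreover have "real (Suc N0) * min t (L - t) \<le> real (Suc N0) * t" "real (Suc N0) * min t (L - t) \<le> real (Suc N0) * (L - t)"
        by (auto intro: mult_left_mono simp del: of_nat_Suc)
      ultimately have "1 < real (Suc N0) * t" "1 < real (Suc N0) * (L - t)" by linarith+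
      then have "1 / real (Suc N0) < t" "1 / real (Suc N0) < L - t"
        by (simp_all only: pos_divide_less_eq of_nat_0_less_iff zero_less_Suc mult.commute)
      then show ?thesis by simp
    qed
  qed simp
qed

lemma trigonometric_dense:
  assumes L: "0 < L" and h: "in_L2 h" and \<epsilon>: "0 < \<epsilon>"
  obtains P where "trigonometric L P" "energy L (\<lambda>t. P t - h t) < \<epsilon>"
proof -
  \<comment> \<open>Two applications of \<open>energy_add_le\<close> weigh the three errors by 4, 4
    and 2, so \<epsilon> / 16 for each is enough.\<close>
  obtain n :: nat where n: "energy L (\<lambda>t. (if cmod (h t) \<le> real n then h t else 0) - h t) < \<epsilon> / 16"
    using in_L2_truncation[OF h, of "\<epsilon> / 16" L] \<epsilon> by auto
  define v where "v t = (if cmod (h t) \<le> real n then h t else 0)" for t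
  have [measurable]: "h \<in> borel_measurable lebesgue" using h by (simp add: in_L2_def)
  have "Measurable.pred lebesgue (\<lambda>t. cmod (h t) \<le> real n)" by measurable
  then have "{t. cmod (h t) \<le> real n} \<in> sets lebesgue" by (simp add: pred_def)
  then have v: "in_L2 v" unfolding v_def by (rule in_L2_restrict[OF h])
  have "cmod (v t) \<le> real n + 1" for t by (simp add: v_def)
  then obtain g \<delta> where g: "continuous_on UNIV g" "0 < \<delta>" "\<And>t. g t \<noteq> 0 \<Longrightarrow> \<delta> \<le> t \<and> t \<le> L - \<delta>"
    "energy L (\<lambda>t. g t - v t) < \<epsilon> / 16"
    using continuous_approximation[OF L in_L2_measurable[OF v], of "real n + 1" "\<epsilon> / 16"] \<epsilon> by auto
  define \<eta> where "\<eta> = sqrt (\<epsilon> / (16 * L))"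
  have \<eta>: "0 < \<eta>" "L * \<eta>\<^sup>2 = \<epsilon> / 16" using \<epsilon> L by (simp_all add: \<eta>_def)
  obtain P where P: "trigonometric L P" "\<And>t. 0 < t \<Longrightarrow> t < L \<Longrightarrow> cmod (g t - P t) < \<eta>"
    using trigonometric_uniform_approximation[OF L g(2,1,3) \<eta>(1)] by blast
  have cP: "continuous_on UNIV P" using P(1) by (rule trigonometric_continuous)
  have 1: "energy L (\<lambda>t. P t - g t) \<le> \<epsilon> / 16"
    using energy_uniform_le[of L "\<lambda>t. P t - g t" \<eta>] P(2) L \<eta>(2) by (simp add: norm_minus_commute less_imp_le)
  have s1: "in_L2_upto L (\<lambda>t. P t - g t)"
    by (intro continuous_in_L2_upto continuous_on_diff cP g)
  have s2: "in_L2_upto L (\<lambda>t. g t - v t)"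
    by (intro in_L2_upto_diff continuous_in_L2_upto g(1) in_L2_imp_upto v)
  have s3: "in_L2_upto L (\<lambda>t. v t - h t)"
    by (intro in_L2_imp_upto in_L2_diff v h)
  note s12 = in_L2_upto_add[OF s1 s2]
  have "energy L (\<lambda>t. P t - h t) = energy L (\<lambda>t. ((P t - g t) + (g t - v t)) + (v t - h t))" by simp
  also have "\<dots> \<le> 2 * energy L (\<lambda>t. (P t - g t) + (g t - v t)) + 2 * energy L (\<lambda>t. v t - h t)"
    by (rule energy_add_le[OF s12 s3])
  also have "\<dots> \<le> 2 * (2 * energy L (\<lambda>t. P t - g t) + 2 * energy L (\<lambda>t. g t - v t)) + 2 * energy L (\<lambda>t. v t - h t)"
    using energy_add_le[OF s1 s2] by simp
  also have "\<dots> < 2 * (2 * (\<epsilon> / 16) + 2 * (\<epsilon> / 16)) + 2 * (\<epsilon> / 16)"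
  proof -
    have "energy L (\<lambda>t. v t - h t) < \<epsilon> / 16" using n by (simp add: v_def)
    with 1 g(4) show ?thesis by (intro add_le_less_mono mult_left_mono mult_strict_left_mono add_mono) auto
  qed
  also have "\<dots> \<le> \<epsilon>" using \<epsilon> by simp
  finally show thesis by (rule that[OF P(1)])
qed

section \<open>Orthogonality of the modes and Parseval's identity\<close>

lemma mode_integral:
  assumes L: "0 < L"
  shows "(\<integral>t. (if 0 < t \<and> t < L then mode L k t else 0) \<partial>lebesgue) = (if k = 0 then of_real L else 0)"
    and "integrable lebesgue (\<lambda>t. if 0 < t \<and> t < L then mode L k t else 0)"
proof -
  define F where "F t = (if k = 0 then of_real t else mode L k t / (\<i> * (2 * pi * of_int k / L)))" for t
  have der: "(F has_vector_derivative mode L k t) (at t within S)" for t S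
  proof (cases "k = 0")
    case True
    have "((\<lambda>t. complex_of_real t) has_vector_derivative of_real 1) (at t within S)"
      by (intro bounded_linear.has_vector_derivative[OF bounded_linear_of_real] derivative_intros)
    then show ?thesis using True by (simp add: F_def[abs_def] mode_def)
  next
    case False
    have "(mode L k has_vector_derivative \<i> * (2 * pi * of_int k / L) * mode L k t) (at t within S)"
    proof -
      have "((\<lambda>z. exp (c * z)) has_field_derivative c * exp (c * of_real t)) (at (of_real t))" for c :: complex
        by (auto intro!: derivative_eq_intros)
      note this[of "\<i> * (2 * pi * of_int k / L)"]
      from has_vector_derivative_real_field[OF this, of S] show ?thesis
        by (simp add: mode_def[abs_def] cis_conv_exp mult_ac)
    qed
    from has_vector_derivative_divide[OF this, of "\<i> * (2 * pi * of_int k / L)"]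
    show ?thesis using False L by (simp add: F_def[abs_def])
  qed
  let ?w = "\<lambda>t. if 0 < t \<and> t < L then mode L k t else 0"
  let ?i = "\<lambda>t. indicator {0..L} t *\<^sub>R mode L k t"
  have b: "has_bochner_integral lborel (\<lambda>t. ?i t) (F L - F 0)"
    using L der continuous_on_mode by (intro has_bochner_integral_FTC_Icc) auto
  then have i: "integrable lborel (\<lambda>t. ?i t)" by (rule integrable.intros)
  then have "integrable lebesgue (\<lambda>t. ?i t)"
    by (simp add: integrable_completion)
  from integrable_restrict_interval[OF this, of 0 L]
  show int: "integrable lebesgue (\<lambda>t. ?w t)"
    by (rule back_subst[where P = "integrable lebesgue"]) auto
  have "(\<integral>t. (?w t) \<partial>lebesgue)
     = (\<integral>t. ?i t \<partial>lebesgue)"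
  proof (rule integral_cong_AE)
    show "AE t in lebesgue. (?w t) = ?i t"
      using AE_lebesgue_neq[of 0] AE_lebesgue_neq[of L] by eventually_elim auto
  qed (use int \<open>integrable lebesgue (\<lambda>t. ?i t)\<close> in \<open>auto intro: borel_measurable_integrable\<close>)
  also have "\<dots> = (\<integral>t. ?i t \<partial>lborel)"
    by (rule integral_completion) (use i in \<open>rule borel_measurable_integrable\<close>)
  also have "\<dots> = F L - F 0" using b by (rule has_bochner_integral_integral_eq)
  also have "\<dots> = (if k = 0 then of_real L else 0)"
    using L cis_multiple_2pi[of "of_int k"] by (simp add: F_def mode_def mult_ac)
  finally show "(\<integral>t. (?w t) \<partial>lebesgue) = (if k = 0 then of_real L else 0)" .
qed

lemma parseval:
  assumes L: "0 < L" and K: "finite K"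
  shows "energy L (\<lambda>t. \<Sum>k\<in>K. a k * mode L k t) = L * (\<Sum>k\<in>K. (cmod (a k))\<^sup>2)"
proof -
  let ?f = "\<lambda>t. \<Sum>k\<in>K. a k * mode L k t"
  let ?e = "\<lambda>j t. if 0 < t \<and> t < L then mode L j t else 0"
  have cnj_mode: "cnj (mode L k t) = mode L (- k) t" for k t
    by (simp add: mode_def cis_cnj)
  have point: "complex_of_real (if 0 < t \<and> t < L then (cmod (?f t))\<^sup>2 else 0)
      = (\<Sum>j\<in>K. \<Sum>k\<in>K. a j * cnj (a k) * ?e (j - k) t)" for t
  proof (cases "0 < t \<and> t < L")
    case True
    have "complex_of_real ((cmod (?f t))\<^sup>2) = ?f t * cnj (?f t)" by (rule complex_norm_square)
    also have "\<dots> = (\<Sum>j\<in>K. \<Sum>k\<in>K. a j * cnj (a k) * (mode L j t * mode L (- k) t))"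
      by (simp add: sum_product cnj_mode mult_ac)
    finally show ?thesis using True by (simp add: mode_mult)
  qed auto
  have "complex_of_real (energy L ?f) = (\<integral>t. complex_of_real (if 0 < t \<and> t < L then (cmod (?f t))\<^sup>2 else 0) \<partial>lebesgue)"
    by (simp add: energy_def)
  also have "\<dots> = (\<Sum>j\<in>K. \<Sum>k\<in>K. a j * cnj (a k) * (\<integral>t. ?e (j - k) t \<partial>lebesgue))"
    unfolding point using mode_integral(2)[OF L] by (simp add: Bochner_Integration.integral_sum)
  also have "\<dots> = (\<Sum>j\<in>K. \<Sum>k\<in>K. if k = j then a j * cnj (a j) * of_real L else 0)"
    unfolding mode_integral(1)[OF L] by (intro sum.cong refl) auto
  also have "\<dots> = (\<Sum>j\<in>K. a j * cnj (a j) * of_real L)" using K by simp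
  also have "\<dots> = of_real (L * (\<Sum>k\<in>K. (cmod (a k))\<^sup>2))"
    by (simp add: sum_distrib_left mult.commute flip: complex_norm_square)
  finally show ?thesis by (simp only: of_real_eq_iff)
qed

section \<open>The operator \<beta> + U in its eigenbasis\<close>

lemma energy_quasi_shift_le:
  assumes "0 < \<Lambda>2" "\<Lambda>2 < \<Lambda>1" and m: "in_L2 m"
  shows "energy \<Lambda>1 (quasi_shift \<alpha> \<Lambda>1 \<Lambda>2 m) \<le> (1 + (cmod \<alpha>)\<^sup>2) * energy \<Lambda>1 m"
proof -
  define f where "f t = (if 0 < t \<and> t < \<Lambda>1 then (cmod (m t))\<^sup>2 else 0)" for t
  have f: "integrable lebesgue f"
    unfolding f_def by (intro in_L2_upto_integrable in_L2_imp_upto m)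
  have f_shift: "integrable lebesgue (\<lambda>t. f (t + d))" for d
    using has_bochner_integral_lebesgue_real_affine_iff[of 1 f _ d, THEN iffD1, OF _ has_bochner_integral_integrable[OF f]]
    by (simp add: add.commute integrable.intros)
  have "energy \<Lambda>1 (quasi_shift \<alpha> \<Lambda>1 \<Lambda>2 m) \<le> (\<integral>t. f (t + (\<Lambda>1 - \<Lambda>2)) + (cmod \<alpha>)\<^sup>2 * f (t + - \<Lambda>2) \<partial>lebesgue)"
  proof (rule energy_bound)
    show "integrable lebesgue (\<lambda>t. f (t + (\<Lambda>1 - \<Lambda>2)) + (cmod \<alpha>)\<^sup>2 * f (t + - \<Lambda>2))"
      by (intro Bochner_Integration.integrable_add integrable_mult_right f_shift)
    show "AE t in lebesgue. 0 < t \<and> t < \<Lambda>1 \<longrightarrow> (cmod (quasi_shift \<alpha> \<Lambda>1 \<Lambda>2 m t))\<^sup>2 \<le> f (t + (\<Lambda>1 - \<Lambda>2)) + (cmod \<alpha>)\<^sup>2 * f (t + - \<Lambda>2)"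
      using AE_lebesgue_neq[of \<Lambda>2]
      by eventually_elim (use assms in \<open>auto simp: quasi_shift_def f_def norm_mult power_mult_distrib algebra_simps\<close>)
  qed (simp add: f_def)
  also have "\<dots> = (\<integral>t. f t \<partial>lebesgue) + (cmod \<alpha>)\<^sup>2 * (\<integral>t. f t \<partial>lebesgue)"
    using f_shift[of "\<Lambda>1 - \<Lambda>2"] f_shift[of "- \<Lambda>2"] lebesgue_integral_shift[of f "\<Lambda>1 - \<Lambda>2"] lebesgue_integral_shift[of f "- \<Lambda>2"] by simp
  also have "(\<integral>t. f t \<partial>lebesgue) = energy \<Lambda>1 m" by (simp add: f_def energy_def)
  finally show ?thesis by (simp add: algebra_simps)
qed

text \<open>The assumption on s forces \<alpha> \<noteq> 0. Then exp (s t) times any mode is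
  multiplied by \<alpha> under t \<mapsto> t + \<Lambda>1, so the two branches of
  \<open>quasi_shift\<close> agree on it and U acts as a scalar.\<close>

locale quasi_shift_equation =
  fixes \<alpha> \<beta> s :: complex and \<Lambda>1 \<Lambda>2 :: real
  assumes \<Lambda>: "0 < \<Lambda>2" "\<Lambda>2 < \<Lambda>1" and s: "exp (s * of_real \<Lambda>1) = \<alpha>"
begin

definition op :: "(real \<Rightarrow> complex) \<Rightarrow> real \<Rightarrow> complex" where
  "op m c = \<beta> * m c + quasi_shift \<alpha> \<Lambda>1 \<Lambda>2 m c"

definition eigenvalue :: "int \<Rightarrow> complex" where
  "eigenvalue k = \<beta> + exp (s * of_real (\<Lambda>1 - \<Lambda>2)) * mode \<Lambda>1 k (\<Lambda>1 - \<Lambda>2)"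

lemma op_eigenfunctions:
  "op (\<lambda>t. exp (s * of_real t) * (\<Sum>k\<in>K. a k * mode \<Lambda>1 k t)) c
    = exp (s * of_real c) * (\<Sum>k\<in>K. eigenvalue k * a k * mode \<Lambda>1 k c)"
proof -
  have mode_shift: "mode \<Lambda>1 k (c - \<Lambda>2) = mode \<Lambda>1 k (c + (\<Lambda>1 - \<Lambda>2))" for k
  proof -
    have "mode \<Lambda>1 k (c - \<Lambda>2) * cis (2 * pi * of_int k) = mode \<Lambda>1 k (c + (\<Lambda>1 - \<Lambda>2))"
      using \<Lambda> by (simp add: mode_def cis_mult field_simps)
    then show ?thesis by simp
  qed
  have exp_shift: "\<alpha> * exp (s * of_real (c - \<Lambda>2)) = exp (s * of_real (c + (\<Lambda>1 - \<Lambda>2)))"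
    unfolding s[symmetric] exp_add[symmetric] by (simp add: algebra_simps)
  have split: "exp (s * of_real (c + (\<Lambda>1 - \<Lambda>2))) = exp (s * of_real c) * exp (s * of_real (\<Lambda>1 - \<Lambda>2))"
    unfolding exp_add[symmetric] by (simp add: algebra_simps)
  have mode_split: "mode \<Lambda>1 k (c + (\<Lambda>1 - \<Lambda>2)) = mode \<Lambda>1 k c * mode \<Lambda>1 k (\<Lambda>1 - \<Lambda>2)" for k
    by (simp add: mode_def cis_mult algebra_simps add_divide_distrib diff_divide_distrib)
  have "quasi_shift \<alpha> \<Lambda>1 \<Lambda>2 (\<lambda>t. exp (s * of_real t) * (\<Sum>k\<in>K. a k * mode \<Lambda>1 k t)) c
      = exp (s * of_real (c + (\<Lambda>1 - \<Lambda>2))) * (\<Sum>k\<in>K. a k * mode \<Lambda>1 k (c + (\<Lambda>1 - \<Lambda>2)))"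
    by (simp only: quasi_shift_def mode_shift mult.assoc[symmetric] exp_shift if_cancel)
  then show ?thesis
    unfolding op_def split mode_split eigenvalue_def
    by (simp add: sum_distrib_left distrib_right distrib_left sum.distrib mult_ac)
qed

lemma op_add: "op (\<lambda>t. f t + g t) c = op f c + op g c"
  and op_zero: "op (\<lambda>t. 0) c = 0"
  by (simp_all add: op_def quasi_shift_def algebra_simps)

lemma op_diff: "op (\<lambda>t. f t - g t) c = op f c - op g c"
  by (simp add: op_def quasi_shift_def algebra_simps)

lemma in_L2_op: "in_L2 m \<Longrightarrow> in_L2 (op m)"
  unfolding op_def[abs_def] by (intro in_L2_intros in_L2_quasi_shift)

lemma energy_op_le:
  assumes m: "in_L2 m"
  shows "energy \<Lambda>1 (op m) \<le> (2 * (cmod \<beta>)\<^sup>2 + 2 * (1 + (cmod \<alpha>)\<^sup>2)) * energy \<Lambda>1 m"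
proof -
  have "energy \<Lambda>1 (op m) \<le> 2 * energy \<Lambda>1 (\<lambda>c. \<beta> * m c) + 2 * energy \<Lambda>1 (quasi_shift \<alpha> \<Lambda>1 \<Lambda>2 m)"
    unfolding op_def[abs_def]
    by (intro energy_add_le in_L2_imp_upto in_L2_cmult in_L2_quasi_shift m)
  also have "\<dots> \<le> 2 * ((cmod \<beta>)\<^sup>2 * energy \<Lambda>1 m) + 2 * ((1 + (cmod \<alpha>)\<^sup>2) * energy \<Lambda>1 m)"
    using energy_mult_le[OF in_L2_imp_upto[OF m], of \<Lambda>1 "\<lambda>_. \<beta>" "cmod \<beta>"]
      energy_quasi_shift_le[OF \<Lambda> m, of \<alpha>] by simp
  finally show ?thesis by (simp add: algebra_simps)
qed

text \<open>Bounds multiplication by exp (s t) and by exp (- s t) on (0, \<Lambda>1): the cost of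
  passing between the eigenbasis and the orthogonal modes.\<close>

definition growth :: real where
  "growth = exp (cmod s * \<Lambda>1)"

lemma growth_bound:
  assumes "0 < t" "t < \<Lambda>1"
  shows "cmod (exp (s * of_real t)) \<le> growth" "cmod (exp (- s * of_real t)) \<le> growth"
proof -
  have "\<bar>Re s * t\<bar> \<le> cmod s * \<Lambda>1"
    unfolding abs_mult using assms abs_Re_le_cmod[of s] by (intro mult_mono) auto
  then show "cmod (exp (s * of_real t)) \<le> growth" "cmod (exp (- s * of_real t)) \<le> growth"
    by (simp_all add: growth_def norm_exp_eq_Re)
qed

lemma growth_ge_1: "1 \<le> growth"
  using \<Lambda> by (simp add: growth_def)

text \<open>Multiply h by exp (- s t), approximate by a trigonometric polynomial P, divide its
  coefficients by the eigenvalues and multiply back. For \<delta> = 0 the last bound is trivial and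
  the statement is density of the range; for \<delta> > 0 the size of m is controlled uniformly.
  Each of the two multiplications contributes growth^2 to the constant, and the 2 comes from
  splitting P into g and the approximation error.\<close>

lemma approximate_inverse:
  assumes nz: "\<And>k. eigenvalue k \<noteq> 0" and \<delta>: "\<And>k. \<delta> \<le> cmod (eigenvalue k)" "0 \<le> \<delta>"
    and h: "in_L2 h" and \<epsilon>: "0 < \<epsilon>"
  shows "\<exists>m. in_L2 m \<and> (\<forall>t. m t \<noteq> 0 \<longrightarrow> 0 < t \<and> t < \<Lambda>1) \<and> energy \<Lambda>1 (\<lambda>c. op m c - h c) < \<epsilon> \<and>
    \<delta>\<^sup>2 * energy \<Lambda>1 m \<le> 2 * growth ^ 4 * (energy \<Lambda>1 h + \<epsilon>)"
proof -
  have L: "0 < \<Lambda>1" using \<Lambda> by simp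
  let ?E = "\<lambda>t. exp (s * of_real t)" and ?E' = "\<lambda>t. exp (- s * of_real t)"
  have E_cont: "continuous_on UNIV ?E" "continuous_on UNIV ?E'" by (intro continuous_intros)+
  have E_inv: "?E t * ?E' t = 1" for t by (simp flip: exp_add)
  define g where "g t = (if 0 < t \<and> t < \<Lambda>1 then ?E' t * h t else 0)" for t
  have g: "in_L2 g"
  proof -
    have "in_L2 (\<lambda>t. ?E' t * (if 0 < t \<and> t < \<Lambda>1 then h t else 0))"
      by (rule in_L2_mult_bounded[where C = growth])
         (use growth_bound(2) E_cont(2) in \<open>auto intro!: in_L2_restrict h
            simp: borel_measurable_continuous_onI measurable_completion split: if_splits\<close>)
    then show ?thesis unfolding g_def by (rule back_subst[where P = in_L2]) auto
  qed
  have g_energy: "energy \<Lambda>1 g \<le> growth\<^sup>2 * energy \<Lambda>1 h"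
  proof -
    have "energy \<Lambda>1 g = energy \<Lambda>1 (\<lambda>t. ?E' t * h t)"
      unfolding energy_def by (rule Bochner_Integration.integral_cong) (auto simp: g_def)
    also have "\<dots> \<le> growth\<^sup>2 * energy \<Lambda>1 h"
      by (rule energy_mult_le[OF in_L2_imp_upto[OF h]]) (rule growth_bound(2))
    finally show ?thesis .
  qed
  \<comment> \<open>Multiplying the error of P by exp (s t) costs the factor growth^2.\<close>
  define \<eta> where "\<eta> = \<epsilon> / growth\<^sup>2"
  have growth_pos: "0 < growth" using growth_ge_1 by simp
  have \<eta>: "0 < \<eta>" "growth\<^sup>2 * \<eta> = \<epsilon>" using \<epsilon> growth_pos by (simp_all add: \<eta>_def)
  obtain P where P: "trigonometric \<Lambda>1 P" "energy \<Lambda>1 (\<lambda>t. P t - g t) < \<eta>"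
    using trigonometric_dense[OF L g \<eta>(1)] .
  obtain K a where K: "finite K" and P_eq: "P = (\<lambda>t. \<Sum>k\<in>K. a k * mode \<Lambda>1 k t)"
    using P(1) by (auto simp: trigonometric_def)
  define Q where "Q t = (\<Sum>k\<in>K. (a k / eigenvalue k) * mode \<Lambda>1 k t)" for t
  have Q_cont: "continuous_on UNIV Q"
    unfolding Q_def by (intro continuous_intros continuous_on_mode)
  define m where "m t = (if 0 < t \<and> t < \<Lambda>1 then ?E t * Q t else 0)" for t
  have m: "in_L2 m"
    unfolding m_def by (intro in_L2_continuous_on_interval continuous_on_mult E_cont Q_cont)
  \<comment> \<open>At c = \<Lambda>2 the operator evaluates m at 0, where the cut-off has replaced
    the eigenfunction expansion by 0.\<close>
  have op_m: "op m c = ?E c * P c" if "0 < c" "c < \<Lambda>1" "c \<noteq> \<Lambda>2" for c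
  proof -
    have "op m c = op (\<lambda>t. ?E t * Q t) c"
      using that \<Lambda> by (auto simp: op_def quasi_shift_def m_def)
    also have "\<dots> = ?E c * P c"
      unfolding Q_def op_eigenfunctions P_eq using nz by simp
    finally show ?thesis .
  qed
  have P_cont: "continuous_on UNIV P" by (rule trigonometric_continuous[OF P(1)])
  have Pg: "in_L2_upto \<Lambda>1 (\<lambda>t. P t - g t)"
    by (intro in_L2_upto_diff continuous_in_L2_upto P_cont in_L2_imp_upto g)
  have "energy \<Lambda>1 (\<lambda>c. op m c - h c) = energy \<Lambda>1 (\<lambda>t. ?E t * (P t - g t))"
  proof -
    have "AE t in lebesgue. 0 < t \<and> t < \<Lambda>1 \<longrightarrow> ?E t * (P t - g t) = op m t - h t"
      using AE_lebesgue_neq[of \<Lambda>2]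
    proof eventually_elim
      case (elim t)
      show ?case
      proof
        assume t: "0 < t \<and> t < \<Lambda>1"
        then have "?E t * g t = h t" unfolding g_def using E_inv[of t] by (simp add: mult.assoc[symmetric])
        then show "?E t * (P t - g t) = op m t - h t" using op_m[of t] t elim by (simp add: right_diff_distrib)
      qed
    qed
    then show ?thesis
      by (intro energy_cong_AE[symmetric] in_L2_imp_upto in_L2_diff in_L2_op m h)
  qed
  also have "\<dots> \<le> growth\<^sup>2 * energy \<Lambda>1 (\<lambda>t. P t - g t)"
    by (rule energy_mult_le[OF Pg]) (rule growth_bound(1))
  also have "\<dots> < growth\<^sup>2 * \<eta>" using P(2) growth_pos by (intro mult_strict_left_mono) auto
  finally have 1: "energy \<Lambda>1 (\<lambda>c. op m c - h c) < \<epsilon>" unfolding \<eta>(2) .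
  have "\<delta>\<^sup>2 * energy \<Lambda>1 Q = \<Lambda>1 * (\<Sum>k\<in>K. \<delta>\<^sup>2 * (cmod (a k / eigenvalue k))\<^sup>2)"
    unfolding Q_def parseval[OF L K] by (simp add: sum_distrib_left mult_ac)
  also have "\<dots> \<le> \<Lambda>1 * (\<Sum>k\<in>K. (cmod (a k))\<^sup>2)"
  proof (intro mult_left_mono sum_mono)
    fix k
    have "\<delta>\<^sup>2 * (cmod (a k / eigenvalue k))\<^sup>2 \<le> (cmod (eigenvalue k))\<^sup>2 * (cmod (a k / eigenvalue k))\<^sup>2"
      using \<delta>(1)[of k] \<delta>(2) by (intro mult_right_mono power_mono) auto
    also have "\<dots> = (cmod (a k))\<^sup>2" using nz[of k] by (simp add: norm_divide power_divide)
    finally show "\<delta>\<^sup>2 * (cmod (a k / eigenvalue k))\<^sup>2 \<le> (cmod (a k))\<^sup>2" .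
  qed (use L in auto)
  also have "\<dots> = energy \<Lambda>1 (\<lambda>t. (P t - g t) + g t)"
    unfolding P_eq diff_add_cancel parseval[OF L K] ..
  also have "\<dots> \<le> 2 * energy \<Lambda>1 (\<lambda>t. P t - g t) + 2 * energy \<Lambda>1 g"
    by (intro energy_add_le Pg in_L2_imp_upto g)
  also have "\<dots> \<le> 2 * (growth\<^sup>2 * \<epsilon>) + 2 * (growth\<^sup>2 * energy \<Lambda>1 h)"
  proof -
    have "\<eta> \<le> \<epsilon>" using \<epsilon> growth_ge_1 one_le_power[OF growth_ge_1, of 2] by (simp add: \<eta>_def field_simps)
    moreover have "1 * \<epsilon> \<le> growth\<^sup>2 * \<epsilon>" using \<epsilon> one_le_power[OF growth_ge_1, of 2] by (intro mult_right_mono) auto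
    ultimately show ?thesis using P(2) g_energy by linarith
  qed
  finally have Q_energy: "\<delta>\<^sup>2 * energy \<Lambda>1 Q \<le> 2 * growth\<^sup>2 * (energy \<Lambda>1 h + \<epsilon>)" by (simp add: algebra_simps)
  have "energy \<Lambda>1 m = energy \<Lambda>1 (\<lambda>t. ?E t * Q t)"
    unfolding energy_def by (rule Bochner_Integration.integral_cong) (auto simp: m_def)
  also have "\<dots> \<le> growth\<^sup>2 * energy \<Lambda>1 Q"
    by (rule energy_mult_le[OF continuous_in_L2_upto[OF Q_cont]]) (rule growth_bound(1))
  finally have "\<delta>\<^sup>2 * energy \<Lambda>1 m \<le> growth\<^sup>2 * (\<delta>\<^sup>2 * energy \<Lambda>1 Q)"
    using mult_left_mono[of _ _ "\<delta>\<^sup>2"] by (simp add: mult.left_commute)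
  also have "\<dots> \<le> growth\<^sup>2 * (2 * growth\<^sup>2 * (energy \<Lambda>1 h + \<epsilon>))" by (intro mult_left_mono Q_energy) auto
  also have "\<dots> = 2 * growth ^ 4 * (energy \<Lambda>1 h + \<epsilon>)"
    by (simp add: power4_eq_xxxx power2_eq_square)
  finally show ?thesis using m 1 by (intro exI[of _ m]) (auto simp: m_def)
qed

text \<open>Iterated correction: each residual \<open>r n\<close> is inverted up to an error of
  energy (1/8)^(n + 1), which becomes the next residual. The spectral gap bounds the corrections
  \<open>f n\<close> by a multiple of (1/8)^n, the rate that \<open>in_L2_series\<close> needs, and
  boundedness of \<open>op\<close> passes to the limit.\<close>

lemma exact_inverse:
  assumes \<delta>: "\<And>k. \<delta> \<le> cmod (eigenvalue k)" "0 < \<delta>" and h: "in_L2 h"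
  shows "\<exists>m. in_L2 m \<and> (AE c in lebesgue. 0 < c \<and> c < \<Lambda>1 \<longrightarrow> op m c = h c)"
proof -
  have nz: "eigenvalue k \<noteq> 0" for k using \<delta>(1)[of k] \<delta>(2) by auto
  define C where "C = 2 * growth ^ 4 / \<delta>\<^sup>2"
  have C0: "0 \<le> C" unfolding C_def growth_def by simp
  \<comment> \<open>The premises stand under the existential so that choice yields a total function
    \<open>inv\<close>.\<close>
  have "\<exists>m. in_L2 h' \<and> 0 < \<epsilon> \<longrightarrow> (in_L2 m \<and> (\<forall>t. m t \<noteq> 0 \<longrightarrow> 0 < t \<and> t < \<Lambda>1) \<and>
     energy \<Lambda>1 (\<lambda>c. op m c - h' c) < \<epsilon> \<and> energy \<Lambda>1 m \<le> C * (energy \<Lambda>1 h' + \<epsilon>))" for h' \<epsilon>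
  proof (cases "in_L2 h' \<and> 0 < \<epsilon>")
    case True
    then obtain m where m: "in_L2 m" "\<forall>t. m t \<noteq> 0 \<longrightarrow> 0 < t \<and> t < \<Lambda>1" "energy \<Lambda>1 (\<lambda>c. op m c - h' c) < \<epsilon>"
      and le: "\<delta>\<^sup>2 * energy \<Lambda>1 m \<le> 2 * growth ^ 4 * (energy \<Lambda>1 h' + \<epsilon>)"
      using approximate_inverse[OF nz \<delta>(1), of h' \<epsilon>] \<delta>(2) by auto
    have "energy \<Lambda>1 m = \<delta>\<^sup>2 * energy \<Lambda>1 m / \<delta>\<^sup>2" using \<delta>(2) by simp
    also have "\<dots> \<le> 2 * growth ^ 4 * (energy \<Lambda>1 h' + \<epsilon>) / \<delta>\<^sup>2" using le by (rule divide_right_mono) simp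
    finally show ?thesis using m unfolding C_def by (intro exI[of _ m]) simp
  qed blast
  then obtain inv where inv0: "\<And>h' \<epsilon>. in_L2 h' \<and> 0 < \<epsilon> \<longrightarrow> (in_L2 (inv h' \<epsilon>) \<and> (\<forall>t. inv h' \<epsilon> t \<noteq> 0 \<longrightarrow> 0 < t \<and> t < \<Lambda>1) \<and>
     energy \<Lambda>1 (\<lambda>c. op (inv h' \<epsilon>) c - h' c) < \<epsilon> \<and> energy \<Lambda>1 (inv h' \<epsilon>) \<le> C * (energy \<Lambda>1 h' + \<epsilon>))"
    by metis
  have inv: "in_L2 (inv h' \<epsilon>)" "inv h' \<epsilon> t \<noteq> 0 \<Longrightarrow> 0 < t \<and> t < \<Lambda>1"
     "energy \<Lambda>1 (\<lambda>c. op (inv h' \<epsilon>) c - h' c) < \<epsilon>" "energy \<Lambda>1 (inv h' \<epsilon>) \<le> C * (energy \<Lambda>1 h' + \<epsilon>)"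
    if "in_L2 h'" "0 < \<epsilon>" for h' \<epsilon> t
    using inv0[of h' \<epsilon>] that by blast+
  define r where "r = rec_nat h (\<lambda>n f c. f c - op (inv f ((1/8) ^ Suc n)) c)"
  have r0: "r 0 = h" and rSuc: "r (Suc n) = (\<lambda>c. r n c - op (inv (r n) ((1/8) ^ Suc n)) c)" for n
    by (simp_all add: r_def)
  define f where "f n = inv (r n) ((1/8) ^ Suc n)" for n
  have r_sq: "in_L2 (r n)" for n
  proof (induction n)
    case 0 then show ?case using h by (simp add: r0)
  next
    case (Suc n)
    show ?case unfolding rSuc by (intro in_L2_diff in_L2_op inv(1) Suc) simp
  qed
  have f_sq: "in_L2 (f n)" and f_supp: "f n t \<noteq> 0 \<Longrightarrow> 0 < t \<and> t < \<Lambda>1"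
    and f_res: "energy \<Lambda>1 (\<lambda>c. op (f n) c - r n c) < (1/8) ^ Suc n"
    and f_energy: "energy \<Lambda>1 (f n) \<le> C * (energy \<Lambda>1 (r n) + (1/8) ^ Suc n)" for n t
    unfolding f_def using inv[OF r_sq, of "(1/8) ^ Suc n" n] by auto
  have r_Suc_energy: "energy \<Lambda>1 (r (Suc n)) \<le> (1/8) ^ Suc n" for n
  proof -
    have "energy \<Lambda>1 (r (Suc n)) = energy \<Lambda>1 (\<lambda>c. op (f n) c - r n c)"
      unfolding energy_def by (rule Bochner_Integration.integral_cong) (simp_all add: rSuc f_def norm_minus_commute)
    then show ?thesis using f_res[of n] by simp
  qed
  \<comment> \<open>Covers n = 0, where the residual is h itself, and n > 0, where residual and
    tolerance together are at most 2 (1/8)^n.\<close>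
  define A where "A = C * (energy \<Lambda>1 h + 2)"
  have f_int: "(\<integral>t. (cmod (f n t))\<^sup>2 \<partial>lebesgue) \<le> A / 8 ^ n" for n
  proof -
    have "(\<integral>t. (cmod (f n t))\<^sup>2 \<partial>lebesgue) = energy \<Lambda>1 (f n)"
      unfolding energy_def by (rule Bochner_Integration.integral_cong) (use f_supp[of n] in auto)
    also have "\<dots> \<le> C * (energy \<Lambda>1 (r n) + (1/8) ^ Suc n)" by (rule f_energy)
    also have "\<dots> \<le> C * ((energy \<Lambda>1 h + 2) * (1/8) ^ n)"
    proof (rule mult_left_mono[OF _ C0])
      show "energy \<Lambda>1 (r n) + (1/8) ^ Suc n \<le> (energy \<Lambda>1 h + 2) * (1/8) ^ n"
      proof (cases n)
        case 0
        then show ?thesis by (simp add: r0)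
      next
        case (Suc l)
        have "energy \<Lambda>1 (r n) \<le> (1/8) ^ n" using r_Suc_energy[of l] Suc by simp
        moreover have "(1/8 :: real) ^ Suc n \<le> (1/8) ^ n" by simp
        moreover have "0 \<le> energy \<Lambda>1 h * (1/8) ^ n" by (simp add: energy_nonneg)
        ultimately show ?thesis unfolding distrib_right by linarith
      qed
    qed
    also have "\<dots> = A / 8 ^ n" by (simp add: A_def power_divide)
    finally show ?thesis .
  qed
  obtain F where F: "in_L2 F" and
    lim: "(\<lambda>n. \<integral>t. (cmod (F t - (\<Sum>k<n. f k t)))\<^sup>2 \<partial>lebesgue) \<longlonglongrightarrow> 0"
    using in_L2_series[OF f_sq f_int] by blast
  have residual: "h c - op (\<lambda>t. \<Sum>k<n. f k t) c = r n c" for n c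
  proof (induction n)
    case 0 then show ?case by (simp add: r0 op_zero)
  next
    case (Suc n)
    then show ?case by (simp add: op_add rSuc f_def algebra_simps)
  qed
  define D where "D = 2 * (cmod \<beta>)\<^sup>2 + 2 * (1 + (cmod \<alpha>)\<^sup>2)"
  have D0: "0 \<le> D" by (simp add: D_def)
  have bound: "energy \<Lambda>1 (\<lambda>c. op F c - h c) \<le> 2 * (D * (\<integral>t. (cmod (F t - (\<Sum>k<Suc n. f k t)))\<^sup>2 \<partial>lebesgue)) + 2 * (1/8) ^ Suc n" for n
  proof -
    let ?S = "\<lambda>t. \<Sum>k<Suc n. f k t"
    have S: "in_L2 (\<lambda>t. F t - ?S t)" by (intro in_L2_diff F in_L2_sum f_sq)
    have "energy \<Lambda>1 (\<lambda>c. op F c - h c) = energy \<Lambda>1 (\<lambda>c. op (\<lambda>t. F t - ?S t) c + - r (Suc n) c)"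
      unfolding op_diff residual[symmetric] by simp
    also have "\<dots> \<le> 2 * energy \<Lambda>1 (op (\<lambda>t. F t - ?S t)) + 2 * energy \<Lambda>1 (\<lambda>c. - r (Suc n) c)"
      by (intro energy_add_le in_L2_imp_upto in_L2_op S in_L2_uminus r_sq)
    also have "energy \<Lambda>1 (\<lambda>c. - r (Suc n) c) = energy \<Lambda>1 (r (Suc n))"
      unfolding energy_def by (rule Bochner_Integration.integral_cong) simp_all
    also have "energy \<Lambda>1 (op (\<lambda>t. F t - ?S t)) \<le> D * energy \<Lambda>1 (\<lambda>t. F t - ?S t)"
      unfolding D_def by (rule energy_op_le[OF S])
    also have "energy \<Lambda>1 (\<lambda>t. F t - ?S t) \<le> (\<integral>t. (cmod (F t - ?S t))\<^sup>2 \<partial>lebesgue)"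
      by (rule energy_bound[OF in_L2_integrable[OF S]]) auto
    finally show ?thesis using r_Suc_energy[of n] D0 by (simp add: mult_left_mono)
  qed
  have "(\<lambda>n. 2 * (D * (\<integral>t. (cmod (F t - (\<Sum>k<Suc n. f k t)))\<^sup>2 \<partial>lebesgue)) + 2 * (1/8) ^ Suc n) \<longlonglongrightarrow> 2 * (D * 0) + 2 * 0"
    by (intro tendsto_intros LIMSEQ_Suc[OF lim] LIMSEQ_Suc[OF LIMSEQ_realpow_zero]) auto
  then have "energy \<Lambda>1 (\<lambda>c. op F c - h c) \<le> 2 * (D * 0) + 2 * 0"
    by (rule LIMSEQ_le_const) (use bound in blast)
  then have "AE c in lebesgue. 0 < c \<and> c < \<Lambda>1 \<longrightarrow> op F c - h c = 0"
    by (intro energy_zero_AE in_L2_imp_upto in_L2_diff in_L2_op F h) simp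
  then show ?thesis using F by (intro exI[of _ F]) auto
qed

end

section \<open>Exact controllability and the spectral gap\<close>

context delay_system
begin

definition exactly_reachable :: bool where
  "exactly_reachable \<longleftrightarrow> (\<forall>wy zy. in_L2 wy \<longrightarrow> in_L2 zy \<longrightarrow>
    (\<exists>w z. zero_response w z \<and> (AE t in lebesgue. T - \<Lambda>1 < t \<and> t < T \<longrightarrow> w t = wy t \<and> z t = zy t)))"

lemma mode_window_integral:
  "(\<integral>t. (if T - \<Lambda>1 < t \<and> t < T then mode \<Lambda>1 k t else 0) \<partial>lebesgue) = (if k = 0 then of_real \<Lambda>1 else 0)"
  and mode_window_integrable:
  "integrable lebesgue (\<lambda>t. if T - \<Lambda>1 < t \<and> t < T then mode \<Lambda>1 k t else 0)"
proof -
  let ?w = "\<lambda>t. if T - \<Lambda>1 < t \<and> t < T then mode \<Lambda>1 k t else 0"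
  let ?f = "\<lambda>t. if 0 < t \<and> t < \<Lambda>1 then mode \<Lambda>1 k t else 0"
  have eq: "(\<lambda>t. ?w t)
      = (\<lambda>t. mode \<Lambda>1 k (T - \<Lambda>1) * ?f (t + - (T - \<Lambda>1)))"
    by (auto simp: fun_eq_iff mode_def cis_mult algebra_simps simp flip: add_divide_distrib)
  have "(\<integral>t. (?w t) \<partial>lebesgue)
      = mode \<Lambda>1 k (T - \<Lambda>1) * (\<integral>t. ?f t \<partial>lebesgue)"
    using lebesgue_integral_shift[of ?f "- (T - \<Lambda>1)"] by (simp only: eq integral_mult_right_zero)
  then show "(\<integral>t. (?w t) \<partial>lebesgue) = (if k = 0 then of_real \<Lambda>1 else 0)"
    unfolding mode_integral(1)[OF \<Lambda>1_pos] by (simp add: mode_def)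
  have "in_L2 (\<lambda>t. ?w t)"
    by (rule in_L2_continuous_on_interval[OF continuous_on_mode])
  from in_L2_product[OF this in_L2_indicator[of "T - \<Lambda>1" T 1]]
  show "integrable lebesgue (\<lambda>t. ?w t)"
    by (rule back_subst[where P = "integrable lebesgue"]) auto
qed

text \<open>The series converges absolutely and may be integrated term by term. The window has the
  length of the period, so orthogonality and injectivity of k leave the i-th term alone.\<close>

lemma lacunary_fourier_coefficient:
  fixes k :: "nat \<Rightarrow> int"
  assumes k: "inj k"
  defines "F \<equiv> \<lambda>t. \<Sum>j. (1/2) ^ j * mode \<Lambda>1 (k j) t"
  shows "(\<integral>t. (if T - \<Lambda>1 < t \<and> t < T then F t * mode \<Lambda>1 (- k i) t else 0) \<partial>lebesgue) = (1/2) ^ i * of_real \<Lambda>1"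
    and "integrable lebesgue (\<lambda>t. if T - \<Lambda>1 < t \<and> t < T then F t * mode \<Lambda>1 (- k i) t else 0)"
    and "F \<in> borel_measurable lebesgue" and "cmod (F t) \<le> 2"
proof -
  let ?W = "\<lambda>t. if T - \<Lambda>1 < t \<and> t < T then F t * mode \<Lambda>1 (- k i) t else 0"
  define g where "g j t = (if T - \<Lambda>1 < t \<and> t < T then (1/2) ^ j * mode \<Lambda>1 (k j - k i) t else 0)" for j t
  have g_eq: "g j = (\<lambda>t. (1/2) ^ j * (if T - \<Lambda>1 < t \<and> t < T then mode \<Lambda>1 (k j - k i) t else 0))" for j
    by (auto simp: g_def)
  have g_int: "integrable lebesgue (g j)" for j
    unfolding g_eq by (intro integrable_mult_right mode_window_integrable)
  have g_val: "(\<integral>t. g j t \<partial>lebesgue) = (if j = i then (1/2) ^ i * of_real \<Lambda>1 else 0)" for j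
    unfolding g_eq integral_mult_right_zero mode_window_integral using k by (auto dest: injD)
  have norm_F: "cmod ((1/2) ^ j * mode \<Lambda>1 l t) = (1/2) ^ j" for j l t
    by (simp add: norm_mult norm_power norm_divide)
  have F_sum: "summable (\<lambda>j. (1/2) ^ j * mode \<Lambda>1 (k j) t)" "summable (\<lambda>j. cmod ((1/2) ^ j * mode \<Lambda>1 (k j) t))" for t
  proof -
    show 2: "summable (\<lambda>j. cmod ((1/2) ^ j * mode \<Lambda>1 (k j) t))"
      unfolding norm_F by (rule summable_geometric) simp
    show "summable (\<lambda>j. (1/2) ^ j * mode \<Lambda>1 (k j) t)" using 2 by (rule summable_norm_cancel)
  qed
  have norm_g: "norm (g j t) = (1/2) ^ j * indicat_real {T - \<Lambda>1<..<T} t" for j t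
    using norm_F by (auto simp: g_def)
  have sm1: "AE t in lebesgue. summable (\<lambda>j. norm (g j t))"
    unfolding norm_g by (intro AE_I2 summable_mult2 summable_geometric) simp
  have sm2: "summable (\<lambda>j. \<integral>t. norm (g j t) \<partial>lebesgue)"
    unfolding norm_g by (simp add: summable_mult2 summable_geometric)
  have sum_g: "(\<Sum>j. g j t) = ?W t" for t
  proof -
    have "F t * mode \<Lambda>1 (- k i) t = (\<Sum>j. (1/2) ^ j * mode \<Lambda>1 (k j) t * mode \<Lambda>1 (- k i) t)"
      unfolding F_def by (rule suminf_mult2[OF F_sum(1)])
    then show ?thesis
      by (cases "T - \<Lambda>1 < t \<and> t < T") (simp_all only: g_def mult.assoc mode_mult add_uminus_conv_diff if_True if_False simp_thms suminf_zero)
  qed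
  show "integrable lebesgue (\<lambda>t. ?W t)"
    unfolding sum_g[symmetric] by (rule integrable_suminf[OF g_int sm1 sm2])
  have "(\<integral>t. ?W t \<partial>lebesgue) = (\<Sum>j. \<integral>t. g j t \<partial>lebesgue)"
    unfolding sum_g[symmetric] by (rule integral_suminf[OF g_int sm1 sm2])
  also have "\<dots> = (1/2) ^ i * of_real \<Lambda>1"
    unfolding g_val by (subst suminf_finite[of "{i}"]) auto
  finally show "(\<integral>t. ?W t \<partial>lebesgue) = (1/2) ^ i * of_real \<Lambda>1" .
  have [measurable]: "mode \<Lambda>1 j \<in> borel_measurable lebesgue" for j
    by (simp add: borel_measurable_continuous_onI continuous_on_mode measurable_completion)
  show "F \<in> borel_measurable lebesgue" unfolding F_def by measurable
  have "cmod (F t) \<le> (\<Sum>j. cmod ((1/2) ^ j * mode \<Lambda>1 (k j) t))"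
    unfolding F_def by (rule summable_norm[OF F_sum(2)])
  also have "\<dots> = 2" unfolding norm_F by (subst suminf_geometric) auto
  finally show "cmod (F t) \<le> 2" .
qed

text \<open>If the eigenvalues at k j are at most 4^(- j), pair a response with exp (- s t) times
  the mode - k i. Before the last window this gives the eigenvalue times a bounded integral, on it
  the coefficient 2^(- i) \<Lambda>1 of the target. Reaching the target would thus give 2^(- i)
  \<Lambda>1 \<le> 4^(- i) C for all i.\<close>

lemma exactly_reachable_spectral_gap:
  assumes ex: exactly_reachable and p2: "p2 \<noteq> 0" and T: "\<Lambda>1 < T"
    and s: "exp (s * of_real \<Lambda>1) = q1 - p1 / p2 * q2"
    and nz: "\<And>k. p1 / p2 + exp (s * of_real (\<Lambda>1 - \<Lambda>2)) * mode \<Lambda>1 k (\<Lambda>1 - \<Lambda>2) \<noteq> 0"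
  shows "\<exists>\<delta>>0. \<forall>k. \<delta> \<le> cmod (p1 / p2 + exp (s * of_real (\<Lambda>1 - \<Lambda>2)) * mode \<Lambda>1 k (\<Lambda>1 - \<Lambda>2))"
proof (rule ccontr)
  define ev where "ev k = p1 / p2 + exp (s * of_real (\<Lambda>1 - \<Lambda>2)) * mode \<Lambda>1 k (\<Lambda>1 - \<Lambda>2)" for k
  define \<alpha> where "\<alpha> = q1 - p1 / p2 * q2"
  have \<alpha>: "\<alpha> \<noteq> 0" using s by (metis \<alpha>_def exp_not_eq_zero)
  assume "\<not> ?thesis"
  then have small: "\<exists>k. cmod (ev k) < \<delta>" if "0 < \<delta>" for \<delta>
    using that unfolding ev_def by (meson not_le)
  have ev_pos: "0 < cmod (ev k)" for k using nz unfolding ev_def by simp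
  \<comment> \<open>The moduli are made strictly decreasing to ensure that k is injective.\<close>
  have "\<exists>k :: nat \<Rightarrow> int. \<forall>j. cmod (ev (k j)) \<le> (1/4) ^ j \<and> cmod (ev (k (Suc j))) < cmod (ev (k j))"
  proof (rule dependent_nat_choice)
    show "\<exists>l. cmod (ev l) \<le> (1/4) ^ 0" using small[of 1] by (auto intro: less_imp_le)
    show "\<exists>l. cmod (ev l) \<le> (1/4) ^ Suc j \<and> cmod (ev l) < cmod (ev l')" for l' j
      using small[of "min ((1/4) ^ Suc j) (cmod (ev l'))"] ev_pos[of l'] by (auto intro: less_imp_le)
  qed
  then obtain k :: "nat \<Rightarrow> int" where k: "\<And>j. cmod (ev (k j)) \<le> (1/4) ^ j" "\<And>j. cmod (ev (k (Suc j))) < cmod (ev (k j))"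
    by blast
  have "inj k"
  proof (rule linorder_injI)
    fix i j :: nat assume "i < j"
    then have "cmod (ev (k j)) < cmod (ev (k i))"
      using lift_Suc_mono_less[of "\<lambda>j. - cmod (ev (k j))" i j] k(2) by simp
    then show "k i \<noteq> k j" by auto
  qed
  note coeff = lacunary_fourier_coefficient[OF this]
  define F where "F t = (\<Sum>j. (1/2) ^ j * mode \<Lambda>1 (k j) t)" for t
  let ?E = "\<lambda>t. exp (s * of_real t)" and ?E' = "\<lambda>t. exp (- s * of_real t)"
  have E_inv: "?E t * ?E' t = 1" for t by (simp flip: exp_add)
  define zy where "zy t = (if T - \<Lambda>1 < t \<and> t < T then ?E t * F t else 0)" for t
  have zy: "in_L2 zy"
  proof -
    have "in_L2 (\<lambda>t. F t * (if T - \<Lambda>1 < t \<and> t < T then ?E t else 0))"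
      by (rule in_L2_mult_bounded[OF in_L2_continuous_on_interval])
         (use coeff(3,4) in \<open>auto intro!: continuous_intros simp: F_def\<close>)
    then show ?thesis unfolding zy_def by (rule back_subst[where P = in_L2]) auto
  qed
  \<comment> \<open>This target for w makes p2 w + q2 z vanish on the last window, so the terms with
    \<phi> (t + \<Lambda>2) cancel there.\<close>
  have wy: "in_L2 (\<lambda>t. - (q2 / p2) * zy t)" by (rule in_L2_cmult[OF zy])
  obtain w z where r: "zero_response w z" and
    wz: "AE t in lebesgue. T - \<Lambda>1 < t \<and> t < T \<longrightarrow> w t = - (q2 / p2) * zy t \<and> z t = zy t"
    using ex wy zy unfolding exactly_reachable_def by blast
  have w: "in_L2 w" and z: "in_L2 z" and out: "\<And>t. t \<le> 0 \<or> T \<le> t \<Longrightarrow> w t = 0 \<and> z t = 0"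
    using r by (auto simp: zero_response_def dynamics_def)
  \<comment> \<open>v does not depend on i, and modes have modulus 1; this is why a single C bounds
    the pairings for all i.\<close>
  define v where "v t = (if 0 < t \<and> t < T - \<Lambda>1 then ?E' t * (q2 * z t + p2 * w t) else 0)" for t
  have v: "integrable lebesgue v"
  proof -
    have "in_L2 (\<lambda>t. if 0 < t \<and> t < T - \<Lambda>1 then ?E' t else 0)"
      by (intro in_L2_continuous_on_interval continuous_intros)
    from in_L2_product[OF this in_L2_add[OF in_L2_cmult[OF z, of q2] in_L2_cmult[OF w, of p2]]]
    show ?thesis by (rule back_subst[where P = "integrable lebesgue"]) (auto simp: v_def)
  qed
  define C where "C = (\<integral>t. cmod (v t) \<partial>lebesgue) / cmod \<alpha>"
  have le: "(1/2) ^ i * \<Lambda>1 \<le> (1/4) ^ i * C" for i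
  proof -
    define \<delta> where "\<delta> = ev (k i)"
    let ?m = "mode \<Lambda>1 (- k i)"
    define \<phi> where "\<phi> t = (if 0 < t \<and> t < T then ?E' t * ?m t else 0)" for t
    have \<phi>: "in_L2 \<phi>"
      unfolding \<phi>_def by (intro in_L2_continuous_on_interval continuous_on_mult continuous_on_mode continuous_intros)
    have period: "?m (t + \<Lambda>1) = ?m t" for t
    proof -
      have "?m (t + \<Lambda>1) = ?m t * cis (2 * pi * of_int (- k i))"
        using \<Lambda>1_pos by (simp add: mode_def cis_mult field_simps)
      then show ?thesis using cis_multiple_2pi[of "of_int (- k i)"] by simp
    qed
    have shift1: "?E' (t + \<Lambda>1) * ?m (t + \<Lambda>1) = ?E' t * ?m t / \<alpha>" for t
    proof -
      have "?E' (t + \<Lambda>1) * \<alpha> = ?E' t" unfolding \<alpha>_def s[symmetric] by (simp add: algebra_simps flip: exp_add)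
      then have "?E' (t + \<Lambda>1) = ?E' t / \<alpha>" by (simp only: nonzero_eq_divide_eq[OF \<alpha>])
      then show ?thesis by (simp only: period times_divide_eq_left)
    qed
    \<comment> \<open>Advancing by \<Lambda>2 is advancing by \<Lambda>1 and going back by
      \<Lambda>1 - \<Lambda>2; the second move brings in the eigenvalue.\<close>
    have shift2: "?E' (t + \<Lambda>2) * ?m (t + \<Lambda>2) = ?E' t * ?m t * (\<delta> - p1 / p2) / \<alpha>" for t
    proof -
      have "?E' (t + \<Lambda>2) = ?E' (t + \<Lambda>1) * ?E (\<Lambda>1 - \<Lambda>2)"
        by (simp add: algebra_simps flip: exp_add)
      moreover have "?m (t + \<Lambda>2) = ?m (t + \<Lambda>1) * mode \<Lambda>1 (k i) (\<Lambda>1 - \<Lambda>2)"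
        by (simp add: mode_def cis_mult algebra_simps add_divide_distrib diff_divide_distrib)
      moreover have "\<delta> - p1 / p2 = ?E (\<Lambda>1 - \<Lambda>2) * mode \<Lambda>1 (k i) (\<Lambda>1 - \<Lambda>2)"
        by (simp add: \<delta>_def ev_def)
      ultimately have "?E' (t + \<Lambda>2) * ?m (t + \<Lambda>2) = (?E' (t + \<Lambda>1) * ?m (t + \<Lambda>1)) * (\<delta> - p1 / p2)"
        by (simp only: mult_ac)
      then show ?thesis unfolding shift1 by simp
    qed
    let ?a = "\<lambda>t. \<phi> t - q1 * \<phi> (t + \<Lambda>1) - q2 * \<phi> (t + \<Lambda>2)"
    let ?b = "\<lambda>t. p1 * \<phi> (t + \<Lambda>1) + p2 * \<phi> (t + \<Lambda>2)"
    let ?X = "\<lambda>t. (- \<delta> / \<alpha>) * (?m t * v t)"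
    let ?Y = "\<lambda>t. if T - \<Lambda>1 < t \<and> t < T then F t * ?m t else 0"
    have pointwise: "AE t in lebesgue. z t * ?a t - w t * ?b t = ?X t + ?Y t"
      using wz AE_lebesgue_neq[of "T - \<Lambda>1"]
    proof eventually_elim
      case (elim t)
      consider "t \<le> 0 \<or> T \<le> t" | "0 < t" "t < T - \<Lambda>1" | "T - \<Lambda>1 < t" "t < T"
        using elim by linarith
      then show ?case
      proof cases
        case 1
        then show ?thesis using out[of t] T by (auto simp: v_def)
      next
        case 2
        define e where "e = ?E' t * ?m t"
        have ev: "\<phi> t = e" "\<phi> (t + \<Lambda>1) = e / \<alpha>" "\<phi> (t + \<Lambda>2) = e * (\<delta> - p1 / p2) / \<alpha>"
          unfolding e_def shift1[symmetric] shift2[symmetric] using 2 \<Lambda>1_pos \<Lambda>2_pos \<Lambda>2_less by (auto simp: \<phi>_def)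
        have "?a t = e / \<alpha> * (\<alpha> - q1 - q2 * (\<delta> - p1 / p2))" unfolding ev using \<alpha> by (simp add: field_simps)
        also have "\<alpha> - q1 - q2 * (\<delta> - p1 / p2) = - (\<delta> * q2)" by (simp add: \<alpha>_def algebra_simps)
        finally have a: "?a t = - (\<delta> / \<alpha> * e * q2)" by simp
        have "p1 * (e / \<alpha>) + p2 * (e * d / \<alpha>) = e / \<alpha> * (p1 + p2 * d)" for d
          by (simp add: algebra_simps add_divide_distrib)
        then have "?b t = e / \<alpha> * (p1 + p2 * (\<delta> - p1 / p2))" unfolding ev .
        also have "p1 + p2 * (\<delta> - p1 / p2) = \<delta> * p2" using p2 by (simp add: algebra_simps)
        finally have b: "?b t = \<delta> / \<alpha> * e * p2" by simp
        have X: "?X t = - (\<delta> / \<alpha> * e * (q2 * z t + p2 * w t))" and Y: "?Y t = 0"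
          using 2 by (simp_all add: v_def e_def)
        show ?thesis unfolding a b X Y by (simp add: algebra_simps)
      next
        case 3
        then have "w t = - (q2 / p2) * zy t" "z t = zy t" "\<phi> (t + \<Lambda>1) = 0" "\<phi> t = ?E' t * ?m t" "v t = 0"
          using elim T by (auto simp: \<phi>_def v_def)
        then have "z t * ?a t - w t * ?b t = zy t * (?E' t * ?m t)" using p2 by (simp add: algebra_simps)
        also have "\<dots> = (?E t * ?E' t) * (F t * ?m t)" using 3 by (simp add: zy_def)
        finally show ?thesis using 3 \<open>v t = 0\<close> E_inv[of t] by simp
      qed
    qed
    have a_sq: "in_L2 ?a" and b_sq: "in_L2 ?b"
      by (intro in_L2_intros \<phi> in_L2_shift[OF \<phi>])+
    have mv: "integrable lebesgue (\<lambda>t. ?m t * v t)"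
    proof (rule Bochner_Integration.integrable_bound[OF v])
      show "(\<lambda>t. ?m t * v t) \<in> borel_measurable lebesgue"
        by (intro borel_measurable_times borel_measurable_integrable[OF v])
           (simp add: borel_measurable_continuous_onI continuous_on_mode measurable_completion)
    qed (simp add: norm_mult)
    have Y: "integrable lebesgue ?Y" "(\<integral>t. ?Y t \<partial>lebesgue) = (1/2) ^ i * of_real \<Lambda>1"
      unfolding F_def by (rule coeff)+
    have supp: "\<phi> t = 0" if "t \<le> 0 \<or> T \<le> t" for t using that by (auto simp: \<phi>_def)
    have "0 = (\<integral>t. z t * ?a t \<partial>lebesgue) - (\<integral>t. w t * ?b t \<partial>lebesgue)"
      using dual_identity[OF r \<phi> supp] by simp
    also have "\<dots> = (\<integral>t. z t * ?a t - w t * ?b t \<partial>lebesgue)"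
      using in_L2_product[OF z a_sq] in_L2_product[OF w b_sq] by simp
    also have "\<dots> = (\<integral>t. ?X t + ?Y t \<partial>lebesgue)"
    proof (rule integral_cong_AE[OF _ _ pointwise])
      show "(\<lambda>t. z t * ?a t - w t * ?b t) \<in> borel_measurable lebesgue"
        by (intro borel_measurable_integrable Bochner_Integration.integrable_diff in_L2_product z w a_sq b_sq)
      show "(\<lambda>t. ?X t + ?Y t) \<in> borel_measurable lebesgue"
        by (intro borel_measurable_integrable Bochner_Integration.integrable_add integrable_mult_right mv Y)
    qed
    also have "\<dots> = (- \<delta> / \<alpha>) * (\<integral>t. ?m t * v t \<partial>lebesgue) + (\<integral>t. ?Y t \<partial>lebesgue)"
      using mv Y(1) by (subst Bochner_Integration.integral_add) (auto intro!: integrable_mult_right)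
    finally have "(1/2) ^ i * complex_of_real \<Lambda>1 = \<delta> / \<alpha> * (\<integral>t. ?m t * v t \<partial>lebesgue)"
      unfolding Y(2) by (simp add: algebra_simps)
    then have "cmod ((1/2) ^ i * complex_of_real \<Lambda>1) = cmod (\<delta> / \<alpha> * (\<integral>t. ?m t * v t \<partial>lebesgue))" by simp
    then have "(1/2) ^ i * \<Lambda>1 = cmod \<delta> * (cmod (\<integral>t. ?m t * v t \<partial>lebesgue) / cmod \<alpha>)"
      using \<Lambda>1_pos by (simp add: norm_mult norm_power norm_divide)
    also have "\<dots> \<le> (1/4) ^ i * C"
    proof (rule mult_mono)
      show "cmod \<delta> \<le> (1/4) ^ i" unfolding \<delta>_def by (rule k)
      have "cmod (\<integral>t. ?m t * v t \<partial>lebesgue) \<le> (\<integral>t. cmod (?m t * v t) \<partial>lebesgue)" by (rule integral_norm_bound)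
      then show "cmod (\<integral>t. ?m t * v t \<partial>lebesgue) / cmod \<alpha> \<le> C"
        unfolding C_def by (intro divide_right_mono) (simp_all add: norm_mult)
    qed auto
    finally show ?thesis .
  qed
  obtain i where i: "C / \<Lambda>1 < 2 ^ i" using real_arch_pow[of 2 "C / \<Lambda>1"] by auto
  have "(4 :: real) ^ i * ((1/2) ^ i * \<Lambda>1) \<le> 4 ^ i * ((1/4) ^ i * C)" using le[of i] by (intro mult_left_mono) auto
  moreover have "(4 :: real) ^ i * (1/2) ^ i = 2 ^ i" "(4 :: real) ^ i * (1/4) ^ i = 1"
    by (simp_all flip: power_mult_distrib)
  ultimately have "2 ^ i * \<Lambda>1 \<le> C" by (simp only: mult.assoc[symmetric] mult_1)
  then show False using i \<Lambda>1_pos by (simp add: field_simps)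
qed

end

section \<open>Values of the complex power and the three cases of the theorem\<close>

lemma power_values_zero: "power_values 0 r = {0}"
  by (auto simp: power_values_def)

text \<open>k selects the logarithm Ln \<alpha> + 2 pi i k. Since 1 - \<Lambda>2 / \<Lambda>1 =
  (\<Lambda>1 - \<Lambda>2) / \<Lambda>1, its contribution to the power is the k-th mode at
  \<Lambda>1 - \<Lambda>2. This identifies the values of the power with the spectrum of U.\<close>

lemma power_values_eq_range:
  assumes "0 < \<Lambda>1" "\<alpha> \<noteq> 0"
  shows "power_values \<alpha> (1 - \<Lambda>2 / \<Lambda>1) = range (\<lambda>k. exp (Ln \<alpha> / of_real \<Lambda>1 * of_real (\<Lambda>1 - \<Lambda>2)) * mode \<Lambda>1 k (\<Lambda>1 - \<Lambda>2))"
proof -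
  define r where "r = 1 - \<Lambda>2 / \<Lambda>1"
  have r: "(\<Lambda>1 - \<Lambda>2) / \<Lambda>1 = r" using assms by (simp add: r_def field_simps)
  have "complex_of_real (cmod \<alpha> powr r) * exp (\<i> * complex_of_real ((Arg \<alpha> + 2 * of_int k * pi) * r))
      = exp (Ln \<alpha> / of_real \<Lambda>1 * of_real (\<Lambda>1 - \<Lambda>2)) * mode \<Lambda>1 k (\<Lambda>1 - \<Lambda>2)" for k
  proof -
    have Ln: "Ln \<alpha> = of_real (ln (cmod \<alpha>)) + \<i> * of_real (Arg \<alpha>)"
      by (rule complex_eqI) (simp_all add: Arg_def assms(2))
    have 1: "Ln \<alpha> / of_real \<Lambda>1 * of_real (\<Lambda>1 - \<Lambda>2) = Ln \<alpha> * of_real r"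
      unfolding r[symmetric] by simp
    have 2: "mode \<Lambda>1 k (\<Lambda>1 - \<Lambda>2) = exp (\<i> * of_real (2 * pi * of_int k * r))"
      unfolding r[symmetric] by (simp add: mode_def cis_conv_exp)
    have 3: "complex_of_real (cmod \<alpha> powr r) = exp (of_real (r * ln (cmod \<alpha>)))"
      unfolding exp_of_real using assms(2) by (simp add: powr_def)
    show ?thesis unfolding 1 2 3 unfolding Ln exp_add[symmetric] by (simp add: algebra_simps)
  qed
  then show ?thesis unfolding power_values_def r_def by auto
qed

context planar_system
begin

lemma exactly_controllable_reachable:
  "exact_ctrl \<Longrightarrow> exactly_reachable"
  unfolding exactly_reachable_def using exactly_controllable_scalar by blast

lemma exactly_controllable_if_solvable:
  assumes "2 * \<Lambda>1 \<le> T" "p_coeff A2 B \<noteq> 0" exactly_solvable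
  shows exact_ctrl
  by (rule exactly_controllableI) (rule exact_steering[OF assms])

lemma approximately_controllable_if_solvable:
  assumes "2 * \<Lambda>1 \<le> T" "p_coeff A2 B \<noteq> 0" approximately_solvable
  shows approx_ctrl
  by (rule approximately_controllableI) (rule approximate_steering[OF assms])

lemma approximately_controllable_time:
  "approx_ctrl \<Longrightarrow> 2 * \<Lambda>1 \<le> T"
  using approximable_time_bound approximately_controllable_scalar by blast

text \<open>If the second pair is the controllable one, then p1 = 0, and the failing range inclusion
  is what gives q1 \<noteq> 0, hence the invertible exchange of intervals. Otherwise p2 = 0 and w is
  solved for directly.\<close>

lemma one_controllable_pair:
  assumes "\<not> Ran A1 \<subseteq> Ran B" "controllable A1 B \<noteq> controllable A2 B" and T: "2 * \<Lambda>1 \<le> T"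
  shows exact_ctrl
proof (cases "controllable A2 B")
  case True
  then have "p_coeff A1 B = 0" "p_coeff A2 B \<noteq> 0" "q_coeff A1 B \<noteq> 0"
    using assms by (auto simp: controllable_iff Ran_subset_iff[OF B_nonzero])
  then show ?thesis by (intro exactly_controllable_if_solvable T exactly_solvable_p1_zero)
next
  case False
  then have "p_coeff A2 B = 0" "p_coeff A1 B \<noteq> 0"
    using assms by (auto simp: controllable_iff)
  then show ?thesis by (intro exactly_controllableI exact_steering_p2_zero T)
qed

lemma both_controllable_pairs:
  fixes S
  assumes p: "p_coeff A1 B \<noteq> 0" "p_coeff A2 B \<noteq> 0"
  defines "\<beta> \<equiv> p_coeff A1 B / p_coeff A2 B"
  defines "\<alpha> \<equiv> q_coeff A1 B - \<beta> * q_coeff A2 B"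
  defines "S \<equiv> {\<beta> + z | z. z \<in> power_values \<alpha> (1 - \<Lambda>2 / \<Lambda>1)}"
  shows "approx_ctrl \<longleftrightarrow> 2 * \<Lambda>1 \<le> T \<and> 0 \<notin> S"
    and "exact_ctrl \<longleftrightarrow> 2 * \<Lambda>1 \<le> T \<and> 0 \<notin> closure S"
proof -
  have "(approx_ctrl \<longleftrightarrow> 2 * \<Lambda>1 \<le> T \<and> 0 \<notin> S) \<and>
    (exact_ctrl \<longleftrightarrow> 2 * \<Lambda>1 \<le> T \<and> 0 \<notin> closure S)"
  proof (cases "\<alpha> = 0")
    case True
    \<comment> \<open>For \<alpha> = 0 the set S is the closed singleton of \<beta>, which is
      nonzero because the first pair is controllable; both spectral conditions then hold.\<close>
    have "\<beta> \<noteq> 0" using p by (simp add: \<beta>_def)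
    then have "0 \<notin> S" "0 \<notin> closure S" unfolding S_def True power_values_zero by simp_all
    moreover have exact_ctrl if "2 * \<Lambda>1 \<le> T"
      using that p(2) \<open>\<beta> \<noteq> 0\<close> True unfolding \<alpha>_def \<beta>_def
      by (intro exactly_controllable_if_solvable exactly_solvable_nilpotent)
    ultimately show ?thesis
      using approximately_controllable_time exactly_imp_approximately_controllable by blast
  next
    case False
    define s where "s = Ln \<alpha> / of_real \<Lambda>1"
    have s: "exp (s * of_real \<Lambda>1) = \<alpha>" using False \<Lambda>1_pos by (simp add: s_def)
    interpret E: quasi_shift_equation \<alpha> \<beta> s \<Lambda>1 \<Lambda>2
      by unfold_locales (use \<Lambda>2_pos \<Lambda>2_less s in auto)
    have S: "S = range E.eigenvalue"
      unfolding S_def power_values_eq_range[OF \<Lambda>1_pos False, folded s_def] by (auto simp only: E.eigenvalue_def image_iff)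
    have approx: "2 * \<Lambda>1 \<le> T \<and> 0 \<notin> S" if a: approx_ctrl
    proof
      show "2 * \<Lambda>1 \<le> T" by (rule approximately_controllable_time[OF a])
      show "0 \<notin> S"
      proof
        assume "0 \<in> S"
        then obtain k where k: "E.eigenvalue k = 0" unfolding S by (metis rangeE)
        \<comment> \<open>The mode is absorbed into the exponent: s' \<Lambda>1 is the k-th
          logarithm of \<alpha>, and the vanishing eigenvalue becomes exp (s' (\<Lambda>1 -
          \<Lambda>2)) = - \<beta>.\<close>
        define s' where "s' = s + 2 * pi * \<i> * of_int k / of_real \<Lambda>1"
        have "s' * of_real \<Lambda>1 = s * of_real \<Lambda>1 + (2 * of_int k * pi) * \<i>"
          using \<Lambda>1_pos by (simp add: s'_def field_simps)
        then have 1: "exp (s' * of_real \<Lambda>1) = \<alpha>" using exp_integer_2pi[OF Ints_of_int[of k]] by (simp add: exp_add s)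
        have "exp (s' * of_real (\<Lambda>1 - \<Lambda>2)) = exp (s * of_real (\<Lambda>1 - \<Lambda>2)) * mode \<Lambda>1 k (\<Lambda>1 - \<Lambda>2)"
          unfolding mode_def cis_conv_exp exp_add[symmetric] s'_def by (simp add: algebra_simps)
        then have 2: "exp (s' * of_real (\<Lambda>1 - \<Lambda>2)) = - \<beta>"
          using k unfolding E.eigenvalue_def by (simp add: add_eq_0_iff)
        show False
          using approximable_no_eigenvalue[OF approximately_controllable_scalar[OF a] p(2), of s'] 1 2
          unfolding \<alpha>_def \<beta>_def by blast
      qed
    qed
    moreover have approx_ctrl if T: "2 * \<Lambda>1 \<le> T" and "0 \<notin> S"
    proof (rule approximately_controllable_if_solvable[OF T p(2)])
      have nz: "E.eigenvalue k \<noteq> 0" for k using \<open>0 \<notin> S\<close> unfolding S by (metis rangeI)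
      show approximately_solvable
        unfolding approximately_solvable_def \<beta>_def[symmetric] \<alpha>_def[symmetric]
      proof (intro allI impI)
        fix h and \<epsilon> :: real assume "in_L2 h" "0 < \<epsilon>"
        then obtain m where "in_L2 m" "energy \<Lambda>1 (\<lambda>c. E.op m c - h c) < \<epsilon>"
          using E.approximate_inverse[OF nz, of 0 h \<epsilon>] by auto
        then show "\<exists>m. in_L2 m \<and> (\<integral>c. (if 0 < c \<and> c < \<Lambda>1
            then (cmod (\<beta> * m c + quasi_shift \<alpha> \<Lambda>1 \<Lambda>2 m c - h c))\<^sup>2 else 0) \<partial>lebesgue) < \<epsilon>"
          unfolding energy_def E.op_def by blast
      qed
    qed
    moreover have "2 * \<Lambda>1 \<le> T \<and> 0 \<notin> closure S" if e: exact_ctrl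
    proof -
      have T: "2 * \<Lambda>1 \<le> T" and nz: "0 \<notin> S"
        using approx[OF exactly_imp_approximately_controllable[OF e]] by auto
      have nz': "E.eigenvalue k \<noteq> 0" for k using nz unfolding S by (metis rangeI)
      have "\<exists>\<delta>>0. \<forall>k. \<delta> \<le> cmod (E.eigenvalue k)"
        using exactly_reachable_spectral_gap[OF exactly_controllable_reachable[OF e] p(2), of s,
            folded \<beta>_def, folded \<alpha>_def E.eigenvalue_def] T \<Lambda>1_pos s nz' by simp
      then have "0 \<notin> closure S" unfolding S closure_approachable by (auto simp: not_less)
      with T show ?thesis by blast
    qed
    moreover have exact_ctrl if T: "2 * \<Lambda>1 \<le> T" and c: "0 \<notin> closure S"
    proof (rule exactly_controllable_if_solvable[OF T p(2)])
      obtain \<delta> where "0 < \<delta>" "\<And>k. \<delta> \<le> cmod (E.eigenvalue k)"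
        using c unfolding S closure_approachable by (auto simp: not_less)
      then show exactly_solvable
        unfolding exactly_solvable_def \<beta>_def[symmetric] \<alpha>_def[symmetric]
        using E.exact_inverse[unfolded E.op_def] by blast
    qed
    ultimately show ?thesis by blast
  qed
  then show "approx_ctrl \<longleftrightarrow> 2 * \<Lambda>1 \<le> T \<and> 0 \<notin> S"
    and "exact_ctrl \<longleftrightarrow> 2 * \<Lambda>1 \<le> T \<and> 0 \<notin> closure S" by blast+
qed

end

theorem theorem4p1:
  fixes A1 A2 :: "complex^2^2" and B :: "complex^1^2" and T \<Lambda>1 \<Lambda>2 :: real
  assumes "B \<noteq> 0" and "T > 0" and "\<Lambda>1 > 0" and "\<Lambda>2 > 0" and "\<Lambda>1 > \<Lambda>2"
  shows
    "(Ran A1 \<subseteq> Ran B \<or> (\<not> controllable A1 B \<and> \<not> controllable A2 B) \<longrightarrow>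
        \<not> approximately_controllable A1 A2 B \<Lambda>1 \<Lambda>2 T \<and>
        \<not> exactly_controllable A1 A2 B \<Lambda>1 \<Lambda>2 T)
     \<and>
     (\<not> Ran A1 \<subseteq> Ran B \<and> (controllable A1 B \<noteq> controllable A2 B) \<longrightarrow>
        (approximately_controllable A1 A2 B \<Lambda>1 \<Lambda>2 T \<longleftrightarrow>
           exactly_controllable A1 A2 B \<Lambda>1 \<Lambda>2 T) \<and>
        (exactly_controllable A1 A2 B \<Lambda>1 \<Lambda>2 T \<longleftrightarrow> T \<ge> 2 * \<Lambda>1))
     \<and>
     (controllable A1 B \<and> controllable A2 B \<longrightarrow>
        (let \<beta> = det (ctrb A1 B) / det (ctrb A2 B);
             \<alpha> = det (two_columns (column 1 B) ((A1 - map_matrix ((*) \<beta>) A2) *v perp B));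
             S = {\<beta> + z | z. z \<in> power_values \<alpha> (1 - \<Lambda>2 / \<Lambda>1)}
         in (approximately_controllable A1 A2 B \<Lambda>1 \<Lambda>2 T \<longleftrightarrow> T \<ge> 2 * \<Lambda>1 \<and> 0 \<notin> S) \<and>
            (exactly_controllable A1 A2 B \<Lambda>1 \<Lambda>2 T \<longleftrightarrow> T \<ge> 2 * \<Lambda>1 \<and> 0 \<notin> closure S)))"
proof -
  interpret planar_system A1 A2 B \<Lambda>1 \<Lambda>2 T
    using assms by unfold_locales
  have a: "\<not> approx_ctrl"
    if "Ran A1 \<subseteq> Ran B \<or> (\<not> controllable A1 B \<and> \<not> controllable A2 B)"
    using that not_approximable_no_first_delay not_approximable_uncontrolled approximately_controllable_scalar
    by (auto simp: Ran_subset_iff[OF B_nonzero] controllable_iff)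
  have b: "(approx_ctrl \<longleftrightarrow> exact_ctrl) \<and>
      (exact_ctrl \<longleftrightarrow> T \<ge> 2 * \<Lambda>1)"
    if "\<not> Ran A1 \<subseteq> Ran B \<and> (controllable A1 B \<noteq> controllable A2 B)"
    using that one_controllable_pair approximately_controllable_time exactly_imp_approximately_controllable by blast
  show ?thesis
    unfolding Let_def det_ctrb alpha_eq
  proof (intro conjI impI, goal_cases)
    case 1
    then show ?case by (rule a)
  next
    case 2
    then show ?case using a exactly_imp_approximately_controllable by blast
  next
    case 3
    then show ?case using b by blast
  next
    case 4
    then show ?case using b by blast
  next
    case 5
    then show ?case by (intro both_controllable_pairs(1)) (simp_all add: controllable_iff)
  next
    case 6
    then show ?case by (intro both_controllable_pairs(2)) (simp_all add: controllable_iff)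
  qed
qed

end
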